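(* Let $V$ be a scanning function computable in polynomial space that is $g$-filling for some polynomial $g$. If $Z\subseteq\mathbb{N}$ is polynomial space random, then so is $Z \circ V$.
   Context: Subsets of $\mathbb{N}$ are identified with languages over the unary alphabet $\{0\}$. A scanning function is a function $V\colon \{0,1\}^* \to \{0\}^*$ (values identified with natural numbers) such that $V(\alpha) \neq V(\alpha\upharpoonright i)$ for every $\alpha\in\{0,1\}^*$ and every $i<|\alpha|$; $V(\alpha\upharpoonright i)$ is called the $i$-th query in the run of $V$ on $\alpha$. For $Z\subseteq\mathbb{N}$, $Z\circ V$ is the set $Y\subseteq\mathbb{N}$ defined recursively by $Y(i)=Z(V(Y\upharpoonright i))$ for each $i$. For $g\colon\mathbb{N}\to\mathbb{N}$, $V$ is $g$-filling if for every $n$ and every $\alpha\in\{0,1\}^{g(n)}$, for every $r<n$ there is $i$ with $V(\alpha\upharpoonright i)=r$. A martingale is a function $M$ from $\{0,1\}^*$ to the positive rationals with $M(x)=(M(x0)+M(x1))/2$ for all $x$; it succeeds on $Z$ if $\limsup_n M(Z\upharpoonright n)=\infty$. A martingale is computable in polynomial space if $M(x)$ (as a rational in lowest terms, numerator and denominator in binary) can be computed in space polynomial in $|x|$, including the space for writing the output. $Z$ is polynomial space random if no martingale computable in polynomial space succeeds on $Z$. *)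

theory Defs
  imports
    Complex_Main
    "HOL-Library.Extended_Real"
    "HOL-Library.Liminf_Limsup"
    "HOL-Computational_Algebra.Polynomial"
begin

section \<open>Turing machines and polynomial space\<close>

text \<open>
  Deterministic multi-tape Turing machines. Symbols are natural numbers below the alphabet size
  and states are natural numbers. A tape consists of its cells \<open>0, 1, 2, \<dots>\<close> and the position of
  its head. A machine is the list of its commands: the state \<open>q < length P\<close> executes the
  command \<open>P ! q\<close>, and every other state is halting. A command receives the list of symbols
  under the heads and returns the next state and, for each tape, the symbol to be written and
  the head move.
\<close>

type_synonym symbol = nat
type_synonym tape = "(nat \<Rightarrow> symbol) \<times> nat"
type_synonym tm_config = "nat \<times> tape list"

datatype head_move = MoveLeft | MoveStay | MoveRight

type_synonym command = "symbol list \<Rightarrow> nat \<times> (symbol \<times> head_move) list"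
type_synonym machine = "command list"

abbreviation blank_sym :: symbol where "blank_sym \<equiv> 0"
abbreviation start_sym :: symbol where "start_sym \<equiv> 1"
abbreviation zero_sym :: symbol where "zero_sym \<equiv> 2"
abbreviation one_sym :: symbol where "one_sym \<equiv> 3"
abbreviation sep_sym :: symbol where "sep_sym \<equiv> 4"

definition turing_machine :: "nat \<Rightarrow> nat \<Rightarrow> machine \<Rightarrow> bool" where
  "turing_machine k G P \<longleftrightarrow> 2 \<le> k \<and> 5 \<le> G \<and>
     (\<forall>q < length P. \<forall>rs. length rs = k \<and> set rs \<subseteq> {..<G} \<longrightarrow>
        fst ((P ! q) rs) \<le> length P \<and>
        length (snd ((P ! q) rs)) = k \<and>
        fst ` set (snd ((P ! q) rs)) \<subseteq> {..<G})"

definition tape_read :: "tape \<Rightarrow> symbol" where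
  "tape_read t = fst t (snd t)"

text \<open>Moving left from the leftmost cell leaves the head in place.\<close>

fun move_head :: "head_move \<Rightarrow> nat \<Rightarrow> nat" where
  "move_head MoveLeft i = i - 1"
| "move_head MoveStay i = i"
| "move_head MoveRight i = i + 1"

definition tape_act :: "symbol \<times> head_move \<Rightarrow> tape \<Rightarrow> tape" where
  "tape_act a t = ((fst t)(snd t := fst a), move_head (snd a) (snd t))"

definition tm_step :: "machine \<Rightarrow> tm_config \<Rightarrow> tm_config" where
  "tm_step P c =
     (if fst c < length P
      then let r = (P ! fst c) (map tape_read (snd c))
           in (fst r, map2 tape_act (snd r) (snd c))
      else c)"

definition tape_content :: "symbol list \<Rightarrow> nat \<Rightarrow> symbol" where
  "tape_content w i =
     (if i = 0 then start_sym else if i \<le> length w then w ! (i - 1) else blank_sym)"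

definition bits_syms :: "bool list \<Rightarrow> symbol list" where
  "bits_syms x = map (\<lambda>b. if b then one_sym else zero_sym) x"

text \<open>Tape 0 is the input tape and tape 1 is the output tape.\<close>

definition tm_init :: "nat \<Rightarrow> bool list \<Rightarrow> tm_config" where
  "tm_init k x = (0, (tape_content (bits_syms x), 0) # replicate (k - 1) (tape_content [], 0))"

definition tm_run :: "machine \<Rightarrow> nat \<Rightarrow> bool list \<Rightarrow> nat \<Rightarrow> tm_config" where
  "tm_run P k x t = (tm_step P ^^ t) (tm_init k x)"

definition tm_outputs :: "machine \<Rightarrow> nat \<Rightarrow> bool list \<Rightarrow> symbol list \<Rightarrow> bool" where
  "tm_outputs P k x y \<longleftrightarrow>
     (\<exists>t. fst (tm_run P k x t) \<ge> length P \<and> fst (snd (tm_run P k x t) ! 1) = tape_content y)"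

text \<open>
  The bound concerns all tapes, the output tape included. Heads start in cell 0 and move by at
  most one cell, so the visited cells of a tape are exactly those up to the largest head position.
\<close>

definition tm_space_bounded :: "machine \<Rightarrow> nat \<Rightarrow> bool list \<Rightarrow> nat \<Rightarrow> bool" where
  "tm_space_bounded P k x s \<longleftrightarrow> (\<forall>t. \<forall>j < k. snd (snd (tm_run P k x t) ! j) \<le> s)"

definition polyspace_computable :: "(bool list \<Rightarrow> symbol list) \<Rightarrow> bool" where
  "polyspace_computable f \<longleftrightarrow>
     (\<exists>k G P. \<exists>p :: nat poly. turing_machine k G P \<and>
        (\<forall>x. tm_outputs P k x (f x) \<and> tm_space_bounded P k x (poly p (length x))))"

section \<open>Martingales and polynomial space randomness\<close>

definition set_prefix :: "nat set \<Rightarrow> nat \<Rightarrow> bool list" where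
  "set_prefix Z n = map (\<lambda>i. i \<in> Z) [0..<n]"

definition martingale :: "(bool list \<Rightarrow> rat) \<Rightarrow> bool" where
  "martingale M \<longleftrightarrow>
     (\<forall>x. M x > 0) \<and> (\<forall>x. M x = (M (x @ [False]) + M (x @ [True])) / 2)"

definition succeeds_on :: "(bool list \<Rightarrow> rat) \<Rightarrow> nat set \<Rightarrow> bool" where
  "succeeds_on M Z \<longleftrightarrow> limsup (\<lambda>n. ereal (real_of_rat (M (set_prefix Z n)))) = \<infinity>"

text \<open>Binary notation, most significant bit first, without leading zeros.\<close>

fun binary :: "nat \<Rightarrow> bool list" where
  "binary n = (if n = 0 then [] else binary (n div 2) @ [odd n])"

declare binary.simps [simp del]

text \<open>
  Only used for positive rationals; \<^const>\<open>quotient_of\<close> yields numerator and denominator in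
  lowest terms, the denominator being positive.
\<close>

definition rat_syms :: "rat \<Rightarrow> symbol list" where
  "rat_syms r = bits_syms (binary (nat (fst (quotient_of r)))) @ [sep_sym] @
                bits_syms (binary (nat (snd (quotient_of r))))"

definition polyspace_martingale :: "(bool list \<Rightarrow> rat) \<Rightarrow> bool" where
  "polyspace_martingale M \<longleftrightarrow> martingale M \<and> polyspace_computable (\<lambda>x. rat_syms (M x))"

definition polyspace_random :: "nat set \<Rightarrow> bool" where
  "polyspace_random Z \<longleftrightarrow> \<not> (\<exists>M. polyspace_martingale M \<and> succeeds_on M Z)"

section \<open>Scanning functions\<close>

definition scanning_function :: "(bool list \<Rightarrow> nat) \<Rightarrow> bool" where
  "scanning_function V \<longleftrightarrow> (\<forall>\<alpha>. \<forall>i < length \<alpha>. V \<alpha> \<noteq> V (take i \<alpha>))"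

text \<open>The value \<open>n\<close> of a scanning function stands for the string \<open>0\<^sup>n\<close>.\<close>

definition polyspace_scanning_function :: "(bool list \<Rightarrow> nat) \<Rightarrow> bool" where
  "polyspace_scanning_function V \<longleftrightarrow>
     scanning_function V \<and> polyspace_computable (\<lambda>\<alpha>. replicate (V \<alpha>) zero_sym)"

definition filling :: "(nat \<Rightarrow> nat) \<Rightarrow> (bool list \<Rightarrow> nat) \<Rightarrow> bool" where
  "filling g V \<longleftrightarrow>
     (\<forall>n \<alpha>. length \<alpha> = g n \<longrightarrow> (\<forall>r < n. \<exists>i \<le> length \<alpha>. V (take i \<alpha>) = r))"

text \<open>Real coefficients also cover functions such as \<open>n(n + 1)/2\<close>.\<close>

definition polynomial_function :: "(nat \<Rightarrow> nat) \<Rightarrow> bool" where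
  "polynomial_function g \<longleftrightarrow> (\<exists>p :: real poly. \<forall>n. real (g n) = poly p (real n))"

fun scan_prefix :: "nat set \<Rightarrow> (bool list \<Rightarrow> nat) \<Rightarrow> nat \<Rightarrow> bool list" where
  "scan_prefix Z V 0 = []"
| "scan_prefix Z V (Suc i) = scan_prefix Z V i @ [V (scan_prefix Z V i) \<in> Z]"

definition scan :: "nat set \<Rightarrow> (bool list \<Rightarrow> nat) \<Rightarrow> nat set" where
  "scan Z V = {i. V (scan_prefix Z V i) \<in> Z}"

lemma set_prefix_scan: "set_prefix (scan Z V) n = scan_prefix Z V n"
  by (induction n) (simp_all add: set_prefix_def scan_def)

lemma scan_iff: "i \<in> scan Z V \<longleftrightarrow> V (set_prefix (scan Z V) i) \<in> Z"
  by (simp add: set_prefix_scan) (simp add: scan_def)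

lemma scan_unique:
  assumes "\<And>i. i \<in> Y \<longleftrightarrow> V (set_prefix Y i) \<in> Z"
  shows "Y = scan Z V"
proof -
  have pre: "set_prefix Y n = scan_prefix Z V n" for n
  proof (induction n)
    case (Suc n)
    have "set_prefix Y (Suc n) = set_prefix Y n @ [n \<in> Y]"
      by (simp add: set_prefix_def)
    then show ?case using Suc assms[of n] by simp
  qed (simp add: set_prefix_def)
  then show ?thesis using assms by (auto simp: scan_def)
qed

end

theory Submission
  imports Defs "HOL-Library.Nat_Bijection"
begin

text \<open>
  Suppose that a polynomial space martingale \<open>M\<close> succeeds on \<open>scan Z V\<close>. First replace it by a martingale
  \<open>S\<close> with savings: each time \<open>M\<close> reaches the next power of 2, half of the capital in play is put
  aside, so that \<open>S\<close> tends to infinity along \<open>scan Z V\<close> and cannot fall below its savings later. All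
  bets are rounded to dyadic rationals, since the average below runs over exponentially many values
  and arbitrary denominators would not have a common multiple of polynomial length. Given a string
  \<open>x\<close> of length \<open>n\<close>, let \<open>L x\<close> be the average of \<open>S \<alpha>\<close> over the strings \<open>\<alpha>\<close> of polynomial length
  \<open>h n > g n\<close> that answer all queries below \<open>n\<close> according to \<open>x\<close>. By the filling property all these
  queries have been asked within \<open>\<alpha>\<close>, so prolonging \<open>\<alpha>\<close> does not change the average, and \<open>L\<close> is a
  martingale. For large \<open>n\<close> every \<open>\<alpha>\<close> consistent with \<open>Z\<close> up to \<open>n\<close> extends a given initial segment of
  \<open>scan Z V\<close>, so \<open>L\<close> succeeds on \<open>Z\<close> thanks to the savings.

  For the complexity bound, polynomial space is characterised by counter programs whose registers have
  polynomially many bits. Since time is free, the functions computed in this way are closed under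
  bounded recursion and exponentially long sums, and they can simulate Turing machines.
\<close>

section \<open>Counter programs and their compilation to Turing machines\<close>

text \<open>The obstacle is that \<open>V\<close> asks for the bits of \<open>Z\<close> in an order
  that depends on the answers. When \<open>Z\<close> is read in its natural order, a run of
  \<open>V\<close> is known only with gaps, and a bet that \<open>M\<close> places behind a gap
  cannot be copied. Averaging over the missing answers merges all these conditional bets into one
  bet on the next bit of \<open>Z\<close>. Each query below \<open>n\<close> occurs exactly once, so
  \<open>2 ^ (h n - n)\<close> of the \<open>2 ^ h n\<close> strings are consistent, which fixes the
  normalisation.

  Rounding is applied to the increments of the martingale, not to its values: opposite increments at
  siblings keep the game exactly fair. A constant \<open>c \<ge> M [] + 1\<close> pays for the
  initial stake and for the rounding, so that \<open>S\<close> stays above its savings and in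
  particular positive.

  At length \<open>m\<close> the denominators of \<open>S\<close> divide \<open>2 ^ (2 * m)\<close>,
  because the stake has been halved at most once per bit; the average adds a factor
  \<open>2 ^ m\<close>. So \<open>2 ^ (3 * m)\<close> is a common denominator, and it remains to
  compute natural numerators and to reduce the fraction.\<close>

datatype prog =
    Inc nat
  | Dec nat
  | Emit symbol
  | Seq prog prog (infixr ";;" 60)
  | While nat prog
  | Read prog prog

type_synonym pstate = "(nat \<Rightarrow> nat) \<times> bool list \<times> symbol list"

text \<open>
  A state consists of the registers, the unread input and the output written so far. The
  parameter \<open>L\<close> bounds the binary length of the registers and the length of the output; together
  with the fact that running time is not restricted, this makes naive counting loops a faithful
  model of space bounded computation.
\<close>

inductive run :: "nat \<Rightarrow> prog \<Rightarrow> pstate \<Rightarrow> pstate \<Rightarrow> bool" for L where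
  run_Inc: "s r + 1 < 2 ^ L \<Longrightarrow> run L (Inc r) (s, xs, ys) (s(r := s r + 1), xs, ys)"
| run_Dec: "run L (Dec r) (s, xs, ys) (s(r := s r - 1), xs, ys)"
| run_Emit: "length ys < L \<Longrightarrow> run L (Emit a) (s, xs, ys) (s, xs, ys @ [a])"
| run_Seq: "run L c st st' \<Longrightarrow> run L d st' st'' \<Longrightarrow> run L (c ;; d) st st''"
| run_While_0: "s r = 0 \<Longrightarrow> run L (While r c) (s, xs, ys) (s, xs, ys)"
| run_While_Suc: "s r \<noteq> 0 \<Longrightarrow> run L c (s, xs, ys) st' \<Longrightarrow> run L (While r c) st' st'' \<Longrightarrow>
    run L (While r c) (s, xs, ys) st''"
| run_Read_Nil: "run L (Read c d) (s, [], ys) (s, [], ys)"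
| run_Read_Cons: "run L (if b then d else c) (s, xs, ys) st' \<Longrightarrow> run L (Read c d) (s, b # xs, ys) st'"

lemma run_mono: "run L c st st' \<Longrightarrow> L \<le> L' \<Longrightarrow> run L' c st st'"
proof (induction rule: run.induct)
  case (run_Inc s r xs ys)
  then show ?case
    by (intro run.run_Inc) (meson less_le_trans one_le_numeral power_increasing)
qed (auto intro: run.intros simp del: One_nat_def)

fun wf_prog :: "nat \<Rightarrow> prog \<Rightarrow> bool" where
  "wf_prog w (Inc r) \<longleftrightarrow> r < w"
| "wf_prog w (Dec r) \<longleftrightarrow> r < w"
| "wf_prog w (Emit a) \<longleftrightarrow> a < 5"
| "wf_prog w (c ;; d) \<longleftrightarrow> wf_prog w c \<and> wf_prog w d"
| "wf_prog w (While r c) \<longleftrightarrow> r < w \<and> wf_prog w c"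
| "wf_prog w (Read c d) \<longleftrightarrow> wf_prog w c \<and> wf_prog w d"

lemma wf_prog_mono: "wf_prog w c \<Longrightarrow> w \<le> w' \<Longrightarrow> wf_prog w' c"
  by (induction c) auto

section \<open>Compiling programs to machine code\<close>

definition tape_cmd :: "nat \<Rightarrow> (symbol \<Rightarrow> nat \<times> symbol \<times> head_move) \<Rightarrow> command" where
  "tape_cmd j \<delta> = (\<lambda>rs. case \<delta> (rs ! j) of
     (q, a, m) \<Rightarrow> (q, (map (\<lambda>s. (s, MoveStay)) rs)[j := (a, m)]))"

fun prog_size :: "prog \<Rightarrow> nat" where
  "prog_size (Inc r) = 2"
| "prog_size (Dec r) = 3"
| "prog_size (Emit a) = 1"
| "prog_size (c ;; d) = prog_size c + prog_size d"
| "prog_size (While r c) = prog_size c + 4"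
| "prog_size (Read c d) = prog_size c + prog_size d + 2"

definition return_cmd :: "nat \<Rightarrow> nat \<Rightarrow> nat \<Rightarrow> command" where
  "return_cmd j q q' = tape_cmd j
     (\<lambda>s. if s = start_sym then (q', s, MoveStay) else (q, s, MoveLeft))"

text \<open>Shared by \<open>Dec\<close> and \<open>While\<close>: the head looks for the lowest
  digit one. If there is one, it is replaced by \<open>a\<close> and control goes to
  \<open>q + 1\<close>; \<open>Dec\<close> uses \<open>zero_sym\<close>, and \<open>While\<close>
  uses \<open>one_sym\<close>, which leaves the tape as it was. Meeting a blank means that the
  register is 0 and leads to \<open>q + 2\<close>.\<close>

definition test_cmd :: "nat \<Rightarrow> nat \<Rightarrow> symbol \<Rightarrow> command" where
  "test_cmd j q a = tape_cmd j
     (\<lambda>s. if s = start_sym \<or> s = zero_sym then (q, s, MoveRight)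
          else if s = one_sym then (q + 1, a, MoveLeft) else (q + 2, s, MoveLeft))"

definition inc_cmd :: "nat \<Rightarrow> nat \<Rightarrow> command" where
  "inc_cmd j q = tape_cmd j (\<lambda>s. if s = start_sym then (q, s, MoveRight)
     else if s = one_sym then (q, zero_sym, MoveRight) else (q + 1, one_sym, MoveLeft))"

definition read_cmd :: "nat \<Rightarrow> nat \<Rightarrow> nat \<Rightarrow> command" where
  "read_cmd q0 q1 q' = tape_cmd 0 (\<lambda>s. if s = zero_sym then (q0, s, MoveRight)
     else if s = one_sym then (q1, s, MoveRight) else (q', s, MoveStay))"

text \<open>
  Tape \<open>r + 2\<close> holds register \<open>r\<close> in binary, least significant bit first, possibly with superfluous
  zeros, and its head rests on the start symbol between commands. The code starts at address \<open>q\<close>.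
\<close>

fun compile :: "nat \<Rightarrow> prog \<Rightarrow> machine" where
  "compile q (Inc r) =
     [inc_cmd (r + 2) q, return_cmd (r + 2) (q + 1) (q + 2)]"
| "compile q (Dec r) =
     [test_cmd (r + 2) q zero_sym,
      tape_cmd (r + 2) (\<lambda>s. if s = start_sym then (q + 3, s, MoveStay) else (q + 1, one_sym, MoveLeft)),
      return_cmd (r + 2) (q + 2) (q + 3)]"
| "compile q (Emit a) = [tape_cmd 1 (\<lambda>s. (q + 1, a, MoveRight))]"
| "compile q (c ;; d) = compile q c @ compile (q + prog_size c) d"
| "compile q (While r c) =
     [test_cmd (r + 2) q one_sym,
      return_cmd (r + 2) (q + 1) (q + 3),
      return_cmd (r + 2) (q + 2) (q + 4 + prog_size c)] @
     compile (q + 3) c @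
     [tape_cmd 0 (\<lambda>s. (q, s, MoveStay))]"
| "compile q (Read c d) =
     [read_cmd (q + 1) (q + 2 + prog_size c) (q + 2 + prog_size c + prog_size d)] @
     compile (q + 1) c @
     [tape_cmd 0 (\<lambda>s. (q + 2 + prog_size c + prog_size d, s, MoveStay))] @
     compile (q + 2 + prog_size c) d"

lemma length_compile [simp]: "length (compile q c) = prog_size c"
  by (induction c arbitrary: q) auto

definition wf_command :: "nat \<Rightarrow> nat \<Rightarrow> command \<Rightarrow> bool" where
  "wf_command k e C \<longleftrightarrow> (\<forall>rs. length rs = k \<and> set rs \<subseteq> {..<5} \<longrightarrow>
     fst (C rs) \<le> e \<and> length (snd (C rs)) = k \<and> fst ` set (snd (C rs)) \<subseteq> {..<5})"

lemma wf_tape_cmd: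
  assumes "j < k" and "\<And>s. s < 5 \<Longrightarrow> fst (\<delta> s) \<le> e \<and> fst (snd (\<delta> s)) < 5"
  shows "wf_command k e (tape_cmd j \<delta>)"
  unfolding wf_command_def
proof (intro allI impI)
  fix rs :: "symbol list"
  assume rs: "length rs = k \<and> set rs \<subseteq> {..<5}"
  obtain q a m where d: "\<delta> (rs ! j) = (q, a, m)" by (cases "\<delta> (rs ! j)")
  have "rs ! j < 5" using rs assms(1) by (meson lessThan_iff nth_mem subsetD)
  then have "q \<le> e" "a < 5" using assms(2)[of "rs ! j"] d by auto
  moreover have "fst ` set ((map (\<lambda>s. (s, MoveStay)) rs)[j := (a, m)]) \<subseteq> insert a (set rs)"
    using set_update_subset_insert[of "map (\<lambda>s. (s, MoveStay)) rs" j "(a, m)"] by auto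
  ultimately show "fst (tape_cmd j \<delta> rs) \<le> e \<and> length (snd (tape_cmd j \<delta> rs)) = k \<and>
      fst ` set (snd (tape_cmd j \<delta> rs)) \<subseteq> {..<5}"
    using rs d by (auto simp: tape_cmd_def)
qed

lemma wf_compile:
  "wf_prog w c \<Longrightarrow> C \<in> set (compile q c) \<Longrightarrow> q + prog_size c \<le> e \<Longrightarrow> wf_command (w + 2) e C"
proof (induction c arbitrary: q)
  case (Seq c d)
  then show ?case using Seq.IH(1)[of q] Seq.IH(2)[of "q + prog_size c"] by auto
next
  case (While r c)
  then show ?case using While.IH[of "q + 3"]
    by (auto simp: test_cmd_def return_cmd_def intro!: wf_tape_cmd)
next
  case (Read c d)
  then show ?case using Read.IH(1)[of "q + 1"] Read.IH(2)[of "q + 2 + prog_size c"]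
    by (auto simp: read_cmd_def intro!: wf_tape_cmd)
qed (auto simp: test_cmd_def return_cmd_def inc_cmd_def intro!: wf_tape_cmd)

lemma turing_machineI:
  assumes "\<And>C. C \<in> set P \<Longrightarrow> wf_command (w + 2) (length P) C"
  shows "turing_machine (w + 2) 5 P"
  using assms nth_mem unfolding turing_machine_def wf_command_def by auto

section \<open>Executing commands within a space bound\<close>

lemma tape_act_read [simp]: "tape_act (tape_read t, MoveStay) t = t"
  by (simp add: tape_act_def tape_read_def)

lemma tm_step_tape_cmd:
  assumes "q < length P" "P ! q = tape_cmd j \<delta>" "j < length ts"
    "\<delta> (tape_read (ts ! j)) = (q', a, m)"
  shows "tm_step P (q, ts) = (q', ts[j := tape_act (a, m) (ts ! j)])"
proof -
  have "map2 tape_act ((map (\<lambda>s. (s, MoveStay)) (map tape_read ts))[j := (a, m)]) ts =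
      ts[j := tape_act (a, m) (ts ! j)]"
    using assms(3) by (intro nth_equalityI) (auto simp: nth_list_update)
  then show ?thesis
    using assms by (simp add: tm_step_def tape_cmd_def)
qed

definition heads_le :: "nat \<Rightarrow> tape list \<Rightarrow> bool" where
  "heads_le S ts \<longleftrightarrow> (\<forall>t\<in>set ts. snd t \<le> S)"

lemma heads_le_update: "heads_le S ts \<Longrightarrow> snd t \<le> S \<Longrightarrow> heads_le S (ts[j := t])"
  using set_update_subset_insert[of ts j t] by (auto simp: heads_le_def)

text \<open>Reachability that carries the space bound along: all configurations passed, both ends
  included, have their heads within \<open>S\<close>.\<close>

inductive reach :: "machine \<Rightarrow> nat \<Rightarrow> tm_config \<Rightarrow> tm_config \<Rightarrow> bool" for P S where
  reach_refl: "heads_le S (snd c) \<Longrightarrow> reach P S c c"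
| reach_step: "heads_le S (snd c) \<Longrightarrow> reach P S (tm_step P c) c' \<Longrightarrow> reach P S c c'"

lemma reach_trans: "reach P S c c' \<Longrightarrow> reach P S c' c'' \<Longrightarrow> reach P S c c''"
  by (induction rule: reach.induct) (auto intro: reach_step)

text \<open>Shaped for backward chaining: the tape in motion is displayed as
  \<open>ts[j := t]\<close>, so that successive steps on it overwrite one another while
  \<open>ts\<close> stays fixed during a sweep.\<close>

lemma reach_tape_cmd:
  assumes "q < length P" "P ! q = tape_cmd j \<delta>" "j < length ts" "heads_le S ts" "snd t \<le> S"
    "\<delta> (fst t (snd t)) = (q', a, m)" "reach P S (q', ts[j := tape_act (a, m) t]) c"
  shows "reach P S (q, ts[j := t]) c"
  by (rule reach_step)
    (use assms in \<open>simp_all add: heads_le_update tm_step_tape_cmd tape_read_def\<close>)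

lemma reach_scan_right:
  assumes "q < length P" "P ! q = tape_cmd j \<delta>" "j < length ts" "heads_le S ts" "n \<le> S"
    "\<And>i. i < n \<Longrightarrow> \<delta> (f i) = (q, f i, MoveRight)"
  shows "i \<le> n \<Longrightarrow> reach P S (q, ts[j := (f, i)]) (q, ts[j := (f, n)])"
proof (induction "n - i" arbitrary: i)
  case 0
  then show ?case using assms by (auto intro!: reach_refl heads_le_update)
next
  case (Suc d)
  then have "reach P S (q, ts[j := (f, Suc i)]) (q, ts[j := (f, n)])" by simp
  then show ?case
    using assms Suc.hyps(2) Suc.prems
    by (rule_tac reach_tape_cmd[where \<delta> = \<delta> and q' = q and a = "f i" and m = MoveRight])
      (auto simp: tape_act_def)
qed

lemma reach_return:
  assumes "q < length P" "P ! q = return_cmd j q q'" "j < length ts" "heads_le S ts" "f 0 = start_sym"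
  shows "n \<le> S \<Longrightarrow> (\<And>i. 0 < i \<Longrightarrow> i \<le> n \<Longrightarrow> f i \<noteq> start_sym) \<Longrightarrow>
    reach P S (q, ts[j := (f, n)]) (q', ts[j := (f, 0)])"
proof (induction n)
  case 0
  show ?case
    using assms
    by (rule_tac reach_tape_cmd[OF assms(1) assms(2)[unfolded return_cmd_def] assms(3,4),
          where q' = q' and a = start_sym and m = MoveStay])
      (auto simp: tape_act_def fun_upd_idem intro!: reach_refl heads_le_update)
next
  case (Suc n)
  have "f (Suc n) \<noteq> start_sym" using Suc.prems by blast
  moreover have "reach P S (q, ts[j := (f, n)]) (q', ts[j := (f, 0)])"
    using Suc by simp
  ultimately show ?case
    using assms Suc.prems
    by (rule_tac reach_tape_cmd[OF assms(1) assms(2)[unfolded return_cmd_def] assms(3,4),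
          where q' = q and a = "f (Suc n)" and m = MoveLeft])
      (auto simp: tape_act_def)
qed

lemma tape_content_simps [simp]:
  "tape_content u 0 = start_sym"
  "length u = n \<Longrightarrow> tape_content u (Suc n) = blank_sym"
  "length u = n \<Longrightarrow> tape_content (u @ a # v) (Suc n) = a"
  "length u = n \<Longrightarrow> (tape_content (u @ a # v))(Suc n := b) = tape_content (u @ b # v)"
  "length u = n \<Longrightarrow> (tape_content u)(Suc n := b) = tape_content (u @ [b])"
  by (auto simp: tape_content_def nth_append nth_Cons' fun_eq_iff)

lemma bits_syms_simps [simp]:
  "bits_syms [] = []"
  "bits_syms (b # x) = (if b then one_sym else zero_sym) # bits_syms x"
  "bits_syms (x @ y) = bits_syms x @ bits_syms y"
  "length (bits_syms x) = length x"
  by (auto simp: bits_syms_def)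

abbreviation bits_tape :: "bool list \<Rightarrow> nat \<Rightarrow> symbol" where
  "bits_tape w \<equiv> tape_content (bits_syms w)"

lemma bits_tape_not_start: "0 < i \<Longrightarrow> bits_tape w i \<noteq> start_sym"
  by (auto simp: tape_content_def bits_syms_def)

fun inc_bits :: "bool list \<Rightarrow> bool list" where
  "inc_bits [] = [True]"
| "inc_bits (False # w) = True # w"
| "inc_bits (True # w) = False # inc_bits w"

abbreviation bits_val :: "bool list \<Rightarrow> nat" where
  "bits_val \<equiv> horner_sum of_bool 2"

lemma bits_val_inc_bits: "bits_val (inc_bits w) = bits_val w + 1"
  by (induction w rule: inc_bits.induct) auto

text \<open>The string grows only if all its digits are ones; at length \<open>L\<close> the bound
  on the value excludes this.\<close>

lemma length_inc_bits: "bits_val w + 1 < 2 ^ L \<Longrightarrow> length w \<le> L \<Longrightarrow> length (inc_bits w) \<le> L"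
proof (induction w arbitrary: L rule: inc_bits.induct)
  case 1
  then show ?case by (cases L) auto
next
  case (3 w)
  then show ?case by (cases L) auto
qed auto

text \<open>The two cases are the two outcomes of \<open>test_cmd\<close>.\<close>

lemma bits_cases:
  obtains "w = replicate (length w) False"
  | n v where "w = replicate n False @ True # v"
proof (cases "True \<in> set w")
  case True
  then obtain u v where "w = u @ True # v" "True \<notin> set u" by (meson split_list_first)
  moreover from this(2) have "u = replicate (length u) False"
    by (intro replicate_eqI) auto
  ultimately show ?thesis using that(2) by metis
next
  case False
  then have "w = replicate (length w) False" by (intro replicate_eqI) auto
  then show ?thesis by (rule that(1))
qed

lemma bits_val_replicate_False [simp]: "bits_val (replicate n False) = 0"
  by (induction n) auto

lemma bits_val_dec:
  "bits_val (replicate n True @ False # v) = bits_val (replicate n False @ True # v) - 1"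
  "0 < bits_val (replicate n False @ True # v)"
proof -
  have "bits_val (replicate n True @ False # v) + 1 = bits_val (replicate n False @ True # v)"
    by (induction n) auto
  then show "bits_val (replicate n True @ False # v) = bits_val (replicate n False @ True # v) - 1"
    "0 < bits_val (replicate n False @ True # v)" by auto
qed

text \<open>Generalised over the part \<open>u\<close> already passed, to which each carry appends a
  zero. The final head position is left open because the return sweep works from any
  position.\<close>

lemma reach_inc_scan:
  assumes "q < length P" "j < length ts" "heads_le S ts"
    and P: "P ! q = inc_cmd j q"
  shows "length u + length v + 1 \<le> S \<Longrightarrow> \<exists>n\<le>S.
    reach P S (q, ts[j := (bits_tape (u @ v), Suc (length u))])
      (q + 1, ts[j := (bits_tape (u @ inc_bits v), n)])"
proof (induction v arbitrary: u rule: inc_bits.induct)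
  case 1
  have "reach P S (q, ts[j := (bits_tape (u @ []), Suc (length u))])
      (q + 1, ts[j := (bits_tape (u @ inc_bits []), length u)])"
    using assms 1
    by (rule_tac reach_tape_cmd[where q' = "q + 1" and a = one_sym and m = MoveLeft, OF assms(1) P[unfolded inc_cmd_def] assms(2,3)])
      (auto simp: tape_act_def intro!: reach_refl heads_le_update)
  then show ?case using 1 by (intro exI[of _ "length u"]) simp
next
  case (2 w)
  have "reach P S (q, ts[j := (bits_tape (u @ False # w), Suc (length u))])
      (q + 1, ts[j := (bits_tape (u @ inc_bits (False # w)), length u)])"
    using assms 2
    by (rule_tac reach_tape_cmd[where q' = "q + 1" and a = one_sym and m = MoveLeft, OF assms(1) P[unfolded inc_cmd_def] assms(2,3)])
      (auto simp: tape_act_def intro!: reach_refl heads_le_update)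
  then show ?case using 2 by (intro exI[of _ "length u"]) simp
next
  case (3 w)
  obtain n where n: "n \<le> S" and
    "reach P S (q, ts[j := (bits_tape ((u @ [False]) @ w), Suc (length (u @ [False])))])
      (q + 1, ts[j := (bits_tape ((u @ [False]) @ inc_bits w), n)])"
    using "3.IH"[of "u @ [False]"] "3.prems" by auto
  then have "reach P S (q, ts[j := (bits_tape (u @ True # w), Suc (length u))])
      (q + 1, ts[j := (bits_tape (u @ inc_bits (True # w)), n)])"
    using assms "3.prems"
    by (rule_tac reach_tape_cmd[where q' = q and a = zero_sym and m = MoveRight, OF assms(1) P[unfolded inc_cmd_def] assms(2,3)])
      (auto simp: tape_act_def)
  then show ?case using n by blast
qed

text \<open>The borrow: after the lowest one has become zero, the zeros below it turn into ones on
  the way back. The digits already rewritten are absorbed into \<open>v\<close>.\<close>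

lemma reach_dec_return:
  assumes "q < length P" "j < length ts" "heads_le S ts"
    and "P ! q = tape_cmd j
      (\<lambda>s. if s = start_sym then (q', s, MoveStay) else (q, one_sym, MoveLeft))"
  shows "n \<le> S \<Longrightarrow> reach P S (q, ts[j := (bits_tape (replicate n False @ v), n)])
      (q', ts[j := (bits_tape (replicate n True @ v), 0)])"
proof (induction n arbitrary: v)
  case 0
  have "(bits_tape v)(0 := start_sym) = bits_tape v"
    by (simp add: fun_upd_idem)
  then show ?case using assms
    by (rule_tac reach_tape_cmd[where q' = q' and a = start_sym and m = MoveStay, OF assms(1,4,2,3)])
      (auto simp: tape_act_def intro!: reach_refl heads_le_update)
next
  case (Suc n)
  have split: "replicate (Suc n) b @ v = replicate n b @ b # v" for b
    by (simp add: replicate_app_Cons_same)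
  show ?case
    unfolding split using assms Suc.prems Suc.IH[of "True # v"]
    by (rule_tac reach_tape_cmd[where q' = q and a = one_sym and m = MoveLeft, OF assms(1,4,2,3)])
      (auto simp: tape_act_def)
qed

lemma bits_tape_replicate_False:
  assumes "i \<le> n"
  shows "bits_tape (replicate n False @ v) i = (if i = 0 then start_sym else zero_sym)"
  using assms by (auto simp: tape_content_def bits_syms_def nth_append)

lemma reach_test_pos:
  assumes "q < length P" "P ! q = test_cmd j q a" "j < length ts" "heads_le S ts"
    and w: "w = replicate n False @ True # v" and "length w \<le> S"
  shows "reach P S (q, ts[j := (bits_tape w, 0)])
     (q + 1, ts[j := ((bits_tape w)(Suc n := a), n)])"
proof -
  let ?f = "bits_tape w"
  have n: "Suc n \<le> S" using assms by simp
  have "reach P S (q, ts[j := (?f, 0)]) (q, ts[j := (?f, Suc n)])"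
    by (rule reach_scan_right[OF assms(1) assms(2)[unfolded test_cmd_def] assms(3,4) n])
      (simp_all add: w bits_tape_replicate_False del: bits_syms_simps)
  moreover have "?f (Suc n) = one_sym"
    by (simp add: w)
  then have "reach P S (q, ts[j := (?f, Suc n)]) (q + 1, ts[j := (?f(Suc n := a), n)])"
    using n assms(4)
    by (rule_tac reach_tape_cmd[OF assms(1) assms(2)[unfolded test_cmd_def] assms(3,4),
          where q' = "q + 1" and a = a and m = MoveLeft])
      (auto simp: tape_act_def intro!: reach_refl heads_le_update)
  ultimately show ?thesis by (rule reach_trans)
qed

lemma reach_test_zero:
  assumes "q < length P" "P ! q = test_cmd j q a" "j < length ts" "heads_le S ts"
    and "q + 2 < length P" "P ! (q + 2) = return_cmd j (q + 2) q'"
    and w: "w = replicate n False" and "n < S"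
  shows "reach P S (q, ts[j := (bits_tape w, 0)]) (q', ts[j := (bits_tape w, 0)])"
proof -
  let ?f = "bits_tape w"
  have n: "Suc n \<le> S" using assms by simp
  have "reach P S (q, ts[j := (?f, 0)]) (q, ts[j := (?f, Suc n)])"
    by (rule reach_scan_right[OF assms(1) assms(2)[unfolded test_cmd_def] assms(3,4) n])
      (use bits_tape_replicate_False[of _ n "[]"] in \<open>simp_all add: w\<close>)
  moreover have "?f (Suc n) = blank_sym" by (simp add: w)
  then have "reach P S (q, ts[j := (?f, Suc n)]) (q + 2, ts[j := (?f, n)])"
    using n assms(4)
    by (rule_tac reach_tape_cmd[OF assms(1) assms(2)[unfolded test_cmd_def] assms(3,4),
          where q' = "q + 2" and a = blank_sym and m = MoveLeft])
      (auto simp: tape_act_def fun_upd_idem intro!: reach_refl heads_le_update)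
  moreover have "reach P S (q + 2, ts[j := (?f, n)]) (q', ts[j := (?f, 0)])"
    using n by (rule_tac reach_return[OF assms(5,6,3,4)])
      (auto simp: bits_tape_not_start simp del: One_nat_def)
  ultimately show ?thesis by (meson reach_trans)
qed

section \<open>Correctness of the compiled code\<close>

definition rep_reg :: "nat \<Rightarrow> tape \<Rightarrow> nat \<Rightarrow> bool" where
  "rep_reg L t v \<longleftrightarrow>
     (\<exists>w. length w \<le> L \<and> t = (bits_tape w, 0) \<and> bits_val w = v)"

text \<open>Between commands the input head stands on the first unread bit and the output head on
  the first free cell; \<open>Suc\<close> accounts for the start symbol in cell 0.\<close>

definition rep :: "nat \<Rightarrow> nat \<Rightarrow> bool list \<Rightarrow> pstate \<Rightarrow> tape list \<Rightarrow> bool" where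
  "rep w L x st ts \<longleftrightarrow> (case st of (s, xs, ys) \<Rightarrow>
     length ts = w + 2 \<and>
     (\<exists>p\<le>length x. ts ! 0 = (bits_tape x, Suc p) \<and> xs = drop p x) \<and>
     ts ! 1 = (tape_content ys, Suc (length ys)) \<and> length ys \<le> L \<and>
     (\<forall>r<w. rep_reg L (ts ! (r + 2)) (s r)))"

lemma rep_heads_le:
  assumes "rep w L x st ts" "L < S" "length x < S"
  shows "heads_le S ts"
  unfolding heads_le_def
proof
  fix t assume "t \<in> set ts"
  then obtain i where i: "i < length ts" "t = ts ! i" by (metis in_set_conv_nth)
  consider "i = 0" | "i = 1" | r where "i = r + 2" "r < w"
    using i assms(1) by (cases i rule: nat.exhaust; cases "i - 1")
      (auto simp: rep_def split: prod.splits)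
  then show "snd t \<le> S"
    using assms i by cases (auto simp: rep_def rep_reg_def split: prod.splits)
qed

lemma rep_update_reg:
  assumes "rep w L x (s, xs, ys) ts" "r < w" "rep_reg L t v"
  shows "rep w L x (s(r := v), xs, ys) (ts[r + 2 := t])"
  using assms by (auto simp: rep_def nth_list_update)

lemma rep_regE:
  assumes "rep w L x (s, xs, ys) ts" "r < w"
  obtains v where "r + 2 < length ts" "length v \<le> L" "ts[r + 2 := (bits_tape v, 0)] = ts" "bits_val v = s r"
proof -
  obtain v where "length v \<le> L" "ts ! (r + 2) = (bits_tape v, 0)" "bits_val v = s r" "r + 2 < length ts"
    using assms by (auto simp: rep_def rep_reg_def)
  then show ?thesis using that by (metis list_update_id)
qed

definition code_at :: "machine \<Rightarrow> nat \<Rightarrow> machine \<Rightarrow> bool" where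
  "code_at P q C \<longleftrightarrow> q + length C \<le> length P \<and> (\<forall>i<length C. P ! (q + i) = C ! i)"

lemma code_at_Nil [simp]: "code_at P q [] \<longleftrightarrow> q \<le> length P"
  by (simp add: code_at_def)

lemma code_at_Cons [simp]:
  "code_at P q (a # C) \<longleftrightarrow> q < length P \<and> P ! q = a \<and> code_at P (Suc q) C"
  by (auto simp: code_at_def nth_Cons' less_Suc_eq_0_disj)

lemma code_at_append [simp]:
  "code_at P q (C @ D) \<longleftrightarrow> code_at P q C \<and> code_at P (q + length C) D"
proof
  assume *: "code_at P q (C @ D)"
  have "P ! (q + length C + i) = D ! i" if "i < length D" for i
    using * that by (auto simp: code_at_def add.assoc nth_append dest!: spec[of _ "length C + i"])
  then show "code_at P q C \<and> code_at P (q + length C) D"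
    using * by (auto simp: code_at_def nth_append)
next
  assume *: "code_at P q C \<and> code_at P (q + length C) D"
  have "P ! (q + i) = (C @ D) ! i" if "i < length C + length D" for i
  proof (cases "i < length C")
    case False
    then have "P ! (q + length C + (i - length C)) = D ! (i - length C)"
      using * that unfolding code_at_def by (metis add_less_cancel_left le_add_diff_inverse not_less)
    moreover have "q + length C + (i - length C) = q + i" using False by simp
    ultimately show ?thesis using False by (simp add: nth_append)
  qed (use * in \<open>simp add: code_at_def nth_append\<close>)
  then show "code_at P q (C @ D)" using * by (simp add: code_at_def)
qed

lemma reach_goto:
  assumes "q < length P" "P ! q = tape_cmd 0 (\<lambda>s. (q', s, MoveStay))" "rep w L x st ts" "heads_le S ts"
  shows "reach P S (q, ts) (q', ts)"
proof (rule reach_step)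
  have "0 < length ts" using assms(3) by (auto simp: rep_def split: prod.splits)
  then show "reach P S (tm_step P (q, ts)) (q', ts)"
    using assms by (simp add: tm_step_tape_cmd[OF assms(1,2)] reach_refl)
qed (use assms(4) in simp)

text \<open>The induction follows the derivation of \<open>run\<close> and not the program, since a
  loop recurs in its own premise with unchanged code. The strict bounds on \<open>S\<close> leave
  room for the blank cell behind a full register or behind the input, where a head has to
  turn.\<close>

theorem compile_correct:
  assumes "run L c st st'" "wf_prog w c" "code_at P q (compile q c)" "rep w L x st ts"
    and LS: "L < S" and xS: "length x < S"
  shows "\<exists>ts'. rep w L x st' ts' \<and> reach P S (q, ts) (q + prog_size c, ts')"
  using assms(1-4)
proof (induction arbitrary: q ts rule: run.induct)
  case (run_Inc s r xs ys)
  note hd = rep_heads_le[OF run_Inc.prems(3) LS xS]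
  obtain v where j: "r + 2 < length ts" and v: "length v \<le> L"
    and ts: "ts[r + 2 := (bits_tape v, 0)] = ts" and val: "bits_val v = s r"
    using run_Inc.prems rep_regE by (metis wf_prog.simps(1))
  have P: "q < length P" "P ! q = inc_cmd (r + 2) q"
    "q + 1 < length P" "P ! (q + 1) = return_cmd (r + 2) (q + 1) (q + 2)"
    using run_Inc.prems(2) by auto
  obtain n where n: "n \<le> S"
    "reach P S (q, ts[r + 2 := (bits_tape v, 1)])
      (q + 1, ts[r + 2 := (bits_tape (inc_bits v), n)])"
    using reach_inc_scan[OF P(1) j hd P(2), of "[]" v] v(1) LS by auto
  have "reach P S (q, ts[r + 2 := (bits_tape v, 0)])
      (q + 1, ts[r + 2 := (bits_tape (inc_bits v), n)])"
    using n(2)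
    by (rule_tac reach_tape_cmd[OF P(1) P(2)[unfolded inc_cmd_def] j hd, where q' = q and a = start_sym and m = MoveRight])
      (auto simp: tape_act_def fun_upd_idem)
  moreover have "reach P S (q + 1, ts[r + 2 := (bits_tape (inc_bits v), n)])
      (q + 2, ts[r + 2 := (bits_tape (inc_bits v), 0)])"
    using n by (rule_tac reach_return[OF P(3,4) j hd]) (auto simp: bits_tape_not_start simp del: One_nat_def)
  ultimately have "reach P S (q, ts) (q + 2, ts[r + 2 := (bits_tape (inc_bits v), 0)])"
    unfolding ts by (rule reach_trans)
  moreover have "rep_reg L (bits_tape (inc_bits v), 0) (s r + 1)"
    unfolding rep_reg_def
    by (rule exI[of _ "inc_bits v"])
      (use run_Inc.hyps v val in \<open>simp add: bits_val_inc_bits length_inc_bits\<close>)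
  with run_Inc.prems(1) have "rep w L x (s(r := s r + 1), xs, ys)
      (ts[r + 2 := (bits_tape (inc_bits v), 0)])"
    by (intro rep_update_reg[OF run_Inc.prems(3)]) auto
  ultimately show ?case by (metis prog_size.simps(1))
next
  case (run_Dec r s xs ys)
  note hd = rep_heads_le[OF run_Dec.prems(3) LS xS]
  obtain v where j: "r + 2 < length ts" and v: "length v \<le> L"
    and ts: "ts[r + 2 := (bits_tape v, 0)] = ts" and val: "bits_val v = s r"
    using run_Dec.prems rep_regE by (metis wf_prog.simps(2))
  have P: "q < length P" "P ! q = test_cmd (r + 2) q zero_sym"
    "q + 1 < length P" "P ! (q + 1) = tape_cmd (r + 2)
      (\<lambda>s. if s = start_sym then (q + 3, s, MoveStay) else (q + 1, one_sym, MoveLeft))"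
    "q + 2 < length P" "P ! (q + 2) = return_cmd (r + 2) (q + 2) (q + 3)"
    using run_Dec.prems(2) by (auto simp: numeral_eq_Suc)
  show ?case
  proof (cases v rule: bits_cases)
    case 1
    have "reach P S (q, ts[r + 2 := (bits_tape v, 0)]) (q + 3, ts[r + 2 := (bits_tape v, 0)])"
      by (rule reach_test_zero[OF P(1,2) j hd P(5,6) 1]) (use v LS in simp)
    then have "reach P S (q, ts) (q + 3, ts)" unfolding ts .
    moreover have "s r = 0" using val 1 by (metis bits_val_replicate_False)
    then have "s(r := s r - 1) = s" by auto
    ultimately show ?thesis using run_Dec.prems(3) by auto
  next
    case (2 n u)
    let ?v = "replicate n False @ False # u"
    let ?v' = "replicate n True @ False # u"
    have f: "(bits_tape v)(Suc n := zero_sym) = bits_tape ?v"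
      by (simp add: 2)
    have "reach P S (q, ts[r + 2 := (bits_tape v, 0)])
        (q + 1, ts[r + 2 := (bits_tape ?v, n)])"
      using reach_test_pos[OF P(1,2) j hd 2] v LS unfolding f by simp
    moreover have "reach P S (q + 1, ts[r + 2 := (bits_tape ?v, n)])
        (q + 3, ts[r + 2 := (bits_tape ?v', 0)])"
      by (rule reach_dec_return[OF P(3) j hd P(4)]) (use v 2 LS in simp)
    ultimately have "reach P S (q, ts) (q + 3, ts[r + 2 := (bits_tape ?v', 0)])"
      unfolding ts by (rule reach_trans)
    moreover have "rep_reg L (bits_tape ?v', 0) (s r - 1)"
      unfolding rep_reg_def
      by (rule exI[of _ ?v']) (use v val 2 bits_val_dec[of n u] in simp)
    with run_Dec.prems(1) have "rep w L x (s(r := s r - 1), xs, ys)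
        (ts[r + 2 := (bits_tape ?v', 0)])"
      by (intro rep_update_reg[OF run_Dec.prems(3)]) auto
    ultimately show ?thesis by (metis prog_size.simps(2))
  qed
next
  case (run_Emit ys a s xs)
  note hd = rep_heads_le[OF run_Emit.prems(3) LS xS]
  have t: "length ts = w + 2" "ts ! 1 = (tape_content ys, Suc (length ys))"
    using run_Emit.prems(3) by (auto simp: rep_def)
  let ?t = "(tape_content (ys @ [a]), Suc (Suc (length ys)))"
  have "reach P S (q, ts[1 := (tape_content ys, Suc (length ys))]) (q + 1, ts[1 := ?t])"
    using run_Emit.prems run_Emit.hyps LS hd t
    by (rule_tac reach_tape_cmd[where \<delta> = "\<lambda>s. (q + 1, a, MoveRight)" and q' = "q + 1" and a = a
          and m = MoveRight])
      (auto simp: tape_act_def intro!: reach_refl heads_le_update)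
  then have "reach P S (q, ts) (q + 1, ts[1 := ?t])"
    using t(2) by (metis list_update_id)
  moreover have "rep w L x (s, xs, ys @ [a]) (ts[1 := ?t])"
    using run_Emit.prems(3) run_Emit.hyps by (auto simp: rep_def nth_list_update)
  ultimately show ?case by auto
next
  case (run_Seq c st st' d st'')
  obtain ts1 where 1: "rep w L x st' ts1" "reach P S (q, ts) (q + prog_size c, ts1)"
    using run_Seq.IH(1)[of q ts] run_Seq.prems by auto
  obtain ts2 where 2: "rep w L x st'' ts2"
    "reach P S (q + prog_size c, ts1) (q + prog_size c + prog_size d, ts2)"
    using run_Seq.IH(2)[of "q + prog_size c" ts1] run_Seq.prems 1 by auto
  show ?case using 1 2 reach_trans by (auto simp: add.assoc)
next
  case (run_While_0 s r c xs ys)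
  note hd = rep_heads_le[OF run_While_0.prems(3) LS xS]
  obtain v where j: "r + 2 < length ts" and v: "length v \<le> L"
    and ts: "ts[r + 2 := (bits_tape v, 0)] = ts" and val: "bits_val v = s r"
    using run_While_0.prems rep_regE by (metis wf_prog.simps(5))
  have P: "q < length P" "P ! q = test_cmd (r + 2) q one_sym"
    "q + 2 < length P" "P ! (q + 2) = return_cmd (r + 2) (q + 2) (q + 4 + prog_size c)"
    using run_While_0.prems(2) by (auto simp: numeral_eq_Suc)
  have 1: "v = replicate (length v) False"
    using run_While_0.hyps val bits_val_dec(2) by (cases v rule: bits_cases) (blast, metis less_irrefl)
  have "reach P S (q, ts[r + 2 := (bits_tape v, 0)]) (q + 4 + prog_size c, ts[r + 2 := (bits_tape v, 0)])"
    by (rule reach_test_zero[OF P(1,2) j hd P(3,4) 1]) (use v LS in simp)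
  then have "reach P S (q, ts) (q + 4 + prog_size c, ts)" unfolding ts .
  then show ?case using run_While_0.prems(3) by (auto simp: ac_simps)
next
  case (run_While_Suc s r c xs ys st' st'')
  note hd = rep_heads_le[OF run_While_Suc.prems(3) LS xS]
  obtain v where j: "r + 2 < length ts" and v: "length v \<le> L"
    and ts: "ts[r + 2 := (bits_tape v, 0)] = ts" and val: "bits_val v = s r"
    using run_While_Suc.prems rep_regE by (metis wf_prog.simps(5))
  have P: "q < length P" "P ! q = test_cmd (r + 2) q one_sym"
    "q + 1 < length P" "P ! (q + 1) = return_cmd (r + 2) (q + 1) (q + 3)"
    "q + 3 + prog_size c < length P" "P ! (q + 3 + prog_size c) = tape_cmd 0 (\<lambda>s. (q, s, MoveStay))"
    and code: "code_at P (q + 3) (compile (q + 3) c)"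
    using run_While_Suc.prems(2) by (auto simp: numeral_eq_Suc)
  obtain n u where nu: "v = replicate n False @ True # u"
    using run_While_Suc.hyps val bits_val_replicate_False by (cases v rule: bits_cases) metis+
  then have nS: "n \<le> S" using v LS by simp
  have f: "(bits_tape v)(Suc n := one_sym) = bits_tape v"
    by (simp add: nu)
  have "reach P S (q, ts[r + 2 := (bits_tape v, 0)])
      (q + 1, ts[r + 2 := (bits_tape v, n)])"
    using reach_test_pos[OF P(1,2) j hd nu] v LS unfolding f by simp
  moreover have "reach P S (q + 1, ts[r + 2 := (bits_tape v, n)])
      (q + 3, ts[r + 2 := (bits_tape v, 0)])"
    using nS by (rule_tac reach_return[OF P(3,4) j hd]) (auto simp: bits_tape_not_start simp del: One_nat_def)
  ultimately have r1: "reach P S (q, ts) (q + 3, ts)"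
    unfolding ts by (rule reach_trans)
  obtain ts1 where 1: "rep w L x st' ts1" "reach P S (q + 3, ts) (q + 3 + prog_size c, ts1)"
    using run_While_Suc.IH(1)[OF _ code run_While_Suc.prems(3)] run_While_Suc.prems(1) by auto
  have r2: "reach P S (q + 3 + prog_size c, ts1) (q, ts1)"
    by (rule reach_goto[OF P(5,6) 1(1) rep_heads_le[OF 1(1) LS xS]])
  obtain ts2 where 2: "rep w L x st'' ts2"
    "reach P S (q, ts1) (q + prog_size (While r c), ts2)"
    using run_While_Suc.IH(2)[of q ts1] run_While_Suc.prems 1(1) by blast
  show ?case using 2 reach_trans[OF r1 reach_trans[OF 1(2) reach_trans[OF r2 2(2)]]] by blast
next
  case (run_Read_Nil c d s ys)
  note hd = rep_heads_le[OF run_Read_Nil.prems(3) LS xS]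
  have P: "q < length P" "P ! q = read_cmd (q + 1) (q + 2 + prog_size c) (q + 2 + prog_size c + prog_size d)"
    using run_Read_Nil.prems(2) by auto
  note P = P[unfolded read_cmd_def]
  have t: "0 < length ts" "ts ! 0 = (bits_tape x, Suc (length x))"
    using run_Read_Nil.prems(3) by (auto simp: rep_def)
  let ?e = "q + 2 + prog_size c + prog_size d"
  have "ts[0 := (bits_tape x, Suc (length x))] = ts"
    using t(2) by (metis list_update_id)
  then have "reach P S (q, ts[0 := ts ! 0]) (?e, ts)"
    using xS t hd
    by (rule_tac reach_tape_cmd[OF P, where q' = ?e and a = blank_sym and m = MoveStay])
      (auto simp: tape_act_def fun_upd_idem intro: reach_refl)
  then show ?case using run_Read_Nil.prems(3) by (auto simp: ac_simps)
next
  case (run_Read_Cons b d c s xs ys st')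
  note hd = rep_heads_le[OF run_Read_Cons.prems(3) LS xS]
  have P: "q < length P" "P ! q = read_cmd (q + 1) (q + 2 + prog_size c) (q + 2 + prog_size c + prog_size d)"
    using run_Read_Cons.prems(2) by auto
  note P = P[unfolded read_cmd_def]
  have t0: "0 < length ts" using run_Read_Cons.prems(3) by (auto simp: rep_def)
  obtain p where t: "ts ! 0 = (bits_tape x, Suc p)"
    "p \<le> length x" "b # xs = drop p x"
    using run_Read_Cons.prems(3) by (auto simp: rep_def)
  have p: "p < length x" using t by (metis drop_all list.distinct(1) not_le)
  have xp: "x ! p = b" "drop (Suc p) x = xs"
    using t(3) p by (metis Cons_nth_drop_Suc list.inject)+
  let ?t = "(bits_tape x, Suc (Suc p))"
  let ?e = "q + 2 + prog_size c + prog_size d"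
  let ?q = "if b then q + 2 + prog_size c else q + 1"
  have a: "bits_tape x (Suc p) = (if b then one_sym else zero_sym)"
    using p xp by (simp add: tape_content_def bits_syms_def)
  have "reach P S (q, ts[0 := ts ! 0]) (?q, ts[0 := ?t])"
    using xS t0 t hd p a
    by (rule_tac reach_tape_cmd[OF P, where q' = ?q and a = "if b then one_sym else zero_sym" and m = MoveRight])
      (auto simp: tape_act_def fun_upd_idem intro!: reach_refl heads_le_update)
  then have r1: "reach P S (q, ts) (?q, ts[0 := ?t])" by simp
  have "rep w L x (s, xs, ys) (ts[0 := ?t])"
    using run_Read_Cons.prems(3) p xp by (auto simp: rep_def intro!: exI[of _ "Suc p"])
  then obtain ts1 where 1: "rep w L x st' ts1"
    "reach P S (?q, ts[0 := ?t]) (?q + prog_size (if b then d else c), ts1)"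
    using run_Read_Cons.IH[of ?q "ts[0 := ?t]"] run_Read_Cons.prems by (cases b) auto
  have r2: "reach P S (?q + prog_size (if b then d else c), ts1) (?e, ts1)"
  proof (cases b)
    case True
    then show ?thesis using rep_heads_le[OF 1(1) LS xS] by (auto intro: reach_refl)
  next
    case False
    have "reach P S (q + 1 + prog_size c, ts1) (?e, ts1)"
      using run_Read_Cons.prems(2) by (intro reach_goto[OF _ _ 1(1) rep_heads_le[OF 1(1) LS xS]]) auto
    then show ?thesis using False by simp
  qed
  show ?case using 1 reach_trans[OF r1 reach_trans[OF 1(2) r2]] by (auto simp: ac_simps)
qed

section \<open>From program runs to polynomial space\<close>

lemma reach_steps:
  assumes "reach P S c c'"
  shows "\<exists>t. (tm_step P ^^ t) c = c' \<and> (\<forall>u\<le>t. heads_le S (snd ((tm_step P ^^ u) c)))"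
  using assms
proof (induction rule: reach.induct)
  case (reach_refl c)
  then show ?case by (intro exI[of _ 0]) simp
next
  case (reach_step c c')
  then obtain t where t: "(tm_step P ^^ t) (tm_step P c) = c'"
    "\<forall>u\<le>t. heads_le S (snd ((tm_step P ^^ u) (tm_step P c)))" by blast
  have "heads_le S (snd ((tm_step P ^^ u) c))" if "u \<le> Suc t" for u
    using that t(2) reach_step.hyps(1) by (cases u) (auto simp: funpow_swap1)
  then show ?case using t(1) by (intro exI[of _ "Suc t"]) (auto simp: funpow_swap1)
qed

lemma tm_run_halted:
  assumes "length P \<le> fst (tm_run P k x t)" "t \<le> u"
  shows "tm_run P k x u = tm_run P k x t"
  using assms(2) by (induction rule: dec_induct) (use assms(1) in \<open>simp_all add: tm_run_def tm_step_def\<close>)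

lemma tm_run_wf:
  assumes "turing_machine k G P"
  shows "length (snd (tm_run P k x t)) = k \<and> fst (tm_run P k x t) \<le> length P \<and>
    (\<forall>tp\<in>set (snd (tm_run P k x t)). \<forall>i. fst tp i < G)"
proof (induction t)
  case 0
  have "2 \<le> k" "5 \<le> G" using assms by (auto simp: turing_machine_def)
  then show ?case
    by (auto simp: tm_run_def tm_init_def tape_content_def bits_syms_def)
next
  case (Suc t)
  obtain q ts where c: "tm_run P k x t = (q, ts)" by (cases "tm_run P k x t")
  have step: "tm_run P k x (Suc t) = tm_step P (q, ts)" using c by (simp add: tm_run_def)
  show ?case
  proof (cases "q < length P")
    case True
    let ?r = "(P ! q) (map tape_read ts)"
    have ts: "length ts = k" "\<forall>tp\<in>set ts. \<forall>i. fst tp i < G" using Suc c by auto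
    then have "length (map tape_read ts) = k" "set (map tape_read ts) \<subseteq> {..<G}"
      by (auto simp: tape_read_def)
    then have r: "fst ?r \<le> length P" "length (snd ?r) = k" "fst ` set (snd ?r) \<subseteq> {..<G}"
      using assms True unfolding turing_machine_def by blast+
    have "\<forall>tp\<in>set (map2 tape_act (snd ?r) ts). \<forall>i. fst tp i < G"
      using ts(2) r(3) by (fastforce simp: tape_act_def dest: set_zip_leftD set_zip_rightD)
    then show ?thesis using step True r ts by (simp add: tm_step_def Let_def)
  next
    case False
    then show ?thesis using step Suc c by (simp add: tm_step_def)
  qed
qed

theorem polyspace_computable_prog:
  assumes wf: "wf_prog w c"
    and run: "\<And>x. \<exists>s. run (poly p (length x)) c (\<lambda>_. 0, x, []) (s, [], f x)"
  shows "polyspace_computable f"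
proof -
  \<comment> \<open>The initial configuration has all heads in cell 0, but \<open>rep\<close> wants
    the input and output heads behind the start symbol; the two extra commands move them
    there.\<close>
  let ?P = "tape_cmd 0 (\<lambda>s. (1, s, MoveRight)) # tape_cmd 1 (\<lambda>s. (2, s, MoveRight)) # compile 2 c"
  let ?k = "w + 2"
  \<comment> \<open>Adding \<open>n + 1\<close> makes the bound exceed both the register length and
    the input length, as \<open>compile_correct\<close> demands.\<close>
  let ?p = "p + [:1, 1:]"
  have "wf_command (w + 2) (length ?P) C" if "C \<in> set ?P" for C
    using that wf_compile[OF wf, of C 2] by (auto intro!: wf_tape_cmd)
  then have tm: "turing_machine ?k 5 ?P" by (rule turing_machineI)
  have code: "code_at ?P 2 (compile 2 c)"
    by (auto simp: code_at_def numeral_eq_Suc)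
  have "tm_outputs ?P ?k x (f x) \<and> tm_space_bounded ?P ?k x (poly ?p (length x))" for x
  proof -
    let ?L = "poly p (length x)"
    let ?S = "poly ?p (length x)"
    obtain s where s: "run ?L c (\<lambda>_. 0, x, []) (s, [], f x)" using run by blast
    define ts where "ts = (bits_tape x, 1) # (tape_content [], 1) #
      replicate w (tape_content [], 0 :: nat)"
    have S: "?L < ?S" "length x < ?S" by auto
    have "rep_reg ?L (tape_content [], 0) 0"
      by (auto simp: rep_reg_def intro!: exI[of _ "[]"])
    then have rep: "rep w ?L x (\<lambda>_. 0, x, []) ts"
      by (auto simp: rep_def ts_def)
    obtain ts' where ts': "rep w ?L x (s, [], f x) ts'"
      "reach ?P ?S (2, ts) (2 + prog_size c, ts')"
      using compile_correct[OF s wf code rep S] by blast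
    let ?r = "replicate w (tape_content [], 0 :: nat)"
    let ?t0 = "(bits_tape x, 0) # (tape_content [], 0) # ?r"
    let ?t1 = "(bits_tape x, 1) # (tape_content [], 0) # ?r"
    have hd: "heads_le ?S ?t0" "heads_le ?S ?t1" using S by (auto simp: heads_le_def)
    have "reach ?P ?S (1, ?t1[1 := (tape_content [], 0)]) (2 + prog_size c, ts')"
      using ts'(2) hd(2)
      by (rule_tac reach_tape_cmd[where \<delta> = "\<lambda>s. (2, s, MoveRight)" and q' = 2 and a = start_sym
            and m = MoveRight])
        (auto simp: tape_act_def fun_upd_idem ts_def)
    then have "reach ?P ?S (0, ?t0[0 := (bits_tape x, 0)]) (2 + prog_size c, ts')"
      using hd(1)
      by (rule_tac reach_tape_cmd[where \<delta> = "\<lambda>s. (1, s, MoveRight)" and q' = 1 and a = start_sym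
            and m = MoveRight])
        (auto simp: tape_act_def fun_upd_idem)
    then have "reach ?P ?S (tm_init ?k x) (2 + prog_size c, ts')"
      by (simp add: tm_init_def)
    then obtain t where t: "tm_run ?P ?k x t = (2 + prog_size c, ts')"
      and hd: "\<And>u. u \<le> t \<Longrightarrow> heads_le ?S (snd (tm_run ?P ?k x u))"
      unfolding tm_run_def using reach_steps by blast
    have out: "tm_outputs ?P ?k x (f x)"
      unfolding tm_outputs_def using t ts'(1) by (intro exI[of _ t]) (auto simp: rep_def)
    \<comment> \<open>A halted configuration no longer changes, so the bound up to the halting time
      holds for all times.\<close>
    have "tm_run ?P ?k x u = tm_run ?P ?k x t" if "t \<le> u" for u
      using tm_run_halted[of ?P ?k x t u] that t by simp
    then have hd': "heads_le ?S (snd (tm_run ?P ?k x u))" for u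
      using hd by (metis nat_le_linear order_refl)
    have len: "length (snd (tm_run ?P ?k x u)) = ?k" for u
      using tm_run_wf[OF tm] by blast
    have "tm_space_bounded ?P ?k x ?S"
      unfolding tm_space_bounded_def using hd' len unfolding heads_le_def by (metis nth_mem)
    with out show ?thesis by blast
  qed
  with tm show ?thesis unfolding polyspace_computable_def by blast
qed

section \<open>Polynomial space functions on natural numbers\<close>

text \<open>Natural coefficients make the bounding polynomials monotone, on which
  \<open>poly_bounded_comp_poly\<close> relies.\<close>

definition poly_bounded :: "(nat \<Rightarrow> nat) \<Rightarrow> bool" where
  "poly_bounded p \<longleftrightarrow> (\<exists>q :: nat poly. \<forall>m. p m \<le> poly q m)"

lemma poly_nat_mono: "m \<le> n \<Longrightarrow> poly (q :: nat poly) m \<le> poly q n"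
  by (induction q) (auto intro!: add_mono mult_mono)

lemma poly_boundedI: "(\<And>m. p m \<le> poly q m) \<Longrightarrow> poly_bounded p"
  unfolding poly_bounded_def by blast

lemma poly_bounded_poly: "poly_bounded (poly q)"
  by (rule poly_boundedI[of _ q]) simp

lemma poly_bounded_const: "poly_bounded (\<lambda>m. k)"
  by (rule poly_boundedI[of _ "[:k:]"]) simp

lemma poly_bounded_id: "poly_bounded (\<lambda>m. m)"
  by (rule poly_boundedI[of _ "[:0, 1:]"]) simp

lemma poly_bounded_add: "poly_bounded p \<Longrightarrow> poly_bounded q \<Longrightarrow> poly_bounded (\<lambda>m. p m + q m)"
  unfolding poly_bounded_def by (metis add_mono poly_add)

lemma poly_bounded_mult: "poly_bounded p \<Longrightarrow> poly_bounded q \<Longrightarrow> poly_bounded (\<lambda>m. p m * q m)"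
  unfolding poly_bounded_def by (metis mult_le_mono poly_mult)

lemma poly_bounded_Suc: "poly_bounded p \<Longrightarrow> poly_bounded (\<lambda>m. Suc (p m))"
  using poly_bounded_add[OF _ poly_bounded_const[of 1]] by simp

lemma poly_bounded_comp_poly:
  assumes "poly_bounded p"
  shows "poly_bounded (\<lambda>m. poly q (p m))"
proof -
  obtain p' where "\<And>m. p m \<le> poly p' m" using assms unfolding poly_bounded_def by blast
  then show ?thesis by (intro poly_boundedI[of _ "pcompose q p'"]) (simp add: poly_pcompose poly_nat_mono)
qed

lemmas poly_bounded_intros = poly_bounded_const poly_bounded_id poly_bounded_add
  poly_bounded_mult poly_bounded_Suc poly_bounded_comp_poly poly_bounded_poly

section \<open>Basic register programs\<close>

lemma run_eq: "run L c st st' \<Longrightarrow> st' = st'' \<Longrightarrow> run L c st st''"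
  by simp

lemma run_Inc_reg: "s r + 1 < 2 ^ L \<Longrightarrow> run L (Inc r) (s, io) (s(r := s r + 1), io)"
  using run_Inc by (cases io) blast

lemma run_Dec_reg: "run L (Dec r) (s, io) (s(r := s r - 1), io)"
  using run_Dec by (cases io) blast

lemma run_Inc_Seq:
  "s r + 1 < 2 ^ L \<Longrightarrow> run L d (s(r := s r + 1), io) st \<Longrightarrow> run L (Inc r ;; d) (s, io) st"
  by (rule run_Seq[OF run_Inc_reg])

lemma run_Dec_Seq: "run L d (s(r := s r - 1), io) st \<Longrightarrow> run L (Dec r ;; d) (s, io) st"
  by (rule run_Seq[OF run_Dec_reg])

lemma run_While_none: "s r = 0 \<Longrightarrow> run L (While r c) (s, io) (s, io)"
  using run_While_0 by (cases io) blast

lemma run_While_step: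
  "s r \<noteq> 0 \<Longrightarrow> run L c (s, io) st' \<Longrightarrow> run L (While r c) st' st'' \<Longrightarrow> run L (While r c) (s, io) st''"
  using run_While_Suc by (cases io) blast

lemma run_While_once:
  "s r \<noteq> 0 \<Longrightarrow> run L c (s, io) (s', io') \<Longrightarrow> s' r = 0 \<Longrightarrow> run L (While r c) (s, io) (s', io')"
  by (rule run_While_step[OF _ _ run_While_none])

text \<open>For loops whose intermediate states can be written down: \<open>\<sigma> i\<close> is
  the state after \<open>i\<close> rounds. The induction goes backwards from the exit.\<close>

lemma run_While_seq:
  assumes "\<And>i. i < n \<Longrightarrow> fst (\<sigma> i) r \<noteq> 0" "\<And>i. i < n \<Longrightarrow> run L c (\<sigma> i) (\<sigma> (Suc i))"
    and "fst (\<sigma> n) r = 0"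
  shows "run L (While r c) (\<sigma> 0) (\<sigma> n)"
proof -
  have "run L (While r c) (\<sigma> (n - k)) (\<sigma> n)" if "k \<le> n" for k
    using that
  proof (induction k)
    case 0
    then show ?case using run_While_none[of "fst (\<sigma> n)" r L c "snd (\<sigma> n)"] assms(3) by simp
  next
    case (Suc k)
    then have i: "n - Suc k < n" "Suc (n - Suc k) = n - k" by auto
    have "run L c (\<sigma> (n - Suc k)) (\<sigma> (n - k))" using assms(2)[OF i(1)] i(2) by simp
    then show ?case
      using run_While_step[of "fst (\<sigma> (n - Suc k))" r L c "snd (\<sigma> (n - Suc k))"] assms(1)[OF i(1)] Suc
      by simp
  qed
  from this[of n] show ?thesis by simp
qed

lemma run_While_regs:
  assumes "\<And>i. i < n \<Longrightarrow> \<sigma> i r \<noteq> 0" "\<And>i. i < n \<Longrightarrow> run L c (\<sigma> i, io) (\<sigma> (Suc i), io)"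
    and "\<sigma> n r = 0" "s = \<sigma> 0" "s' = \<sigma> n"
  shows "run L (While r c) (s, io) (s', io)"
  using run_While_seq[of n "\<lambda>i. (\<sigma> i, io)"] assms by simp

definition Clear :: "nat \<Rightarrow> prog" where "Clear a = While a (Dec a)"

definition Move :: "nat \<Rightarrow> nat \<Rightarrow> prog" where "Move a b = While a (Dec a ;; Inc b)"

definition Move2 :: "nat \<Rightarrow> nat \<Rightarrow> nat \<Rightarrow> prog" where
  "Move2 a b d = While a (Dec a ;; Inc b ;; Inc d)"

definition Copy :: "nat \<Rightarrow> nat \<Rightarrow> nat \<Rightarrow> prog" where "Copy a b d = Move2 a b d ;; Move d a"

lemma wf_prog_moves [simp]:
  "wf_prog w (Clear a) \<longleftrightarrow> a < w"
  "wf_prog w (Move a b) \<longleftrightarrow> a < w \<and> b < w"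
  "wf_prog w (Move2 a b d) \<longleftrightarrow> a < w \<and> b < w \<and> d < w"
  "wf_prog w (Copy a b d) \<longleftrightarrow> a < w \<and> b < w \<and> d < w"
  by (auto simp: Clear_def Move_def Move2_def Copy_def)

lemma run_Clear: "run L (Clear a) (s, io) (s(a := 0), io)"
  unfolding Clear_def
  by (rule run_While_regs[where n = "s a" and \<sigma> = "\<lambda>i. s(a := s a - i)"])
    (auto intro!: run_eq[OF run_Dec_reg])

lemma run_Move:
  assumes "a \<noteq> b" "s a + s b < 2 ^ L"
  shows "run L (Move a b) (s, io) (s(a := 0, b := s a + s b), io)"
  unfolding Move_def
proof (rule run_While_regs[where n = "s a" and \<sigma> = "\<lambda>i. s(a := s a - i, b := s b + i)"])
  fix i assume i: "i < s a"
  show "run L (Dec a ;; Inc b) (s(a := s a - i, b := s b + i), io)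
      (s(a := s a - Suc i, b := s b + Suc i), io)"
    by (intro run_Dec_Seq run_Inc_Seq run_eq[OF run_Inc_reg])
      (use assms i in \<open>auto simp: fun_eq_iff\<close>)
qed (use assms in \<open>auto simp: fun_eq_iff\<close>)

lemma run_Move2:
  assumes "a \<noteq> b" "a \<noteq> d" "b \<noteq> d" "s a + s b < 2 ^ L" "s a + s d < 2 ^ L"
  shows "run L (Move2 a b d) (s, io) (s(a := 0, b := s a + s b, d := s a + s d), io)"
  unfolding Move2_def
proof (rule run_While_regs[where n = "s a"
      and \<sigma> = "\<lambda>i. s(a := s a - i, b := s b + i, d := s d + i)"])
  fix i assume i: "i < s a"
  show "run L (Dec a ;; Inc b ;; Inc d) (s(a := s a - i, b := s b + i, d := s d + i), io)
      (s(a := s a - Suc i, b := s b + Suc i, d := s d + Suc i), io)"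
    by (intro run_Dec_Seq run_Inc_Seq run_eq[OF run_Inc_reg])
      (use assms i in \<open>auto simp: fun_eq_iff\<close>)
qed (use assms in \<open>auto simp: fun_eq_iff\<close>)

lemma run_Copy:
  assumes "a \<noteq> b" "a \<noteq> d" "b \<noteq> d" "s b = 0" "s d = 0" "s a < 2 ^ L"
  shows "run L (Copy a b d) (s, io) (s(b := s a), io)"
  unfolding Copy_def
  by (rule run_Seq[OF run_Move2 run_eq[OF run_Move]]) (use assms in \<open>auto simp: fun_eq_iff\<close>)

lemma run_Move_Seq:
  "a \<noteq> b \<Longrightarrow> s a + s b < 2 ^ L \<Longrightarrow> run L d (s(a := 0, b := s a + s b), io) st \<Longrightarrow>
    run L (Move a b ;; d) (s, io) st"
  by (rule run_Seq[OF run_Move])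

lemma run_Clear_Seq: "run L d (s(a := 0), io) st \<Longrightarrow> run L (Clear a ;; d) (s, io) st"
  by (rule run_Seq[OF run_Clear])

text \<open>\<open>m\<close> is any bound on the binary length of the argument. Registers from
  \<open>w\<close> on are arbitrary and remain untouched, as do input and output: this frame
  condition lets a caller park values there. Registers 1 to \<open>w - 1\<close> are scratch space,
  which is zero before and after the run.\<close>

definition computes :: "nat \<Rightarrow> prog \<Rightarrow> nat poly \<Rightarrow> (nat \<Rightarrow> nat) \<Rightarrow> bool" where
  "computes w c q f \<longleftrightarrow> wf_prog w c \<and> (\<forall>m x. x < 2 ^ m \<longrightarrow> f x < 2 ^ poly q m \<and>
     (\<forall>s io. s 0 = x \<longrightarrow> (\<forall>r. 0 < r \<and> r < w \<longrightarrow> s r = 0) \<longrightarrow>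
        run (poly q m) c (s, io) (s(0 := f x), io)))"

text \<open>The number functions computable in space polynomial in the binary length of the
  argument, with results of polynomial length.\<close>

definition pspace :: "(nat \<Rightarrow> nat) \<Rightarrow> bool" where
  "pspace f \<longleftrightarrow> (\<exists>w c q. computes w c q f)"

lemma less_power2_mono: "(x :: nat) < 2 ^ m \<Longrightarrow> m \<le> n \<Longrightarrow> x < 2 ^ n"
  by (meson less_le_trans one_le_numeral power_increasing)

lemma pspaceI:
  assumes "wf_prog w c" "poly_bounded p" "\<And>m x. x < 2 ^ m \<Longrightarrow> f x < 2 ^ p m"
    and "\<And>m s io. s 0 < 2 ^ m \<Longrightarrow> (\<And>r. 0 < r \<Longrightarrow> r < w \<Longrightarrow> s r = 0) \<Longrightarrow>
      run (p m) c (s, io) (s(0 := f (s 0)), io)"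
  shows "pspace f"
proof -
  obtain q where q: "\<And>m. p m \<le> poly q m" using assms(2) unfolding poly_bounded_def by blast
  have "computes w c q f"
    unfolding computes_def
    using assms(1) less_power2_mono[OF assms(3) q] run_mono[OF assms(4) q] by auto
  then show ?thesis unfolding pspace_def by blast
qed

lemma computesD:
  assumes "computes w c q f"
  shows "wf_prog w c" "x < 2 ^ m \<Longrightarrow> f x < 2 ^ poly q m"
    "s 0 < 2 ^ m \<Longrightarrow> (\<And>r. 0 < r \<Longrightarrow> r < w \<Longrightarrow> s r = 0) \<Longrightarrow> poly q m \<le> L \<Longrightarrow>
      run L c (s, io) (s(0 := f (s 0)), io)"
  using assms run_mono[of "poly q m" c _ _ L] unfolding computes_def by blast+

lemma pspace_bounded:
  assumes "pspace f"
  obtains q where "\<And>m x. x < 2 ^ m \<Longrightarrow> f x < 2 ^ poly q m"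
  using assms computesD(2) unfolding pspace_def by metis

lemma pspace_comp:
  assumes "pspace f" "pspace g"
  shows "pspace (\<lambda>x. f (g x))"
proof -
  obtain c w q where "computes w c q f"
    using assms(1) unfolding pspace_def by blast
  note f = computesD[OF this]
  obtain c' w' q' where "computes w' c' q' g"
    using assms(2) unfolding pspace_def by blast
  note g = computesD[OF this]
  define p where "p m = poly q (poly q' m) + poly q' m" for m
  show ?thesis
  proof (rule pspaceI[of "max w w'" "c' ;; c" p])
    show "poly_bounded p" unfolding p_def by (intro poly_bounded_intros)
    show "wf_prog (max w w') (c' ;; c)" using f(1) g(1) by (auto intro: wf_prog_mono)
    show "f (g x) < 2 ^ p m" if "x < 2 ^ m" for m x
      using f(2)[OF g(2)[OF that]] by (rule less_power2_mono) (simp add: p_def)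
    show "run (p m) (c' ;; c) (s, io) (s(0 := f (g (s 0))), io)"
      if "s 0 < 2 ^ m" "\<And>r. 0 < r \<Longrightarrow> r < max w w' \<Longrightarrow> s r = 0" for m s io
    proof (rule run_Seq)
      show "run (p m) c' (s, io) (s(0 := g (s 0)), io)"
        using that by (intro g(3)[of _ m]) (auto simp: p_def)
      show "run (p m) c (s(0 := g (s 0)), io) (s(0 := f (g (s 0))), io)"
        using f(3)[of "s(0 := g (s 0))" "poly q' m" "p m" io] that g(2)[OF that(1)]
        by (auto simp: p_def)
    qed
  qed
qed

lemma pspace_id: "pspace (\<lambda>x. x)"
  by (rule pspaceI[of 2 "Clear 1" "\<lambda>m. m"])
    (auto intro!: poly_bounded_intros run_eq[OF run_Clear] simp: fun_eq_iff)

lemma pspace_Suc': "pspace Suc"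
proof (rule pspaceI[of 1 "Inc 0" "\<lambda>m. m + 1"])
  show "Suc x < 2 ^ (m + 1)" if "x < 2 ^ m" for x m
  proof -
    have "x + 1 \<le> 2 ^ m" "(1::nat) \<le> 2 ^ m" using that by simp_all
    then have "x + 1 < 2 * 2 ^ m" by linarith
    then show ?thesis by simp
  qed
  then show "run (m + 1) (Inc 0) (s, io) (s(0 := Suc (s 0)), io)" if "s 0 < 2 ^ m" for m s io
    using run_Inc_reg[of s 0 "m + 1" io] that by simp
qed (auto intro!: poly_bounded_intros)

lemmas pspace_Suc = pspace_comp[OF pspace_Suc']

lemma pspace_const: "pspace (\<lambda>x. k)"
proof (induction k)
  case 0
  show ?case
    by (rule pspaceI[of 1 "Clear 0" "\<lambda>m. m"]) (auto intro!: poly_bounded_intros run_Clear)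
next
  case (Suc k)
  show ?case using pspace_Suc[OF Suc] .
qed

text \<open>The registers from \<open>W\<close> on lie beyond the reach of all three programs and
  hold the argument and the value of \<open>g\<close>. As \<open>g\<close> is evaluated first, the
  value of \<open>f\<close> already lies in register 0 when \<open>c\<close> starts.\<close>

lemma pspace_bin:
  assumes op: "wf_prog w c" "poly_bounded p" "\<And>m a b. a < 2 ^ m \<Longrightarrow> b < 2 ^ m \<Longrightarrow> op a b < 2 ^ p m"
    and run: "\<And>m s io. s 0 < 2 ^ m \<Longrightarrow> s 1 < 2 ^ m \<Longrightarrow> (\<And>r. 1 < r \<Longrightarrow> r < w \<Longrightarrow> s r = 0) \<Longrightarrow>
      run (p m) c (s, io) (s(0 := op (s 0) (s 1), 1 := 0), io)"
    and "pspace f" "pspace g"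
  shows "pspace (\<lambda>x. op (f x) (g x))"
proof -
  obtain cf wf qf where "computes wf cf qf f"
    using assms(5) unfolding pspace_def by blast
  note f = computesD[OF this]
  obtain cg wg qg where "computes wg cg qg g"
    using assms(6) unfolding pspace_def by blast
  note g = computesD[OF this]
  obtain q where q: "\<And>m. p m \<le> poly q m" using op(2) unfolding poly_bounded_def by blast
  define W where "W = w + wf + wg + 2"
  define L where "L m = m + poly qf m + poly qg m + poly q (poly qf m + poly qg m)" for m
  let ?c = "Copy 0 W (W + 1) ;; cg ;; Move 0 (W + 1) ;; Move W 0 ;; cf ;; Move (W + 1) 1 ;; c"
  show ?thesis
  proof (rule pspaceI[of "W + 2" ?c L])
    show "poly_bounded L" unfolding L_def by (intro poly_bounded_intros)
    show "wf_prog (W + 2) ?c"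
      using f(1) g(1) op(1) by (auto simp: W_def intro: wf_prog_mono)
  next
    fix m x :: nat
    assume x: "x < 2 ^ m"
    let ?k = "poly qf m + poly qg m"
    have "op (f x) (g x) < 2 ^ p ?k"
      using f(2)[OF x] g(2)[OF x] by (intro op(3)) (auto elim: less_power2_mono)
    then show "op (f x) (g x) < 2 ^ L m"
      using q[of ?k] by (auto simp: L_def elim!: less_power2_mono)
  next
    fix m :: nat and s :: "nat \<Rightarrow> nat" and io
    assume s: "s 0 < 2 ^ m" "\<And>r. 0 < r \<Longrightarrow> r < W + 2 \<Longrightarrow> s r = 0"
    define x where "x = s 0"
    define a where "a = f x"
    define b where "b = g x"
    let ?k = "poly qf m + poly qg m"
    have L: "m \<le> L m" "poly qf m \<le> L m" "poly qg m \<le> L m" "p ?k \<le> L m"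
      using q[of ?k] by (auto simp: L_def)
    have x: "x < 2 ^ m" "x < 2 ^ L m" using s L less_power2_mono by (auto simp: x_def)
    have ab: "a < 2 ^ ?k" "b < 2 ^ ?k" "a < 2 ^ L m" "b < 2 ^ L m"
      using f(2)[OF x(1)] g(2)[OF x(1)] L unfolding a_def b_def by (auto elim: less_power2_mono)
    have W: "0 < W" "wf < W" "wg < W" "1 < W" "w < W" by (auto simp: W_def)
    have r1: "run (L m) (Copy 0 W (W + 1)) (s, io) (s(W := x), io)"
      using run_Copy[of 0 W "W + 1" s "L m" io] s(2) W x by (simp add: x_def)
    have r2: "run (L m) cg (s(W := x), io) (s(W := x, 0 := b), io)"
      using g(3)[of "s(W := x)" m "L m" io] s W L by (simp add: x_def b_def)
    have r3: "run (L m) (Move 0 (W + 1)) (s(W := x, 0 := b), io)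
        (s(W := x, 0 := 0, W + 1 := b), io)"
      by (rule run_eq[OF run_Move]) (use s W ab in \<open>auto simp: fun_eq_iff\<close>)
    have r4: "run (L m) (Move W 0) (s(W := x, 0 := 0, W + 1 := b), io)
        (s(W + 1 := b), io)"
      by (rule run_eq[OF run_Move]) (use s W x in \<open>auto simp: fun_eq_iff x_def\<close>)
    have r5: "run (L m) cf (s(W + 1 := b), io) (s(W + 1 := b, 0 := a), io)"
      using f(3)[of "s(W + 1 := b)" m "L m" io] s W L by (simp add: x_def a_def)
    have r6: "run (L m) (Move (W + 1) 1) (s(W + 1 := b, 0 := a), io) (s(0 := a, 1 := b), io)"
      by (rule run_eq[OF run_Move]) (use s W ab in \<open>auto simp: fun_eq_iff\<close>)
    have r7: "run (L m) c (s(0 := a, 1 := b), io) (s(0 := op a b), io)"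
      by (rule run_eq[OF run_mono[OF run[of "s(0 := a, 1 := b)" ?k io] L(4)]])
        (use s W ab in \<open>auto simp: fun_eq_iff\<close>)
    show "run (L m) ?c (s, io) (s(0 := op (f (s 0)) (g (s 0))), io)"
      using run_Seq[OF r1 run_Seq[OF r2 run_Seq[OF r3 run_Seq[OF r4 run_Seq[OF r5 run_Seq[OF r6 r7]]]]]]
      by (simp only: a_def b_def x_def)
  qed
qed

lemma pspace_add:
  assumes "pspace f" "pspace g"
  shows "pspace (\<lambda>x. f x + g x)"
proof (rule pspace_bin[of 2 "Move 1 0" "\<lambda>m. m + 1" "(+)", OF _ _ _ _ assms])
  show "run (m + 1) (Move 1 0) (s, io) (s(0 := s 0 + s 1, 1 := 0), io)"
    if "s 0 < 2 ^ m" "s 1 < 2 ^ m" for m s io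
    using that by (intro run_eq[OF run_Move]) (auto simp: fun_eq_iff)
qed (auto intro!: poly_bounded_intros)

lemma pspace_diff:
  assumes "pspace f" "pspace g"
  shows "pspace (\<lambda>x. f x - g x)"
proof (rule pspace_bin[of 2 "While 1 (Dec 1 ;; Dec 0)" "\<lambda>m. m" "(-)", OF _ _ _ _ assms])
  show "run m (While 1 (Dec 1 ;; Dec 0)) (s, io) (s(0 := s 0 - s 1, 1 := 0), io)"
    if "s 0 < 2 ^ m" "s 1 < 2 ^ m" for m s io
  proof (rule run_While_regs[where n = "s 1" and \<sigma> = "\<lambda>i. s(0 := s 0 - i, 1 := s 1 - i)"])
    fix i assume "i < s 1"
    show "run m (Dec 1 ;; Dec 0) (s(0 := s 0 - i, 1 := s 1 - i), io)
      (s(0 := s 0 - Suc i, 1 := s 1 - Suc i), io)"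
      by (intro run_Dec_Seq run_eq[OF run_Dec_reg]) (auto simp: fun_eq_iff)
  qed (auto simp: fun_eq_iff)
qed (auto intro!: poly_bounded_intros)

section \<open>Pairing\<close>

definition pair :: "nat \<Rightarrow> nat \<Rightarrow> nat" where "pair a b = prod_encode (a, b)"
definition pfst :: "nat \<Rightarrow> nat" where "pfst x = fst (prod_decode x)"
definition psnd :: "nat \<Rightarrow> nat" where "psnd x = snd (prod_decode x)"

lemma pair_simps [simp]: "pfst (pair a b) = a" "psnd (pair a b) = b" "pair (pfst x) (psnd x) = x"
  by (simp_all add: pair_def pfst_def psnd_def)

lemma pfst_le: "pfst x \<le> x" and psnd_le: "psnd x \<le> x"
  using le_prod_encode_1[of "pfst x" "psnd x"] le_prod_encode_2[of "psnd x" "pfst x"] pair_simps(3)[of x]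
  by (auto simp: pair_def)

text \<open>\<open>prod_encode\<close> numbers the pairs along the diagonals of constant sum. The
  successor is one place further on the diagonal or, at its end, the start of the next one, so that
  decoding can be done by mere counting.\<close>

lemma pair_Suc:
  "psnd x \<noteq> 0 \<Longrightarrow> pfst (Suc x) = Suc (pfst x)" "psnd x \<noteq> 0 \<Longrightarrow> psnd (Suc x) = psnd x - 1"
  "psnd x = 0 \<Longrightarrow> pfst (Suc x) = 0" "psnd x = 0 \<Longrightarrow> psnd (Suc x) = Suc (pfst x)"
proof -
  have 1: "Suc x = pair (Suc (pfst x)) (psnd x - 1)" if "psnd x \<noteq> 0"
  proof -
    have "Suc x = Suc (pair (pfst x) (psnd x))" by simp
    also have "\<dots> = pair (Suc (pfst x)) (psnd x - 1)"
      using that unfolding pair_def prod_encode_def by (cases "psnd x") simp_all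
    finally show ?thesis .
  qed
  have 2: "Suc x = pair 0 (Suc (pfst x))" if "psnd x = 0"
  proof -
    have "Suc x = Suc (pair (pfst x) (psnd x))" by simp
    also have "\<dots> = pair 0 (Suc (pfst x))"
      using that unfolding pair_def prod_encode_def by simp
    finally show ?thesis .
  qed
  show "psnd x \<noteq> 0 \<Longrightarrow> pfst (Suc x) = Suc (pfst x)" "psnd x \<noteq> 0 \<Longrightarrow> psnd (Suc x) = psnd x - 1"
    using 1 by (metis pair_simps(1), metis pair_simps(2))
  show "psnd x = 0 \<Longrightarrow> pfst (Suc x) = 0" "psnd x = 0 \<Longrightarrow> psnd (Suc x) = Suc (pfst x)"
    using 2 by (metis pair_simps(1), metis pair_simps(2))
qed

lemma triangle_le: "triangle n \<le> n * n"
  by (induction n) auto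

lemma triangle_mono: "m \<le> n \<Longrightarrow> triangle m \<le> triangle n"
  by (rule lift_Suc_mono_le[of triangle]) auto

lemma pair_less:
  assumes "a < 2 ^ m" "b < 2 ^ m"
  shows "pair a b < 2 ^ (2 * m + 3)" "a + b < 2 ^ (2 * m + 3)"
proof -
  have "a + b + 1 \<le> 2 ^ (m + 1)" using assms by simp
  then have "(a + b) * (a + b) \<le> 2 ^ (m + 1) * 2 ^ (m + 1)" by (intro mult_le_mono) auto
  moreover have "(2::nat) ^ (m + 1) * 2 ^ (m + 1) = 2 ^ (2 * m + 2)"
    by (simp flip: power_add)
  moreover have "a < 2 ^ (2 * m + 2)" "a + b < 2 ^ (2 * m + 3)"
  proof -
    show "a < 2 ^ (2 * m + 2)" using assms(1) by (rule less_power2_mono) simp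
    have "a + b < 2 ^ (m + 1)" using assms by simp
    then show "a + b < 2 ^ (2 * m + 3)" by (rule less_power2_mono) simp
  qed
  moreover have "pair a b \<le> (a + b) * (a + b) + a"
    using triangle_le[of "a + b"] by (simp add: pair_def prod_encode_def)
  moreover have "(2::nat) ^ (2 * m + 3) = 2 ^ (2 * m + 2) + 2 ^ (2 * m + 2)"
    by (simp add: numeral_eq_Suc)
  ultimately show "pair a b < 2 ^ (2 * m + 3)" "a + b < 2 ^ (2 * m + 3)" by linarith+
qed

text \<open>The code of \<open>(a, b)\<close> is \<open>a\<close> plus the triangular number of
  \<open>a + b\<close>; the loop adds up \<open>a + b\<close>, \<open>a + b - 1\<close>, and so on
  down to 1.\<close>

definition pair_prog :: prog where
  "pair_prog = Move2 0 2 3 ;; Move 1 2 ;; While 2 (Move2 2 3 4 ;; Move 4 2 ;; Dec 2) ;; Move 3 0"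

lemma run_pair_prog:
  assumes s: "s 0 < 2 ^ m" "s 1 < 2 ^ m" "\<And>r. 1 < r \<Longrightarrow> r < 5 \<Longrightarrow> s r = 0"
  shows "run (2 * m + 3) pair_prog (s, io) (s(0 := pair (s 0) (s 1), 1 := 0), io)"
proof -
  let ?L = "2 * m + 3"
  define a where "a = s 0"
  define b where "b = s 1"
  define n where "n = a + b"
  have z: "s 2 = 0" "s 3 = 0" "s 4 = 0" using s(3) by auto
  have P: "pair a b < 2 ^ ?L" "n < 2 ^ ?L"
    using pair_less[of a m b] s by (auto simp: a_def b_def n_def)
  have pair: "pair a b = triangle n + a" by (simp add: pair_def prod_encode_def n_def)
  have a: "a < 2 ^ ?L" "b < 2 ^ ?L" using P by (auto simp: n_def)
  let ?\<sigma> = "\<lambda>i. s(0 := 0, 1 := 0, 2 := n - i, 3 := a + (triangle n - triangle (n - i)))"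
  have r1: "run ?L (Move2 0 2 3) (s, io) (s(0 := 0, 2 := a, 3 := a), io)"
    by (rule run_eq[OF run_Move2]) (use z a in \<open>auto simp: fun_eq_iff a_def\<close>)
  have r2: "run ?L (Move 1 2) (s(0 := 0, 2 := a, 3 := a), io) (?\<sigma> 0, io)"
    by (rule run_eq[OF run_Move]) (use z P in \<open>auto simp: fun_eq_iff n_def b_def\<close>)
  have r3: "run ?L (While 2 (Move2 2 3 4 ;; Move 4 2 ;; Dec 2)) (?\<sigma> 0, io) (?\<sigma> n, io)"
  proof (rule run_While_regs[where \<sigma> = ?\<sigma> and n = n])
    fix i assume i: "i < n"
    then obtain k where k: "n - i = Suc k" "n - Suc i = k" by (metis Suc_diff_Suc)
    have t: "triangle (Suc k) \<le> triangle n" "triangle k \<le> triangle n" "triangle (Suc k) = triangle k + Suc k"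
      using k by (auto intro!: triangle_mono simp del: triangle_Suc) (auto)
    show "run ?L (Move2 2 3 4 ;; Move 4 2 ;; Dec 2) (?\<sigma> i, io) (?\<sigma> (Suc i), io)"
      unfolding k
      by (rule run_Seq[OF run_Move2 run_Move_Seq[OF _ _ run_eq[OF run_Dec_reg]]])
        (use z P pair t k in \<open>auto simp: fun_eq_iff simp del: triangle_Suc\<close>)
  qed auto
  have r4: "run ?L (Move 3 0) (?\<sigma> n, io) (s(0 := pair a b, 1 := 0), io)"
    by (rule run_eq[OF run_Move]) (use z P pair in \<open>auto simp: fun_eq_iff\<close>)
  show ?thesis
    using run_Seq[OF r1 run_Seq[OF r2 run_Seq[OF r3 r4]]] by (simp only: pair_prog_def a_def b_def)
qed

lemma pspace_pair:
  assumes "pspace f" "pspace g"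
  shows "pspace (\<lambda>x. pair (f x) (g x))"
proof (rule pspace_bin[of 5 pair_prog "\<lambda>m. 2 * m + 3" pair, OF _ _ _ _ assms])
  show "wf_prog 5 pair_prog" by (simp add: pair_prog_def)
qed (auto intro!: poly_bounded_intros run_pair_prog pair_less simp del: One_nat_def)

text \<open>Enumerates the pairs in the order of their codes.\<close>

definition unpair_prog :: prog where
  "unpair_prog = While 0 (Dec 0 ;; Inc 3 ;;
     While 2 (Dec 2 ;; Dec 3 ;; Inc 1 ;; Move 2 4) ;; Move 4 2 ;;
     While 3 (Dec 3 ;; Move 1 2 ;; Inc 2))"

lemma run_unpair_prog:
  assumes s: "s 0 < 2 ^ m" "\<And>r. 0 < r \<Longrightarrow> r < 5 \<Longrightarrow> s r = 0"
  shows "run (m + 1) unpair_prog (s, io) (s(0 := 0, 1 := pfst (s 0), 2 := psnd (s 0)), io)"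
  unfolding unpair_prog_def
proof (rule run_While_regs[where n = "s 0"
      and \<sigma> = "\<lambda>i. s(0 := s 0 - i, 1 := pfst i, 2 := psnd i)"])
  have z: "s 1 = 0" "s 2 = 0" "s 3 = 0" "s 4 = 0" using s(2) by auto
  fix i assume i: "i < s 0"
  have L: "Suc (pfst i) < 2 ^ (m + 1)" "Suc (psnd i) < 2 ^ (m + 1)" "1 < (2::nat) ^ (m + 1)"
    using pfst_le[of i] psnd_le[of i] i s(1) by auto
  let ?s = "s(0 := s 0 - i, 1 := pfst i, 2 := psnd i)"
  let ?s' = "s(0 := s 0 - Suc i, 1 := pfst (Suc i), 2 := psnd (Suc i))"
  show "run (m + 1) (Dec 0 ;; Inc 3 ;; While 2 (Dec 2 ;; Dec 3 ;; Inc 1 ;; Move 2 4) ;; Move 4 2 ;;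
     While 3 (Dec 3 ;; Move 1 2 ;; Inc 2)) (?s, io) (?s', io)"
  \<comment> \<open>Both inner loops act as conditionals and run at most once. Register 3 is a flag:
    the loop on register 2 clears it if the second component is positive; otherwise the loop on
    register 3 starts a new diagonal.\<close>
  proof (cases "psnd i = 0")
    case True
    show ?thesis
      by (intro run_Dec_Seq run_Inc_Seq run_Seq[OF run_While_none] run_Move_Seq run_While_once
          run_eq[OF run_Inc_reg])
        (use True z L pair_Suc[of i] in \<open>auto simp: fun_eq_iff\<close>)
  next
    case False
    let ?t = "?s(0 := s 0 - Suc i, 3 := 1)"
    let ?t' = "?s'(2 := 0, 4 := psnd i - 1)"
    have "run (m + 1) (While 2 (Dec 2 ;; Dec 3 ;; Inc 1 ;; Move 2 4)) (?t, io) (?t', io)"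
      by (intro run_While_once run_Dec_Seq run_Inc_Seq run_eq[OF run_Move])
        (use False z L pair_Suc[of i] in \<open>auto simp: fun_eq_iff\<close>)
    moreover have "run (m + 1) (Move 4 2 ;; While 3 (Dec 3 ;; Move 1 2 ;; Inc 2)) (?t', io) (?s', io)"
      by (intro run_Move_Seq run_eq[OF run_While_none])
        (use False z L pair_Suc[of i] in \<open>auto simp: fun_eq_iff\<close>)
    ultimately have "run (m + 1) (While 2 (Dec 2 ;; Dec 3 ;; Inc 1 ;; Move 2 4) ;; Move 4 2 ;;
        While 3 (Dec 3 ;; Move 1 2 ;; Inc 2)) (?t, io) (?s', io)" by (rule run_Seq)
    moreover have "?t = ?s(0 := ?s 0 - 1, 3 := (?s(0 := ?s 0 - 1)) 3 + 1)"
      using z by (auto simp: fun_eq_iff)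
    ultimately show ?thesis
      using z L by (intro run_Dec_Seq run_Inc_Seq) simp_all
  qed
qed (use s in \<open>auto simp: fun_eq_iff pfst_def psnd_def prod_decode_def prod_decode_aux.simps\<close>)

lemma pspace_pfst': "pspace pfst"
proof (rule pspaceI[of 5 "unpair_prog ;; Clear 2 ;; Move 1 0" "\<lambda>m. m + 1"])
  fix m :: nat and s :: "nat \<Rightarrow> nat" and io
  assume s: "s 0 < 2 ^ m" "\<And>r. 0 < r \<Longrightarrow> r < 5 \<Longrightarrow> s r = (0::nat)"
  have z: "s 1 = 0" "s 2 = 0" using s(2) by auto
  show "run (m + 1) (unpair_prog ;; Clear 2 ;; Move 1 0) (s, io) (s(0 := pfst (s 0)), io)"
    by (rule run_Seq[OF run_unpair_prog run_Clear_Seq[OF run_eq[OF run_Move]]])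
      (use s z pfst_le[of "s 0"] in \<open>auto simp: fun_eq_iff\<close>)
next
  show "pfst x < 2 ^ (m + 1)" if "x < 2 ^ m" for x m using pfst_le[of x] that by simp
qed (auto intro!: poly_bounded_intros simp: unpair_prog_def)

lemma pspace_psnd': "pspace psnd"
proof (rule pspaceI[of 5 "unpair_prog ;; Clear 1 ;; Move 2 0" "\<lambda>m. m + 1"])
  fix m :: nat and s :: "nat \<Rightarrow> nat" and io
  assume s: "s 0 < 2 ^ m" "\<And>r. 0 < r \<Longrightarrow> r < 5 \<Longrightarrow> s r = (0::nat)"
  have z: "s 1 = 0" "s 2 = 0" using s(2) by auto
  show "run (m + 1) (unpair_prog ;; Clear 1 ;; Move 2 0) (s, io) (s(0 := psnd (s 0)), io)"
    by (rule run_Seq[OF run_unpair_prog run_Clear_Seq[OF run_eq[OF run_Move]]])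
      (use s z psnd_le[of "s 0"] in \<open>auto simp: fun_eq_iff\<close>)
next
  show "psnd x < 2 ^ (m + 1)" if "x < 2 ^ m" for x m using psnd_le[of x] that by simp
qed (auto intro!: poly_bounded_intros simp: unpair_prog_def)

lemmas pspace_pfst = pspace_comp[OF pspace_pfst']
lemmas pspace_psnd = pspace_comp[OF pspace_psnd']

section \<open>Unbounded loops, recursion and exponentially long sums\<close>

text \<open>Only the size of the states is restricted, not the number of rounds, and only up to the
  first state that passes the test. This is where free running time enters.\<close>

lemma pspace_while:
  assumes init: "pspace init" and step: "pspace step" and test: "pspace b"
    and terminates: "\<And>x. \<exists>t. b ((step ^^ t) (init x)) = 0"
    and Q: "poly_bounded Q" "\<And>m x t. x < 2 ^ m \<Longrightarrow> (\<And>u. u < t \<Longrightarrow> b ((step ^^ u) (init x)) \<noteq> 0) \<Longrightarrow>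
      (step ^^ t) (init x) < 2 ^ Q m"
  shows "pspace (\<lambda>x. (step ^^ (LEAST t. b ((step ^^ t) (init x)) = 0)) (init x))"
proof -
  obtain ci wi qi where "computes wi ci qi init"
    using init unfolding pspace_def by blast
  note i = computesD[OF this]
  obtain cs ws qs where "computes ws cs qs step"
    using step unfolding pspace_def by blast
  note s = computesD[OF this]
  obtain cb wb qb where "computes wb cb qb b"
    using test unfolding pspace_def by blast
  note b = computesD[OF this]
  obtain Q' where Q': "\<And>m. Q m \<le> poly Q' m" using Q(1) unfolding poly_bounded_def by blast
  define W where "W = wi + ws + wb + 1"
  define L where "L m = poly qi m + poly Q' m + poly qs (poly Q' m) + poly qb (poly Q' m)" for m
  define F where "F = W + 2"
  \<comment> \<open>Evaluating the test destroys its argument, so a copy waits in register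
    \<open>W\<close>; the result goes to the flag \<open>F\<close>, which controls the loop.\<close>
  let ?T = "Copy 0 W (W + 1) ;; cb ;; Move 0 F ;; Move W 0"
  let ?c = "ci ;; ?T ;; While F (Clear F ;; cs ;; ?T)"
  let ?t = "\<lambda>x. LEAST t. b ((step ^^ t) (init x)) = 0"
  have W: "0 < W" "wi < W" "ws < W" "wb < W" "F = W + 2" by (auto simp: W_def F_def)
  have least: "b ((step ^^ ?t x) (init x)) = 0" "\<And>u. u < ?t x \<Longrightarrow> b ((step ^^ u) (init x)) \<noteq> 0" for x
    using LeastI_ex[OF terminates[of x]] not_less_Least by blast+
  have bound: "(step ^^ u) (init x) < 2 ^ poly Q' m" if "x < 2 ^ m" "u \<le> ?t x" for x u m
    using Q(2)[OF that(1), of u] least(2)[of _ x] that(2) Q'[of m] by (auto elim!: less_power2_mono)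
  have T: "run (L m) ?T (s, io) (s(F := b (s 0)), io)"
    if "s 0 < 2 ^ poly Q' m" "\<And>r. 0 < r \<Longrightarrow> r < W + 3 \<Longrightarrow> s r = 0" for m s io
  proof -
    have L: "poly Q' m \<le> L m" "poly qb (poly Q' m) \<le> L m" by (auto simp: L_def)
    have x: "s 0 < 2 ^ L m" "b (s 0) < 2 ^ L m"
      using that(1) L b(2)[OF that(1)] by (auto elim!: less_power2_mono)
    have r1: "run (L m) (Copy 0 W (W + 1)) (s, io) (s(W := s 0), io)"
      using run_Copy[of 0 W "W + 1" s "L m" io] that(2) W x by simp
    have r2: "run (L m) cb (s(W := s 0), io) (s(W := s 0, 0 := b (s 0)), io)"
      using b(3)[of "s(W := s 0)" "poly Q' m" "L m" io] that W L by simp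
    have r3: "run (L m) (Move 0 F) (s(W := s 0, 0 := b (s 0)), io)
        (s(W := s 0, 0 := 0, F := b (s 0)), io)"
      by (rule run_eq[OF run_Move]) (use that W x in \<open>auto simp: fun_eq_iff\<close>)
    have r4: "run (L m) (Move W 0) (s(W := s 0, 0 := 0, F := b (s 0)), io) (s(F := b (s 0)), io)"
      by (rule run_eq[OF run_Move]) (use that W x in \<open>auto simp: fun_eq_iff\<close>)
    show ?thesis by (rule run_Seq[OF r1 run_Seq[OF r2 run_Seq[OF r3 r4]]])
  qed
  show ?thesis
  proof (rule pspaceI[of "W + 3" ?c L])
    show "poly_bounded L" unfolding L_def by (intro poly_bounded_intros)
    show "wf_prog (W + 3) ?c"
      using i(1) s(1) b(1) W by (auto intro: wf_prog_mono)
    show "(step ^^ ?t x) (init x) < 2 ^ L m" if "x < 2 ^ m" for x m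
      using bound[OF that order_refl] by (rule less_power2_mono) (simp add: L_def)
  next
    fix m :: nat and s :: "nat \<Rightarrow> nat" and io
    assume s0: "s 0 < 2 ^ m" "\<And>r. 0 < r \<Longrightarrow> r < W + 3 \<Longrightarrow> s r = 0"
    define x where "x = s 0"
    define n where "n = ?t x"
    let ?y = "\<lambda>i. (step ^^ i) (init x)"
    let ?\<sigma> = "\<lambda>i. s(0 := ?y i, F := b (?y i))"
    have y: "?y k < 2 ^ poly Q' m" if "k \<le> n" for k
      using bound[of x m k] s0(1) that by (simp add: x_def n_def)
    have r1: "run (L m) ci (s, io) (s(0 := ?y 0), io)"
      using i(3)[of s m "L m" io] s0 W by (simp add: x_def L_def)
    have r2: "run (L m) ?T (s(0 := ?y 0), io) (?\<sigma> 0, io)"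
      using T[of "s(0 := ?y 0)" m io] y[of 0] s0 by simp
    have r3: "run (L m) (While F (Clear F ;; cs ;; ?T)) (?\<sigma> 0, io) (?\<sigma> n, io)"
    proof (rule run_While_regs[where \<sigma> = ?\<sigma> and n = n])
      fix k assume k: "k < n"
      show "?\<sigma> k F \<noteq> 0" using least(2)[of k x] k by (simp add: n_def)
      have q1: "run (L m) (Clear F) (?\<sigma> k, io) (s(0 := ?y k), io)"
        by (rule run_eq[OF run_Clear]) (use s0(2) W in \<open>auto simp: fun_eq_iff\<close>)
      have q2: "run (L m) cs (s(0 := ?y k), io) (s(0 := ?y (Suc k)), io)"
        using s(3)[of "s(0 := ?y k)" "poly Q' m" "L m" io] y[of k] k s0 W
        by (simp add: L_def)
      have q3: "run (L m) ?T (s(0 := ?y (Suc k)), io) (?\<sigma> (Suc k), io)"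
        using T[of "s(0 := ?y (Suc k))" m io] y[of "Suc k"] k s0 by simp
      show "run (L m) (Clear F ;; cs ;; ?T) (?\<sigma> k, io) (?\<sigma> (Suc k), io)"
        by (rule run_Seq[OF q1 run_Seq[OF q2 q3]])
    qed (use least(1)[of x] in \<open>auto simp: n_def\<close>)
    have "?\<sigma> n = s(0 := ?y n)" using least(1)[of x] s0(2)[of F] W by (auto simp: n_def fun_eq_iff)
    then show "run (L m) ?c (s, io) (s(0 := (step ^^ ?t (s 0)) (init (s 0))), io)"
      using run_Seq[OF r1 run_Seq[OF r2 r3]] by (simp only: n_def x_def)
  qed
qed

lemma pspace_pair_bounded:
  "a < 2 ^ m \<Longrightarrow> b < 2 ^ n \<Longrightarrow> pair a b < 2 ^ (2 * (m + n) + 3)"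
  by (rule pair_less) (auto elim: less_power2_mono)

text \<open>The loop state is the triple of the argument, the round number and the current value. No
  earlier value is stored, so exponentially many rounds are affordable as long as each value is of
  polynomial length.\<close>

lemma pspace_rec:
  assumes "pspace init" "pspace cnt" "pspace (\<lambda>z. h (pfst z) (pfst (psnd z)) (psnd (psnd z)))"
    and Q: "poly_bounded Q"
      "\<And>m x t. x < 2 ^ m \<Longrightarrow> t \<le> cnt x \<Longrightarrow> rec_nat (init x) (h x) t < 2 ^ Q m"
  shows "pspace (\<lambda>x. rec_nat (init x) (h x) (cnt x))"
proof -
  let ?h = "\<lambda>z. h (pfst z) (pfst (psnd z)) (psnd (psnd z))"
  let ?step = "\<lambda>z. pair (pfst z) (pair (Suc (pfst (psnd z))) (?h z))"
  let ?b = "\<lambda>z. cnt (pfst z) - pfst (psnd z)"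
  let ?init = "\<lambda>x. pair x (pair 0 (init x))"
  have step: "(?step ^^ t) (?init x) = pair x (pair t (rec_nat (init x) (h x) t))" for t x
    by (induction t) auto
  have least: "(LEAST t. ?b ((?step ^^ t) (?init x)) = 0) = cnt x" for x
    by (rule Least_equality) (simp_all add: step)
  obtain q where q: "\<And>m x. x < 2 ^ m \<Longrightarrow> cnt x < 2 ^ poly q m"
    using assms(2) by (rule pspace_bounded) blast
  define Q' where "Q' m = 2 * (m + (2 * (poly q m + Q m) + 3)) + 3" for m
  have "pspace (\<lambda>x. (?step ^^ (LEAST t. ?b ((?step ^^ t) (?init x)) = 0)) (?init x))"
  proof (rule pspace_while[where Q = Q'])
    show "pspace ?init"
      by (intro pspace_pair pspace_id pspace_const assms)
    show "pspace ?step"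
      by (intro pspace_pair pspace_pfst pspace_psnd pspace_Suc pspace_id assms)
    show "pspace ?b"
      by (intro pspace_diff pspace_comp[OF assms(2)] pspace_pfst pspace_psnd pspace_id)
    show "\<exists>t. ?b ((?step ^^ t) (?init x)) = 0" for x
      by (rule exI[of _ "cnt x"]) (simp add: step)
    show "poly_bounded Q'" unfolding Q'_def by (intro poly_bounded_intros Q)
  next
    fix m x t :: nat
    assume x: "x < 2 ^ m" and *: "\<And>u. u < t \<Longrightarrow> ?b ((?step ^^ u) (?init x)) \<noteq> 0"
    have "\<not> cnt x < t" using *[of "cnt x"] unfolding step by auto
    then have t: "t \<le> cnt x" by simp
    then have "t < 2 ^ poly q m" using q[OF x] by simp
    then show "(?step ^^ t) (?init x) < 2 ^ Q' m"
      unfolding step Q'_def by (intro pspace_pair_bounded x Q(2) t)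
  qed
  then have "pspace (\<lambda>x. psnd (psnd ((?step ^^ (LEAST t. ?b ((?step ^^ t) (?init x)) = 0)) (?init x))))"
    by (intro pspace_psnd)
  then show ?thesis unfolding least unfolding step by simp
qed

text \<open>The number of terms and the size of each are at most exponential, so the lengths of the
  two bounds add up to a bound for every partial sum.\<close>

lemma pspace_sum:
  assumes "pspace cnt" "pspace (\<lambda>z. f (pfst z) (psnd z))"
  shows "pspace (\<lambda>x. \<Sum>t<cnt x. f x t)"
proof -
  obtain q where q: "\<And>m x. x < 2 ^ m \<Longrightarrow> cnt x < 2 ^ poly q m"
    using assms(1) by (rule pspace_bounded) blast
  obtain p where p: "\<And>m z. z < 2 ^ m \<Longrightarrow> f (pfst z) (psnd z) < 2 ^ poly p m"
    using assms(2) by (rule pspace_bounded) blast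
  have sum: "rec_nat 0 (\<lambda>t a. a + f x t) n = (\<Sum>t<n. f x t)" for x n
    by (induction n) auto
  define P where "P m = poly p (2 * (m + poly q m) + 3)" for m
  have f: "f x u < 2 ^ P m" if "x < 2 ^ m" "u < cnt x" for x u m
    using p[of "pair x u" "2 * (m + poly q m) + 3"] pspace_pair_bounded[of x m u "poly q m"]
      q[OF that(1)] that by (auto simp: P_def)
  have "pspace (\<lambda>x. rec_nat 0 (\<lambda>t a. a + f x t) (cnt x))"
  proof (rule pspace_rec[where Q = "\<lambda>m. poly q m + P m"])
    show "pspace (\<lambda>z. psnd (psnd z) + f (pfst z) (pfst (psnd z)))"
    proof -
      have "pspace (\<lambda>z. pair (pfst z) (pfst (psnd z)))"
        by (intro pspace_psnd pspace_pfst pspace_pair pspace_id)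
      from pspace_comp[OF assms(2) this] show ?thesis
        by (auto intro!: pspace_add pspace_psnd pspace_id)
    qed
    show "poly_bounded (\<lambda>m. poly q m + P m)" unfolding P_def by (intro poly_bounded_intros)
    fix m x t :: nat
    assume x: "x < 2 ^ m" and t: "t \<le> cnt x"
    have "(\<Sum>u<t. f x u) \<le> (\<Sum>u<t. 2 ^ P m)"
      using f[OF x] t by (intro sum_mono) (meson lessThan_iff less_imp_le less_le_trans)
    also have "\<dots> = t * 2 ^ P m" by simp
    also have "\<dots> < 2 ^ poly q m * 2 ^ P m" using q[OF x] t by simp
    finally show "rec_nat 0 (\<lambda>t a. a + f x t) t < 2 ^ (poly q m + P m)"
      unfolding sum by (simp add: power_add)
  qed (intro pspace_const assms)+
  then show ?thesis unfolding sum .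
qed

lemma pspace_mult:
  assumes "pspace f" "pspace g"
  shows "pspace (\<lambda>x. f x * g x)"
  using pspace_sum[OF assms(1), of "\<lambda>x t. g x"] pspace_comp[OF assms(2)] pspace_pfst[OF pspace_id]
  by simp

section \<open>Predicates as functions with values 0 and 1, and division\<close>

lemma pspace_not: "pspace (\<lambda>x. of_bool (P x)) \<Longrightarrow> pspace (\<lambda>x. of_bool (\<not> P x))"
proof -
  assume "pspace (\<lambda>x. of_bool (P x))"
  then have "pspace (\<lambda>x. 1 - of_bool (P x))" by (intro pspace_diff pspace_const)
  moreover have "(\<lambda>x. 1 - of_bool (P x)) = (\<lambda>x. of_bool (\<not> P x) :: nat)" by (auto simp: fun_eq_iff)
  ultimately show ?thesis by simp
qed

lemma pspace_conj:
  "pspace (\<lambda>x. of_bool (P x)) \<Longrightarrow> pspace (\<lambda>x. of_bool (Q x)) \<Longrightarrow> pspace (\<lambda>x. of_bool (P x \<and> Q x))"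
  using pspace_mult[of "\<lambda>x. of_bool (P x)" "\<lambda>x. of_bool (Q x)"] by (simp add: of_bool_conj)

lemma pspace_imp:
  "pspace (\<lambda>x. of_bool (P x)) \<Longrightarrow> pspace (\<lambda>x. of_bool (Q x)) \<Longrightarrow> pspace (\<lambda>x. of_bool (P x \<longrightarrow> Q x))"
  using pspace_not[OF pspace_conj[OF _ pspace_not, of P Q]] by simp

lemma pspace_iff:
  "pspace (\<lambda>x. of_bool (P x)) \<Longrightarrow> pspace (\<lambda>x. of_bool (Q x)) \<Longrightarrow> pspace (\<lambda>x. of_bool (P x \<longleftrightarrow> Q x))"
  using pspace_conj[OF pspace_imp[of P Q] pspace_imp[of Q P]] by (simp add: iff_conv_conj_imp)

lemma pspace_le: "pspace f \<Longrightarrow> pspace g \<Longrightarrow> pspace (\<lambda>x. of_bool (f x \<le> g x))"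
proof -
  assume "pspace f" "pspace g"
  then have "pspace (\<lambda>x. 1 - (f x - g x))" by (intro pspace_diff pspace_const)
  moreover have "(\<lambda>x. 1 - (f x - g x)) = (\<lambda>x. of_bool (f x \<le> g x))" by (auto simp: fun_eq_iff)
  ultimately show ?thesis by simp
qed

lemma pspace_less: "pspace f \<Longrightarrow> pspace g \<Longrightarrow> pspace (\<lambda>x. of_bool (f x < g x))"
  using pspace_le[OF pspace_Suc] by (simp add: Suc_le_eq)

lemma pspace_eq: "pspace f \<Longrightarrow> pspace g \<Longrightarrow> pspace (\<lambda>x. of_bool (f x = g x))"
  using pspace_conj[OF pspace_le[of f g] pspace_le[of g f]] by (simp add: eq_iff)

lemma pspace_if:
  assumes "pspace (\<lambda>x. of_bool (P x))" "pspace f" "pspace g"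
  shows "pspace (\<lambda>x. if P x then f x else g x)"
proof -
  have "pspace (\<lambda>x. of_bool (P x) * f x + of_bool (\<not> P x) * g x)"
    using assms by (intro pspace_add pspace_mult pspace_not)
  moreover have "(\<lambda>x. of_bool (P x) * f x + of_bool (\<not> P x) * g x) = (\<lambda>x. if P x then f x else g x)"
    by auto
  ultimately show ?thesis by simp
qed

text \<open>Quantification over an exponential range is decided by counting the
  counterexamples.\<close>

lemma pspace_all_less:
  assumes "pspace c" "pspace (\<lambda>z. of_bool (P (pfst z) (psnd z)))"
  shows "pspace (\<lambda>x. of_bool (\<forall>t<c x. P x t))"
proof -
  have "pspace (\<lambda>x. of_bool ((\<Sum>t<c x. of_bool (\<not> P x t)) = (0::nat)))"
    using assms by (intro pspace_eq pspace_const pspace_sum pspace_not)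
  moreover have "(\<Sum>t<c x. of_bool (\<not> P x t)) = (0::nat) \<longleftrightarrow> (\<forall>t<c x. P x t)" for x
    by (simp add: sum_eq_0_iff) auto
  ultimately show ?thesis by simp
qed

lemma pspace_div:
  assumes "pspace f" "pspace g"
  shows "pspace (\<lambda>x. f x div g x)"
proof -
  \<comment> \<open>The quotient counts the positive multiples of \<open>b\<close> up to
    \<open>a\<close>. The case \<open>b = 0\<close> is separate because the sum would then count
    every \<open>t\<close>, whereas \<open>a div 0 = 0\<close>.\<close>
  have "a div b = (if b = 0 then 0 else \<Sum>t<a. of_bool (Suc t * b \<le> a))" for a b :: nat
  proof (cases "b = 0")
    case False
    have "{..<a} \<inter> {t. Suc t * b \<le> a} = {..<a div b}"
      using False by (auto simp flip: less_eq_div_iff_mult_less_eq simp del: mult_Suc simp: Suc_le_eq)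
        (meson div_le_dividend less_le_trans)
    then show ?thesis using False by (simp add: of_bool_def sum.If_cases del: mult_Suc)
  qed simp
  moreover have "pspace (\<lambda>x. if g x = 0 then 0 else \<Sum>t<f x. of_bool (Suc t * g x \<le> f x))"
    by (intro pspace_if pspace_eq pspace_const pspace_sum pspace_le pspace_mult pspace_Suc
        pspace_comp[OF assms(1)] pspace_comp[OF assms(2)] pspace_pfst pspace_psnd pspace_id)
  ultimately show ?thesis by simp
qed

lemma pspace_mod:
  assumes "pspace f" "pspace g"
  shows "pspace (\<lambda>x. f x mod g x)"
  using pspace_diff[OF assms(1) pspace_mult[OF pspace_div[OF assms] assms(2)]]
  by (simp add: minus_div_mult_eq_mod)

lemma pspace_odd: "pspace f \<Longrightarrow> pspace (\<lambda>x. of_bool (odd (f x)))"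
  using pspace_mod[OF _ pspace_const[of 2]] by (simp add: mod_2_eq_odd)

lemma pspace_even: "pspace f \<Longrightarrow> pspace (\<lambda>x. of_bool (even (f x)))"
  using pspace_not[OF pspace_odd] by simp

lemma pspace_poly: "pspace f \<Longrightarrow> pspace (\<lambda>x. poly q (f x))"
proof (induction q)
  case 0
  then show ?case by (simp add: pspace_const)
next
  case (pCons a q)
  then show ?case by (auto intro!: pspace_add pspace_mult pspace_const)
qed

lemmas pspace_intros = pspace_id pspace_const pspace_Suc pspace_add pspace_diff pspace_mult
  pspace_div pspace_mod pspace_pair pspace_pfst pspace_psnd pspace_not pspace_conj pspace_imp
  pspace_iff pspace_le pspace_less pspace_eq pspace_if pspace_all_less pspace_sum pspace_odd
  pspace_even pspace_poly

lemma pspace_fin_sum: "(\<And>j. j < k \<Longrightarrow> pspace (f j)) \<Longrightarrow> pspace (\<lambda>x. \<Sum>j<k. f j x)" for k :: nat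
  by (induction k) (auto intro!: pspace_intros)

text \<open>Nothing is assumed of \<open>\<phi>\<close>: it is consulted for finitely many argument
  lists only, so its values become constants of the program. In this way the commands of a machine,
  which are arbitrary functions, enter the simulation.\<close>

lemma pspace_finite_table:
  "(\<And>f. f \<in> set fs \<Longrightarrow> pspace f) \<Longrightarrow>
    pspace (\<lambda>x. if \<forall>f\<in>set fs. f x < G then \<phi> (map (\<lambda>f. f x) fs) else 0)"
proof (induction fs arbitrary: \<phi>)
  case Nil
  then show ?case by (simp add: pspace_const)
next
  case (Cons f fs)
  let ?g = "\<lambda>a x. if \<forall>f\<in>set fs. f x < G then \<phi> (a # map (\<lambda>f. f x) fs) else 0"
  have "pspace (\<lambda>x. \<Sum>a<G. of_bool (f x = a) * ?g a x)"
    using Cons.IH[of "\<lambda>l. \<phi> (_ # l)"] Cons.prems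
    by (intro pspace_fin_sum pspace_mult pspace_eq pspace_const) auto
  moreover have "(\<Sum>a<G. of_bool (f x = a) * ?g a x) =
      (if \<forall>f\<in>set (f # fs). f x < G then \<phi> (map (\<lambda>f. f x) (f # fs)) else 0)" for x
  proof (cases "f x < G")
    case True
    have "(\<Sum>a<G. of_bool (f x = a) * ?g a x) = (\<Sum>a\<in>{f x}. of_bool (f x = a) * ?g a x)"
      using True by (intro sum.mono_neutral_right) auto
    also have "\<dots> = ?g (f x) x" by auto
    finally show ?thesis using True by (simp only: list.set ball_simps list.map simp_thms)
  next
    case False
    then have "(\<Sum>a<G. of_bool (f x = a) * ?g a x) = 0" by (intro sum.neutral) auto
    then show ?thesis using False by simp
  qed
  ultimately show ?case by (simp only:)
qed

section \<open>Words as numbers in base \<open>g\<close>, least significant digit first\<close>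

fun digs :: "nat \<Rightarrow> nat \<Rightarrow> nat list" where
  "digs g n = (if n = 0 \<or> g < 2 then [] else n mod g # digs g (n div g))"

declare digs.simps [simp del]

lemma digs_0 [simp]: "digs g 0 = []"
  by (simp add: digs.simps)

lemma digs_rec: "2 \<le> g \<Longrightarrow> n \<noteq> 0 \<Longrightarrow> digs g n = n mod g # digs g (n div g)"
  by (subst digs.simps) simp

lemma length_digs_le: "n < 2 ^ m \<Longrightarrow> length (digs g n) \<le> m"
proof (induction m arbitrary: n)
  case (Suc m)
  show ?case
  proof (cases "n = 0 \<or> g < 2")
    case True
    then show ?thesis by (simp add: digs.simps)
  next
    case False
    have "n div g \<le> n div 2" using False by (intro div_le_mono2) auto
    also have "\<dots> < 2 ^ m" using Suc.prems by (simp add: less_mult_imp_div_less)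
    finally show ?thesis using Suc.IH False by (subst digs.simps) simp
  qed
qed simp

abbreviation undigs :: "nat \<Rightarrow> nat list \<Rightarrow> nat" where
  "undigs \<equiv> horner_sum (\<lambda>d. d)"

text \<open>Digits 0 at the end of a word would leave no trace in the number. The symbols of the
  words to be recovered are at least 2.\<close>

lemma digs_undigs: "2 \<le> g \<Longrightarrow> (\<And>d. d \<in> set ds \<Longrightarrow> 0 < d \<and> d < g) \<Longrightarrow> digs g (undigs g ds) = ds"
proof (induction ds)
  case (Cons d ds)
  then have "0 < d" "d < g" by auto
  then show ?case using Cons by (subst digs_rec) auto
qed simp

lemma rec_nat_const: "rec_nat a (\<lambda>_. F) t = (F ^^ t) a"
  by (induction t) auto

lemma pspace_fold_digs:
  assumes g: "2 \<le> g" and "pspace init" "pspace W"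
    and h: "pspace (\<lambda>z. h (pfst z) (pfst (psnd z)) (psnd (psnd z)))"
    and Q: "poly_bounded Q"
      "\<And>m x t. x < 2 ^ m \<Longrightarrow> fold (h x) (take t (digs g (W x))) (init x) < 2 ^ Q m"
  shows "pspace (\<lambda>x. fold (h x) (digs g (W x)) (init x))"
proof -
  let ?F = "\<lambda>x z. if pfst z = 0 then z else pair (pfst z div g) (h x (pfst z mod g) (psnd z))"
  have F: "\<exists>w'\<le>w. (?F x ^^ t) (pair w a) = pair w' (fold (h x) (take t (digs g w)) a)" for x t w a
  proof (induction t arbitrary: w a)
    case (Suc t)
    show ?case
    proof (cases "w = 0")
      case True
      then show ?thesis using Suc[of 0 a] by (auto simp: funpow_Suc_right simp del: funpow.simps)
    next
      case False
      obtain w' where "w' \<le> w div g"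
        "(?F x ^^ t) (pair (w div g) (h x (w mod g) a)) =
          pair w' (fold (h x) (take t (digs g (w div g))) (h x (w mod g) a))"
        using Suc by blast
      then show ?thesis using False g
        by (intro exI[of _ w']) (auto simp: funpow_Suc_right digs_rec intro: le_trans simp del: funpow.simps)
    qed
  qed auto
  obtain q where q: "\<And>m x. x < 2 ^ m \<Longrightarrow> W x < 2 ^ poly q m"
    using assms(3) by (rule pspace_bounded) blast
  define Q' where "Q' m = 2 * (poly q m + Q m) + 3" for m
  \<comment> \<open>\<open>W x\<close> rounds cover all digits, since there are at most
    \<open>W x\<close> of them; once the number is used up, \<open>?F\<close> is the
    identity.\<close>
  have "pspace (\<lambda>x. rec_nat (pair (W x) (init x)) (\<lambda>_. ?F x) (W x))"
  proof (rule pspace_rec[where Q = Q'])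
    show "poly_bounded Q'" unfolding Q'_def by (intro poly_bounded_intros Q)
    show "pspace (\<lambda>z. ?F (pfst z) (psnd (psnd z)))"
    proof -
      have "pspace (\<lambda>z. pair (pfst z) (pair (pfst (psnd (psnd z)) mod g) (psnd (psnd (psnd z)))))"
        by (intro pspace_intros)
      from pspace_comp[OF h this] show ?thesis by (auto intro!: pspace_intros)
    qed
    fix m x t :: nat
    assume x: "x < 2 ^ m"
    obtain w' where "w' \<le> W x" "(?F x ^^ t) (pair (W x) (init x)) =
        pair w' (fold (h x) (take t (digs g (W x))) (init x))"
      using F by blast
    then show "rec_nat (pair (W x) (init x)) (\<lambda>_. ?F x) t < 2 ^ Q' m"
      using q[OF x] Q(2)[OF x, of t] pspace_pair_bounded[of w' "poly q m" _ "Q m"]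
      unfolding rec_nat_const Q'_def by simp
  qed (intro pspace_intros assms)+
  then have "pspace (\<lambda>x. psnd (rec_nat (pair (W x) (init x)) (\<lambda>_. ?F x) (W x)))"
    by (rule pspace_psnd)
  moreover have "psnd (rec_nat (pair (W x) (init x)) (\<lambda>_. ?F x) (W x)) =
      fold (h x) (digs g (W x)) (init x)" for x
  proof -
    have "length (digs g (W x)) \<le> W x" by (rule length_digs_le) (rule less_exp)
    then show ?thesis using F[of "W x" "W x" x "init x"] unfolding rec_nat_const by auto
  qed
  ultimately show ?thesis by simp
qed

lemma binary_eq_digs: "binary n = rev (map (\<lambda>d. d = 1) (digs 2 n))"
proof (induction n rule: less_induct)
  case (less n)
  show ?case
  proof (cases "n = 0")
    case False
    then have "digs 2 n = n mod 2 # digs 2 (n div 2)" by (simp add: digs_rec)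
    moreover have "binary n = binary (n div 2) @ [odd n]" using False by (subst binary.simps) simp
    moreover have "odd n = (n mod 2 = 1)" by (simp add: odd_iff_mod_2_eq_one)
    ultimately show ?thesis using less[of "n div 2"] False by simp
  qed (simp add: binary.simps)
qed

lemma digs_2_less: "d \<in> set (digs 2 n) \<Longrightarrow> d < 2"
proof (induction n rule: less_induct)
  case (less n)
  then show ?case using less.IH[of "n div 2"] by (cases "n = 0") (auto simp: digs_rec)
qed

text \<open>\<open>binary\<close> begins with the most significant bit, while \<open>undigs\<close>
  takes the first symbol as the least significant digit. So the word is built from its end: each bit
  delivered by \<open>digs\<close> becomes the new lowest digit.\<close>

lemma undigs_bits_syms_binary:
  "undigs G (bits_syms (binary n)) = fold (\<lambda>d a. (d + 2) + G * a) (digs 2 n) 0"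
proof -
  have "bits_syms (binary n) = map (\<lambda>d. d + 2) (rev (digs 2 n))"
    unfolding binary_eq_digs bits_syms_def
    by (auto simp: rev_map dest!: digs_2_less intro!: map_cong[OF refl])
  then show ?thesis
    by (simp add: horner_sum_foldr foldr_conv_fold rev_map fold_map o_def)
qed

lemma undigs_less:
  "(\<And>d. d \<in> set ds \<Longrightarrow> d < g) \<Longrightarrow> undigs g ds < g ^ length ds" for g :: nat
proof (induction ds)
  case (Cons d ds)
  then have "undigs g ds + 1 \<le> g ^ length ds" "d < g" by (auto simp: Suc_le_eq)
  then have "g * (undigs g ds + 1) \<le> g * g ^ length ds" by (intro mult_le_mono) auto
  then show ?case using \<open>d < g\<close> by (simp add: algebra_simps)
qed simp

lemma nat_power_less_power2: "(g::nat) ^ k \<le> 2 ^ (g * k)"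
  by (metis less_exp less_imp_le power_mono power_mult zero_le)

lemma pspace_undigs_bits:
  assumes "4 \<le> G" "pspace f"
  shows "pspace (\<lambda>x. undigs G (bits_syms (binary (f x))))"
  unfolding undigs_bits_syms_binary
proof -
  obtain q where q: "\<And>m x. x < 2 ^ m \<Longrightarrow> f x < 2 ^ poly q m"
    using assms(2) by (rule pspace_bounded) blast
  have fold: "fold (\<lambda>d a. (d + 2) + G * a) ds 0 < G ^ length ds" if "\<And>d. d \<in> set ds \<Longrightarrow> d < 2" for ds
  proof -
    have "fold (\<lambda>d a. (d + 2) + G * a) ds 0 = undigs G (map (\<lambda>d. d + 2) (rev ds))"
      by (simp add: horner_sum_foldr foldr_conv_fold rev_map fold_map o_def)
    also have "\<dots> < G ^ length (map (\<lambda>d. d + 2) (rev ds))"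
      using that assms(1) by (intro undigs_less) fastforce
    finally show ?thesis by simp
  qed
  show "pspace (\<lambda>x. fold (\<lambda>d a. (d + 2) + G * a) (digs 2 (f x)) 0)"
  proof (rule pspace_fold_digs[where Q = "\<lambda>m. G * poly q m"])
    fix m x t :: nat
    assume x: "x < 2 ^ m"
    have "fold (\<lambda>d a. (d + 2) + G * a) (take t (digs 2 (f x))) 0 < G ^ length (take t (digs 2 (f x)))"
      by (rule fold) (meson digs_2_less in_set_takeD)
    also have "\<dots> \<le> G ^ poly q m"
      using length_digs_le[OF q[OF x], of 2] assms(1) by (intro power_increasing) auto
    also have "\<dots> \<le> 2 ^ (G * poly q m)" by (rule nat_power_less_power2)
    finally show "fold (\<lambda>d a. (d + 2) + G * a) (take t (digs 2 (f x))) 0 < 2 ^ (G * poly q m)" .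
  qed (intro pspace_intros assms poly_bounded_intros order_refl)+
qed

section \<open>Lengths, powers and greatest common divisors\<close>

text \<open>Strings are coded by putting a 1 in front and reading the result in binary; this is the
  length of the string coded by \<open>n\<close>, without that leading digit.\<close>

definition nlen :: "nat \<Rightarrow> nat" where "nlen n = length (binary n) - 1"

lemma length_binary: "length (binary n) = length (digs 2 n)"
  by (simp add: binary_eq_digs)

lemma pspace_length_digs:
  assumes "2 \<le> g" and f: "pspace f"
  shows "pspace (\<lambda>x. length (digs g (f x)))"
proof -
  obtain q where q: "\<And>m x. x < 2 ^ m \<Longrightarrow> f x < 2 ^ poly q m"
    using f by (rule pspace_bounded) blast
  have fold: "fold (\<lambda>d. Suc) ds a = length ds + a" for ds :: "nat list" and a
    by (induction ds arbitrary: a) auto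
  have "pspace (\<lambda>x. fold (\<lambda>d. Suc) (digs g (f x)) 0)"
  proof (rule pspace_fold_digs[where Q = "poly q"])
    fix m x t :: nat
    assume x: "x < 2 ^ m"
    have "fold (\<lambda>d. Suc) (take t (digs g (f x))) 0 \<le> poly q m"
      using length_digs_le[OF q[OF x], of g] by (simp add: fold)
    also have "\<dots> < 2 ^ poly q m" by (rule less_exp)
    finally show "fold (\<lambda>d. Suc) (take t (digs g (f x))) 0 < 2 ^ poly q m" .
  qed (intro pspace_intros f poly_bounded_intros assms(1))+
  then show ?thesis by (simp add: fold)
qed

lemma pspace_nlen: "pspace f \<Longrightarrow> pspace (\<lambda>x. nlen (f x))"
  unfolding nlen_def length_binary by (intro pspace_diff pspace_length_digs pspace_const) simp_all

text \<open>The value itself, and not only its length, is polynomial in the length of the argument.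
  Exponents have to be of this kind.\<close>

definition small :: "(nat \<Rightarrow> nat) \<Rightarrow> bool" where
  "small f \<longleftrightarrow> (\<exists>q :: nat poly. \<forall>m x. x < 2 ^ m \<longrightarrow> f x \<le> poly q m)"

lemma smallI: "(\<And>m x. x < 2 ^ m \<Longrightarrow> f x \<le> q m) \<Longrightarrow> poly_bounded q \<Longrightarrow> small f"
  unfolding small_def poly_bounded_def by (meson le_trans)

lemma small_const: "small (\<lambda>x. k)"
  by (rule smallI[of _ "\<lambda>m. k"]) (auto intro: poly_bounded_intros)

lemma small_add: "small f \<Longrightarrow> small g \<Longrightarrow> small (\<lambda>x. f x + g x)"
  unfolding small_def by (metis add_mono poly_add)

lemma small_mult: "small f \<Longrightarrow> small g \<Longrightarrow> small (\<lambda>x. f x * g x)"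
  unfolding small_def by (metis mult_le_mono poly_mult)

lemma small_diff: "small f \<Longrightarrow> small (\<lambda>x. f x - g x)"
  unfolding small_def by (meson diff_le_self le_trans)

lemma small_poly: "small f \<Longrightarrow> small (\<lambda>x. poly q (f x))"
proof (induction q)
  case 0
  then show ?case by (simp add: small_const)
next
  case (pCons a q)
  then show ?case by (auto intro!: small_add small_mult small_const)
qed

lemma small_nlen: "pspace f \<Longrightarrow> small (\<lambda>x. nlen (f x))"
proof -
  assume f: "pspace f"
  obtain q where q: "\<And>m x. x < 2 ^ m \<Longrightarrow> f x < 2 ^ poly q m"
    using f by (rule pspace_bounded) blast
  show ?thesis
    using length_digs_le[OF q, of _ _ 2]
    by (intro smallI[of _ "poly q"] poly_bounded_intros) (simp add: nlen_def length_binary le_diff_conv le_SucI)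
qed

lemmas small_intros = small_const small_add small_mult small_diff small_poly small_nlen

lemma pspace_power:
  assumes "pspace f" "small f"
  shows "pspace (\<lambda>x. k ^ f x)"
proof -
  obtain q where q: "\<And>m x. x < 2 ^ m \<Longrightarrow> f x \<le> poly q m" using assms(2) unfolding small_def by blast
  have pow: "rec_nat 1 (\<lambda>t a. k * a) n = k ^ n" for n :: nat by (induction n) auto
  have "pspace (\<lambda>x. rec_nat 1 (\<lambda>t a. k * a) (f x))"
  proof (rule pspace_rec[where Q = "\<lambda>m. Suc (k * poly q m)"])
    fix m x t :: nat
    assume "x < 2 ^ m" "t \<le> f x"
    then have t: "t \<le> poly q m" using q[of x m] by simp
    have "k ^ t \<le> 2 ^ (k * t)" by (rule nat_power_less_power2)
    also have "\<dots> < 2 ^ Suc (k * poly q m)"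
      using t by (intro power_strict_increasing) (auto simp: less_Suc_eq_le)
    finally show "rec_nat 1 (\<lambda>t a. k * a) t < 2 ^ Suc (k * poly q m)" unfolding pow .
  qed (intro pspace_intros assms poly_bounded_intros)+
  then show ?thesis unfolding pow .
qed

lemma pspace_dvd: "pspace f \<Longrightarrow> pspace g \<Longrightarrow> pspace (\<lambda>x. of_bool (f x dvd g x))"
  unfolding dvd_eq_mod_eq_0 by (intro pspace_intros)

lemma pspace_gcd:
  assumes f: "pspace f" and g: "pspace g" and pos: "\<And>x. 0 < f x"
  shows "pspace (\<lambda>x. gcd (f x) (g x))"
proof -
  \<comment> \<open>Exhaustive search written as a sum with a single nonzero term, the greatest
    common divisor itself.\<close>
  have "gcd a b = (\<Sum>c<Suc a. of_bool (c dvd a \<and> c dvd b \<and>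
      (\<forall>u<Suc a. u dvd a \<and> u dvd b \<longrightarrow> u \<le> c)) * c)" if "0 < a" for a b :: nat
  proof -
    let ?P = "\<lambda>c. c dvd a \<and> c dvd b \<and> (\<forall>u<Suc a. u dvd a \<and> u dvd b \<longrightarrow> u \<le> c)"
    have le: "u \<le> gcd a b" if "u dvd a" "u dvd b" for u
      using that \<open>0 < a\<close> by (intro dvd_imp_le) auto
    have gl: "gcd a b < Suc a" using that by (simp add: less_Suc_eq_le gcd_le1_nat)
    have P: "?P c \<longleftrightarrow> c = gcd a b" if "c < Suc a" for c
      using le gl by (metis gcd_dvd1 gcd_dvd2 le_antisym)
    have "(\<Sum>c<Suc a. of_bool (?P c) * c) = (\<Sum>c<Suc a. of_bool (c = gcd a b) * c)"
      by (rule sum.cong) (use P in auto)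
    also have "\<dots> = (\<Sum>c\<in>{gcd a b}. of_bool (c = gcd a b) * c)"
      using gl by (intro sum.mono_neutral_right) auto
    finally show ?thesis by simp
  qed
  moreover have "pspace (\<lambda>x. \<Sum>c<Suc (f x). of_bool (c dvd f x \<and> c dvd g x \<and>
      (\<forall>u<Suc (f x). u dvd f x \<and> u dvd g x \<longrightarrow> u \<le> c)) * c)"
    by (intro pspace_intros pspace_dvd pspace_comp[OF f] pspace_comp[OF g])
  ultimately show ?thesis using pos by simp
qed

section \<open>Turing machines and polynomial space functions\<close>

subsection \<open>Simulating a Turing machine\<close>

fun tup :: "nat list \<Rightarrow> nat" where
  "tup [] = 0"
| "tup (a # as) = pair a (tup as)"

definition proj :: "nat \<Rightarrow> nat \<Rightarrow> nat" where "proj j z = pfst ((psnd ^^ j) z)"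

lemma proj_tup: "j < length xs \<Longrightarrow> proj j (tup xs) = xs ! j"
proof -
  assume j: "j < length xs"
  have "(psnd ^^ j) (tup xs) = tup (drop j xs)" using less_imp_le[OF j]
  proof (induction j)
    case (Suc j)
    then show ?case by (simp add: Cons_nth_drop_Suc[symmetric])
  qed simp
  then show ?thesis using j by (simp add: proj_def Cons_nth_drop_Suc[symmetric])
qed

lemma pspace_proj: "pspace f \<Longrightarrow> pspace (\<lambda>x. proj j (f x))"
proof -
  assume f: "pspace f"
  have "pspace (\<lambda>x. (psnd ^^ j) (f x))" by (induction j) (auto intro!: pspace_intros f)
  then show ?thesis unfolding proj_def by (rule pspace_pfst)
qed

lemma pspace_tup: "(\<And>f. f \<in> set fs \<Longrightarrow> pspace f) \<Longrightarrow> pspace (\<lambda>x. tup (map (\<lambda>f. f x) fs))"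
  by (induction fs) (auto intro!: pspace_intros)

text \<open>Every nested pair roughly doubles the length, which is harmless because the number
  \<open>n\<close> of components, the number of tapes, is constant.\<close>

fun tup_bits :: "nat \<Rightarrow> nat \<Rightarrow> nat" where
  "tup_bits 0 m = 0"
| "tup_bits (Suc n) m = 2 * (m + tup_bits n m) + 3"

lemma tup_less: "(\<And>a. a \<in> set xs \<Longrightarrow> a < 2 ^ m) \<Longrightarrow> tup xs < 2 ^ tup_bits (length xs) m"
proof (induction xs)
  case (Cons a xs)
  then show ?case using pspace_pair_bounded[of a m "tup xs" "tup_bits (length xs) m"] by simp
qed simp

lemma poly_bounded_tup_bits: "poly_bounded p \<Longrightarrow> poly_bounded (\<lambda>m. tup_bits n (p m))"
  by (induction n) (auto intro!: poly_bounded_intros)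

lemma undigs_nth:
  assumes "h < length ds" "\<And>d. d \<in> set ds \<Longrightarrow> d < g"
  shows "undigs g ds div g ^ h mod g = ds ! h"
proof -
  have ds: "ds = take h ds @ ds ! h # drop (Suc h) ds" using assms(1) by (rule id_take_nth_drop)
  have less: "undigs g (take h ds) < g ^ h"
    using undigs_less[of "take h ds" g] assms by (auto dest: in_set_takeD)
  have g: "ds ! h < g" using assms by simp
  have "undigs g ds = undigs g (take h ds) + g ^ h * (ds ! h + g * undigs g (drop (Suc h) ds))"
    using assms(1) by (subst ds) (simp add: horner_sum_append)
  then have "undigs g ds div g ^ h = ds ! h + g * undigs g (drop (Suc h) ds)"
    using less by (metis add.right_neutral div_less div_mult_self2 not_less_zero)
  then show ?thesis using g by simp
qed

text \<open>The old digit is subtracted before the new one is added, so the truncated subtraction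
  loses nothing.\<close>

lemma undigs_update:
  assumes "h < length ds"
  shows "undigs g (ds[h := a]) = undigs g ds - ds ! h * g ^ h + a * g ^ h"
proof -
  have ds: "ds = take h ds @ ds ! h # drop (Suc h) ds" using assms(1) by (rule id_take_nth_drop)
  have "undigs g ds = undigs g (take h ds) + g ^ h * (ds ! h + g * undigs g (drop (Suc h) ds))"
    using assms(1) by (subst ds) (simp add: horner_sum_append)
  moreover have "undigs g (ds[h := a]) =
      undigs g (take h ds) + g ^ h * (a + g * undigs g (drop (Suc h) ds))"
    using assms(1) by (simp add: upd_conv_take_nth_drop horner_sum_append)
  ultimately show ?thesis by (simp add: algebra_simps)
qed

lemma undigs_tape_content:
  assumes "length w \<le> B"
  shows "undigs g (map (tape_content w) [0..<Suc B]) = 1 + g * undigs g w"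
proof -
  have "map (tape_content w) [0..<Suc B] = 1 # w @ replicate (B - length w) 0"
    using assms by (intro nth_equalityI) (auto simp: tape_content_def nth_Cons' nth_append simp del: upt_Suc)
  moreover have "undigs g (replicate n 0) = 0" for n by (induction n) auto
  ultimately show ?thesis by (simp add: horner_sum_append)
qed

text \<open>The head position \<open>i\<close> is stored as \<open>G ^ i\<close>: reading is then
  division and remainder, writing is addition of a multiple, and moving the head is multiplication
  or division by \<open>G\<close>.\<close>

definition tape_num :: "nat \<Rightarrow> nat \<Rightarrow> tape \<Rightarrow> nat" where
  "tape_num G B t = pair (undigs G (map (fst t) [0..<Suc B])) (G ^ snd t)"

definition config_num :: "nat \<Rightarrow> nat \<Rightarrow> tm_config \<Rightarrow> nat" where
  "config_num G B c = pair (fst c) (tup (map (tape_num G B) (snd c)))"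

definition wf_config :: "nat \<Rightarrow> nat \<Rightarrow> nat \<Rightarrow> tm_config \<Rightarrow> bool" where
  "wf_config k G B c \<longleftrightarrow> length (snd c) = k \<and>
     (\<forall>t\<in>set (snd c). snd t \<le> B \<and> (\<forall>i. fst t i < G) \<and> (\<forall>i>B. fst t i = 0))"

definition move_num :: "head_move \<Rightarrow> nat" where
  "move_num m = (case m of MoveLeft \<Rightarrow> 0 | MoveStay \<Rightarrow> 1 | MoveRight \<Rightarrow> 2)"

definition cell_num :: "nat \<Rightarrow> nat \<Rightarrow> nat \<Rightarrow> nat" where
  "cell_num G j z = pfst (proj j (psnd z)) div psnd (proj j (psnd z)) mod G"

text \<open>A function of the state and of the scanned symbols, tabulated.
  \<open>G + length P\<close> is above all symbols and all non-halting states, so on running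
  configurations the table agrees with \<open>\<phi>\<close>.\<close>

definition tm_table :: "nat \<Rightarrow> nat \<Rightarrow> machine \<Rightarrow> (nat \<Rightarrow> nat list \<Rightarrow> nat) \<Rightarrow> nat \<Rightarrow> nat" where
  "tm_table k G P \<phi> z = (if \<forall>f\<in>set (pfst # map (cell_num G) [0..<k]). f z < G + length P
     then (\<lambda>l. \<phi> (hd l) (tl l)) (map (\<lambda>f. f z) (pfst # map (cell_num G) [0..<k])) else 0)"

definition act_num :: "nat \<Rightarrow> nat \<Rightarrow> nat \<Rightarrow> nat \<Rightarrow> nat \<Rightarrow> nat" where
  "act_num G r a m t = pair (pfst t - r * psnd t + a * psnd t)
     (if m = 0 then if psnd t = 1 then 1 else psnd t div G
      else if m = 1 then psnd t else psnd t * G)"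

definition step_num :: "nat \<Rightarrow> nat \<Rightarrow> machine \<Rightarrow> nat \<Rightarrow> nat" where
  "step_num k G P z = pair (tm_table k G P (\<lambda>q rs. fst ((P ! q) rs)) z)
     (tup (map (\<lambda>f. f z) (map (\<lambda>j z.
        act_num G (cell_num G j z) (tm_table k G P (\<lambda>q rs. fst (snd ((P ! q) rs) ! j)) z)
          (tm_table k G P (\<lambda>q rs. move_num (snd (snd ((P ! q) rs) ! j))) z) (proj j (psnd z))) [0..<k])))"

lemma pspace_cell_num: "pspace (cell_num G j)"
  unfolding cell_num_def by (intro pspace_intros pspace_proj)

lemma pspace_tm_table: "pspace (tm_table k G P \<phi>)"
  unfolding tm_table_def
  by (rule pspace_finite_table) (auto intro!: pspace_pfst' pspace_cell_num)

lemma pspace_step_num: "pspace (step_num k G P)"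
  unfolding step_num_def act_num_def
  by (intro pspace_pair pspace_tup pspace_tm_table)
    (auto intro!: pspace_intros pspace_proj pspace_comp[OF pspace_tm_table] pspace_comp[OF pspace_cell_num])

lemma step_num_correct:
  assumes tm: "turing_machine k G P" and wf: "wf_config k G B (q, ts)" and q: "q < length P"
  shows "step_num k G P (config_num G B (q, ts)) = config_num G B (tm_step P (q, ts))"
proof -
  let ?z = "config_num G B (q, ts)"
  have G: "5 \<le> G" and k: "length ts = k" using tm wf by (auto simp: turing_machine_def wf_config_def)
  let ?rs = "map tape_read ts"
  let ?r = "(P ! q) ?rs"
  have ts: "snd (ts ! j) \<le> B" "\<And>i. fst (ts ! j) i < G" if "j < k" for j
    using wf that nth_mem[of j ts] unfolding wf_config_def by auto
  have "length ?rs = k" "set ?rs \<subseteq> {..<G}" using wf by (auto simp: wf_config_def tape_read_def)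
  then have r: "length (snd ?r) = k" using tm q unfolding turing_machine_def by blast
  have proj: "proj j (psnd ?z) = tape_num G B (ts ! j)" if "j < k" for j
    using that k by (simp add: config_num_def proj_tup)
  have cell: "cell_num G j ?z = tape_read (ts ! j)" if "j < k" for j
  proof -
    have h: "snd (ts ! j) < length (map (fst (ts ! j)) [0..<Suc B])"
      using ts(1)[OF that] by simp
    show ?thesis
      using undigs_nth[OF h, of G] ts[OF that] nth_map_upt[of "snd (ts ! j)" "Suc B" 0 "fst (ts ! j)"]
      by (auto simp: cell_num_def proj[OF that] tape_num_def tape_read_def simp del: upt_Suc)
  qed
  have "map (\<lambda>f. f ?z) (pfst # map (cell_num G) [0..<k]) = q # ?rs"
    using cell k by (auto simp: config_num_def intro!: nth_equalityI)
  moreover have "f ?z < G + length P" if "f \<in> set (pfst # map (cell_num G) [0..<k])" for f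
    using that q cell ts by (fastforce simp: config_num_def tape_read_def trans_less_add1)
  ultimately have tab: "tm_table k G P \<phi> ?z = \<phi> q ?rs" for \<phi>
    by (simp add: tm_table_def)
  have step: "tm_step P (q, ts) = (fst ?r, map2 tape_act (snd ?r) ts)"
    using q by (simp add: tm_step_def Let_def)
  have tape: "tape_num G B (tape_act (a, m) t) =
      act_num G (tape_read t) a (move_num m) (tape_num G B t)"
    if "snd t \<le> B" for t a m
  proof -
    have u1: "map ((fst t)(snd t := a)) [0..<Suc B] = (map (fst t) [0..<Suc B])[snd t := a]"
      using that by (intro nth_equalityI) (auto simp: nth_list_update simp del: upt_Suc)
    have u2: "undigs G ((map (fst t) [0..<Suc B])[snd t := a]) =
        undigs G (map (fst t) [0..<Suc B]) - fst t (snd t) * G ^ snd t + a * G ^ snd t"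
      using that nth_map_upt[of "snd t" "Suc B" 0 "fst t"] by (subst undigs_update) (auto simp del: upt_Suc)
    define n where "n = snd t"
    define T where "T = undigs G (map (fst t) [0..<Suc B])"
    have p: "G ^ n = 1 \<longleftrightarrow> n = 0" "n \<noteq> 0 \<longrightarrow> G ^ n div G = G ^ (n - 1)"
      using G by (cases n; simp)+
    have t: "tape_num G B t = pair T (G ^ n)" by (simp only: tape_num_def T_def n_def)
    have "tape_num G B (tape_act (a, m) t) =
        pair (T - tape_read t * G ^ n + a * G ^ n) (G ^ move_head m n)"
      unfolding tape_num_def tape_act_def fst_conv snd_conv u1 u2 tape_read_def T_def n_def ..
    then show ?thesis
      unfolding act_num_def t pair_simps using p by (cases m) (auto simp: move_num_def mult.commute)
  qed
  have "map2 tape_act (snd ?r) ts ! j = tape_act (snd ?r ! j) (ts ! j)" if "j < k" for j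
    using that r k by simp
  then have "map (tape_num G B) (map2 tape_act (snd ?r) ts) =
      map (\<lambda>j. tape_num G B (tape_act (fst (snd ?r ! j), snd (snd ?r ! j)) (ts ! j))) [0..<k]"
    using r k by (intro nth_equalityI) auto
  also have "\<dots> = map (\<lambda>j. act_num G (cell_num G j ?z) (fst (snd ?r ! j))
      (move_num (snd (snd ?r ! j))) (proj j (psnd ?z))) [0..<k]"
    (is "map ?f _ = map ?g _")
  proof (rule map_cong[OF refl])
    fix j assume "j \<in> set [0..<k]"
    then have j: "j < k" by simp
    show "?f j = ?g j" unfolding proj[OF j] cell[OF j] by (rule tape[OF ts(1)[OF j]])
  qed
  finally have tapes: "map (tape_num G B) (map2 tape_act (snd ?r) ts) = map ?g [0..<k]" .
  have "config_num G B (fst ?r, map2 tape_act (snd ?r) ts) = pair (fst ?r) (tup (map ?g [0..<k]))"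
    unfolding config_num_def[of G B "(fst ?r, map2 tape_act (snd ?r) ts)"] fst_conv snd_conv tapes ..
  then show ?thesis
    unfolding step step_num_def tab map_map o_def by (rule sym)
qed

text \<open>\<open>max n 1\<close> takes care of 0, whose binary notation has no leading 1; like 1
  it then stands for the empty string.\<close>

lemma binary_max_1: "binary (max n 1) = True # tl (binary n)"
proof (cases "n = 0")
  case True
  then show ?thesis by (simp add: binary.simps)
next
  case False
  then have "\<exists>x. binary n = True # x"
  proof (induction n rule: less_induct)
    case (less n)
    have b: "binary n = binary (n div 2) @ [odd n]" using less.prems by (subst binary.simps) simp
    show ?case
    proof (cases "n div 2 = 0")
      case True
      then have "n = 1" using less.prems by linarith
      then show ?thesis by (simp add: binary.simps)
    next
      case False
      then show ?thesis using b less.IH[of "n div 2"] by auto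
    qed
  qed
  moreover have "max n 1 = n" using False by simp
  ultimately show ?thesis by (metis list.sel(3))
qed

text \<open>The initial 1 preserves the leading zeros of the string, so strings correspond
  bijectively to positive numbers, with inverse \<open>tl\<close> after
  \<open>binary\<close>.\<close>

definition code :: "bool list \<Rightarrow> nat" where
  "code x = foldl (\<lambda>a b. 2 * a + of_bool b) 1 x"

lemma code_simps [simp]: "code [] = 1" "code (x @ [b]) = 2 * code x + of_bool b"
  by (simp_all add: code_def)

lemma code_pos: "0 < code x"
  by (induction x rule: rev_induct) simp_all

lemma code_less: "code x < 2 ^ Suc (length x)"
  by (induction x rule: rev_induct) (auto split: if_splits)

lemma code_ge: "2 ^ length x \<le> code x"
  by (induction x rule: rev_induct) auto

lemma binary_code: "binary (code x) = True # x"
proof (induction x rule: rev_induct)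
  case Nil
  show ?case by (simp add: binary.simps)
next
  case (snoc b x)
  have "binary (code (x @ [b])) = binary (code x) @ [b]"
    using code_pos[of x] by (subst binary.simps) simp
  then show ?case using snoc by simp
qed

lemma nlen_eq: "length (tl (binary n)) = nlen n"
  by (simp add: nlen_def)

lemma nlen_le: "n < 2 ^ m \<Longrightarrow> nlen n \<le> m"
  using length_digs_le[of n m 2] by (simp add: nlen_def length_binary)

lemma config_num_less:
  assumes "wf_config k G B c" "fst c \<le> l" "2 \<le> G"
  shows "config_num G B c < 2 ^ (2 * (l + tup_bits k (4 * (G * Suc B) + 3)) + 3)"
  unfolding config_num_def
proof (rule pspace_pair_bounded)
  have "fst c < 2 ^ fst c" by (rule less_exp)
  then show "fst c < 2 ^ l" using assms(2) by (rule less_power2_mono)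
  have tape: "tape_num G B t < 2 ^ (4 * (G * Suc B) + 3)" if "t \<in> set (snd c)" for t
  proof -
    have t: "snd t \<le> B" "\<And>i. fst t i < G" using assms(1) that by (auto simp: wf_config_def)
    have le: "G ^ Suc B \<le> 2 ^ (G * Suc B)" by (rule nat_power_less_power2)
    have "undigs G (map (fst t) [0..<Suc B]) < G ^ length (map (fst t) [0..<Suc B])"
      using t(2) by (intro undigs_less) auto
    then have 1: "undigs G (map (fst t) [0..<Suc B]) < 2 ^ (G * Suc B)" using le by simp
    have "G ^ snd t < G ^ Suc B" using t(1) assms(3) by (intro power_strict_increasing) auto
    then have 2: "G ^ snd t < 2 ^ (G * Suc B)" using le by simp
    show ?thesis unfolding tape_num_def
      using pspace_pair_bounded[OF 1 2] by (simp add: algebra_simps)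
  qed
  have "tup (map (tape_num G B) (snd c)) <
      2 ^ tup_bits (length (map (tape_num G B) (snd c))) (4 * (G * Suc B) + 3)"
    by (rule tup_less) (use tape in force)
  then show "tup (map (tape_num G B) (snd c)) < 2 ^ tup_bits k (4 * (G * Suc B) + 3)"
    using assms(1) by (simp add: wf_config_def)
qed

text \<open>The simulation runs until the machine halts, without a bound on the time. A tape does
  not show blanks at the end of a word; excluding them also confines the output to cells within the
  space bound.\<close>

theorem pspace_polyspace_computable:
  assumes "polyspace_computable f" and blank: "\<And>x. blank_sym \<notin> set (f x)"
  obtains G where "5 \<le> G" "\<And>x a. a \<in> set (f x) \<Longrightarrow> a < G"
    "pspace (\<lambda>n. undigs G (f (tl (binary n))))"
proof -
  obtain k G P p where tm: "turing_machine k G P"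
    and out: "\<And>x. tm_outputs P k x (f x)" and space: "\<And>x. tm_space_bounded P k x (poly p (length x))"
    using assms(1) unfolding polyspace_computable_def by blast
  have G: "5 \<le> G" and k: "2 \<le> k" using tm by (auto simp: turing_machine_def)
  \<comment> \<open>The space bound speaks of visited cells only. The length of the input is added
    because a machine need not read all of it, yet every nonblank cell must be recorded.\<close>
  define B where "B x = poly p (length x) + length x" for x :: "bool list"
  have wf: "wf_config k G (B x) (tm_run P k x t)" for x t
  proof -
    have len: "length (snd (tm_run P k x t)) = k" for t using tm_run_wf[OF tm] by blast
    have head: "snd (snd (tm_run P k x t) ! j) \<le> B x" if "j < k" for j t
      using space[of x] that by (auto simp: tm_space_bounded_def B_def intro: trans_le_add1)
    have "\<forall>tp\<in>set (snd (tm_run P k x t)). \<forall>i>B x. fst tp i = 0"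
    proof (induction t)
      case 0
      then show ?case by (auto simp: tm_run_def tm_init_def tape_content_def B_def)
    next
      case (Suc t)
      obtain q ts where c: "tm_run P k x t = (q, ts)" by (cases "tm_run P k x t")
      have step: "tm_run P k x (Suc t) = tm_step P (q, ts)" using c by (simp add: tm_run_def)
      have "fst tp i = 0" if i: "B x < i" and tp: "tp \<in> set (map2 tape_act as ts)" for i tp as
      proof -
        obtain a u where au: "tp = tape_act a u" "u \<in> set ts"
          using tp by (auto dest: set_zip_rightD)
        then obtain j where "j < k" "u = ts ! j" using len[of t] c by (auto simp: in_set_conv_nth)
        then have "snd u \<le> B x" using head[of j t] c by simp
        then show ?thesis using au Suc c i by (auto simp: tape_act_def)
      qed
      then show ?case using Suc c unfolding step by (auto simp: tm_step_def Let_def)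
    qed
    moreover have "snd tp \<le> B x" if "tp \<in> set (snd (tm_run P k x t))" for tp
      using that head len by (auto simp: in_set_conv_nth)
    ultimately show ?thesis using tm_run_wf[OF tm, of x t] by (simp add: wf_config_def)
  qed
  let ?x = "\<lambda>n. tl (binary n)"
  \<comment> \<open>The leading 1 of the code of the input appears in cell 0 as
    \<open>one_sym\<close>, which is 3; subtracting 2 turns it into the start symbol. An empty tape
    is just the start symbol, the number 1, with the head at \<open>G ^ 0 = 1\<close>.\<close>
  let ?init = "\<lambda>n. pair 0 (pair (pair (undigs G (bits_syms (binary (max n 1))) - 2) 1)
    (tup (replicate (k - 1) (pair 1 1))))"
  have init: "?init n = config_num G (B (?x n)) (tm_run P k (?x n) 0)" for n
  proof -
    have "undigs G (bits_syms (binary (max n 1))) - 2 = 1 + G * undigs G (bits_syms (?x n))"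
      unfolding binary_max_1 by simp
    then show ?thesis
      using undigs_tape_content[of "bits_syms (?x n)" "B (?x n)" G] undigs_tape_content[of "[]" "B (?x n)" G]
      by (simp add: tm_run_def tm_init_def config_num_def tape_num_def B_def del: upt_Suc)
  qed
  let ?step = "step_num k G P"
  let ?b = "\<lambda>z. length P - pfst z"
  have b: "?b (config_num G B' c) = 0 \<longleftrightarrow> length P \<le> fst c" for B' c
    by (auto simp: config_num_def)
  have steps: "(?step ^^ t) (?init n) = config_num G (B (?x n)) (tm_run P k (?x n) t)"
    if "\<And>u. u < t \<Longrightarrow> ?b ((?step ^^ u) (?init n)) \<noteq> 0" for t n
    using that
  proof (induction t)
    case (Suc t)
    then have IH: "(?step ^^ t) (?init n) = config_num G (B (?x n)) (tm_run P k (?x n) t)" by simp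
    obtain q ts where c: "tm_run P k (?x n) t = (q, ts)" by (cases "tm_run P k (?x n) t")
    have "?b ((?step ^^ t) (?init n)) \<noteq> 0" using Suc.prems by blast
    then have "q < length P" unfolding IH b c by simp
    then show ?case
      using step_num_correct[OF tm wf[of "?x n" t, unfolded c]] IH c by (simp add: tm_run_def)
  qed (simp only: funpow.simps id_apply init)
  let ?halt = "\<lambda>n t. length P \<le> fst (tm_run P k (?x n) t)"
  have halts: "\<exists>t. ?b ((?step ^^ t) (?init n)) = 0" for n
  proof (rule ccontr)
    assume *: "\<nexists>t. ?b ((?step ^^ t) (?init n)) = 0"
    obtain t where "?halt n t" using out[of "?x n"] by (auto simp: tm_outputs_def)
    then have "?b ((?step ^^ t) (?init n)) = 0"
      using steps[of t n] * b by (metis (no_types, lifting))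
    then show False using * by blast
  qed
  let ?t = "\<lambda>n. LEAST t. ?b ((?step ^^ t) (?init n)) = 0"
  have final: "\<exists>ts. (?step ^^ ?t n) (?init n) = config_num G (B (?x n)) (length P, ts) \<and>
      fst (ts ! 1) = tape_content (f (?x n)) \<and> wf_config k G (B (?x n)) (length P, ts)" for n
  proof -
    have eq: "(?step ^^ ?t n) (?init n) = config_num G (B (?x n)) (tm_run P k (?x n) (?t n))"
      by (rule steps) (use not_less_Least in blast)
    have h: "?halt n (?t n)" using LeastI_ex[OF halts[of n]] unfolding eq b .
    obtain t where t: "?halt n t" "fst (snd (tm_run P k (?x n) t) ! 1) = tape_content (f (?x n))"
      using out[of "?x n"] by (auto simp: tm_outputs_def)
    \<comment> \<open>\<open>tm_outputs\<close> speaks of some halting time and the simulation stops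
      at the first one; the configurations agree because nothing changes after halting.\<close>
    have "?t n \<le> t"
    proof (rule ccontr)
      assume less: "\<not> ?t n \<le> t"
      have "?b ((?step ^^ u) (?init n)) \<noteq> 0" if "u < t" for u
        using not_less_Least[of u "\<lambda>t. ?b ((?step ^^ t) (?init n)) = 0"] less that by linarith
      then have "?b ((?step ^^ t) (?init n)) = 0" using steps[of t n] t(1) b by metis
      then show False using not_less_Least[of t "\<lambda>t. ?b ((?step ^^ t) (?init n)) = 0"] less by simp
    qed
    moreover have "fst (tm_run P k (?x n) (?t n)) = length P"
      using h tm_run_wf[OF tm, of "?x n" "?t n"] by simp
    ultimately show ?thesis
      using eq tm_run_halted[OF h, of t] t(2) wf[of "?x n" "?t n"]
      by (intro exI[of _ "snd (tm_run P k (?x n) (?t n))"]) (metis prod.collapse)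
  qed
  define Q where "Q m = 2 * (length P + tup_bits k (4 * (G * Suc (poly p m + m)) + 3)) + 3" for m
  have "pspace (\<lambda>n. (?step ^^ ?t n) (?init n))"
  proof (rule pspace_while[where Q = Q])
    have "pspace (\<lambda>n. if n \<le> 1 then 1 else n)"
      by (intro pspace_if pspace_le pspace_id pspace_const)
    then have "pspace (\<lambda>n. max n 1)" by (simp only: max_def)
    then have "pspace (\<lambda>n. undigs G (bits_syms (binary (max n 1))))"
      using G by (intro pspace_undigs_bits) auto
    then show "pspace ?init" by (intro pspace_pair pspace_diff pspace_const)
    show "pspace ?step" by (rule pspace_step_num)
    show "pspace ?b" by (intro pspace_intros)
    show "poly_bounded Q" unfolding Q_def by (intro poly_bounded_intros poly_bounded_tup_bits)
  next
    fix m n t :: nat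
    assume n: "n < 2 ^ m" and *: "\<And>u. u < t \<Longrightarrow> ?b ((?step ^^ u) (?init n)) \<noteq> 0"
    have "B (?x n) \<le> poly p m + m"
      using nlen_le[OF n] unfolding B_def nlen_eq by (intro add_mono poly_nat_mono)
    have mono: "tup_bits j a \<le> tup_bits j a'" if "a \<le> a'" for j a a'
      using that by (induction j) auto
    have "config_num G (B (?x n)) (tm_run P k (?x n) t) <
        2 ^ (2 * (length P + tup_bits k (4 * (G * Suc (B (?x n))) + 3)) + 3)"
      using G tm_run_wf[OF tm, of "?x n" t] by (intro config_num_less wf) auto
    moreover have "(?step ^^ t) (?init n) = config_num G (B (?x n)) (tm_run P k (?x n) t)"
      by (rule steps) (rule *)
    ultimately have "(?step ^^ t) (?init n) <
        2 ^ (2 * (length P + tup_bits k (4 * (G * Suc (B (?x n))) + 3)) + 3)" by (simp only:)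
    then show "(?step ^^ t) (?init n) < 2 ^ Q m"
      unfolding Q_def
      by (rule less_power2_mono) (intro add_mono mult_le_mono mono order_refl, use \<open>B (?x n) \<le> poly p m + m\<close> in simp)
  qed (rule halts)
  \<comment> \<open>Division by \<open>G\<close> removes the start symbol from the output
    tape.\<close>
  then have "pspace (\<lambda>n. pfst (proj 1 (psnd ((?step ^^ ?t n) (?init n)))) div G)"
    by (intro pspace_intros pspace_proj)
  moreover have fin: "pfst (proj 1 (psnd ((?step ^^ ?t n) (?init n)))) div G = undigs G (f (?x n)) \<and>
      (\<forall>a\<in>set (f (?x n)). a < G)" for n
  proof -
    obtain ts where ts: "(?step ^^ ?t n) (?init n) = config_num G (B (?x n)) (length P, ts)"
      "fst (ts ! 1) = tape_content (f (?x n))" "wf_config k G (B (?x n)) (length P, ts)"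
      using final by blast
    let ?y = "f (?x n)"
    have 1: "1 < length ts" using ts(3) k by (simp add: wf_config_def)
    then have wf1: "\<And>i. tape_content ?y i < G" "\<And>i. B (?x n) < i \<Longrightarrow> tape_content ?y i = 0"
      using ts(3) nth_mem[OF 1] unfolding wf_config_def ts(2)[symmetric] by auto
    have nth: "tape_content ?y (Suc i) = ?y ! i" if "i < length ?y" for i
      using that by (simp add: tape_content_def)
    have "length ?y \<le> B (?x n)"
    proof (rule ccontr)
      assume l: "\<not> length ?y \<le> B (?x n)"
      then have "?y ! B (?x n) = 0" using wf1(2)[of "Suc (B (?x n))"] nth[of "B (?x n)"] by simp
      then show False using blank[of "?x n"] l by (metis not_le nth_mem)
    qed
    then have "undigs G (map (tape_content ?y) [0..<Suc (B (?x n))]) = 1 + G * undigs G ?y"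
      by (rule undigs_tape_content)
    then have "pfst (proj 1 (psnd ((?step ^^ ?t n) (?init n)))) = 1 + G * undigs G ?y"
      unfolding ts(1) using 1 ts(2) by (simp add: config_num_def proj_tup tape_num_def del: upt_Suc)
    moreover have "a < G" if "a \<in> set ?y" for a
      using that wf1(1) nth by (metis in_set_conv_nth)
    moreover have "(1 + G * u) div G = u" for u using G div_mult_self2[of G 1 u] by simp
    ultimately show ?thesis by (simp only:) blast
  qed
  ultimately have "pspace (\<lambda>n. undigs G (f (?x n)))" by (simp only: fin)
  moreover have "a < G" if "a \<in> set (f x)" for x a
  proof -
    have "x = ?x (code x)" by (simp add: binary_code)
    then show ?thesis using that fin by metis
  qed
  ultimately show ?thesis using that G by blast
qed


subsection \<open>Computing a polynomial space function by a Turing machine\<close>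

definition Double :: prog where "Double = Move2 0 2 3 ;; Move 2 0 ;; Move 3 0"

text \<open>\<open>Read\<close> executes neither branch at the end of the input. Register 1 is
  therefore cleared before each attempt and set again by both branches, so that it tells whether a
  bit has been read.\<close>

definition read_prog :: prog where
  "read_prog = Inc 0 ;; Inc 1 ;;
     While 1 (Dec 1 ;; Read (Inc 1 ;; Double) (Inc 1 ;; Double ;; Inc 0))"

lemma run_Double:
  assumes "2 * s 0 < 2 ^ L" "s 2 = 0" "s 3 = 0"
  shows "run L Double (s, io) (s(0 := 2 * s 0), io)"
  unfolding Double_def
  by (rule run_Seq[OF run_Move2 run_Move_Seq[OF _ _ run_eq[OF run_Move]]])
    (use assms in \<open>auto simp: fun_eq_iff\<close>)

lemma run_read_prog:
  "run (length x + 2) read_prog (\<lambda>_. 0, x, []) ((\<lambda>_. 0)(0 := code x), [], [])"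
proof -
  let ?L = "length x + 2"
  let ?z = "\<lambda>_::nat. 0::nat"
  define n where "n = length x"
  \<comment> \<open>Round \<open>n\<close> meets the end of the input and only clears the flag, so
    there is one round more than there are bits.\<close>
  define \<sigma> where "\<sigma> i = (if i \<le> n then (?z(0 := code (take i x), 1 := 1), drop i x, [] :: symbol list)
    else (?z(0 := code x), [], []))" for i
  have one: "1 < (2::nat) ^ ?L" by (rule one_less_power) simp_all
  let ?c = "Dec 1 ;; Read (Inc 1 ;; Double) (Inc 1 ;; Double ;; Inc 0)"
  have "run ?L (While 1 ?c) (\<sigma> 0) (\<sigma> (Suc n))"
  proof (rule run_While_seq)
    fix i assume i: "i < Suc n"
    show "fst (\<sigma> i) 1 \<noteq> 0" using i by (simp add: \<sigma>_def)
    show "run ?L ?c (\<sigma> i) (\<sigma> (Suc i))"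
    proof (cases "i = n")
      case True
      show ?thesis unfolding \<sigma>_def True
        by (simp add: n_def, rule run_Seq[OF run_Dec_reg run_eq[OF run_Read_Nil]])
          (auto simp: fun_eq_iff)
    next
      case False
      then have i: "i < n" "i < length x" using i by (auto simp: n_def)
      define y where "y = take i x"
      define s where "s = ?z(0 := code y)"
      have y: "take (Suc i) x = y @ [x ! i]" using i by (simp add: take_Suc_conv_app_nth y_def)
      have len: "length y < length x" using i by (simp add: y_def)
      have "code (y @ [b]) < 2 ^ ?L" for b
        using code_less[of "y @ [b]"] by (rule less_power2_mono) (use len in simp)
      from this[of False] this[of True] have L: "2 * code y < 2 ^ ?L" "2 * code y + 1 < 2 ^ ?L" by auto
      have 1: "run ?L (Dec 1) (\<sigma> i) (s, x ! i # drop (Suc i) x, [])"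
        using i by (auto simp: \<sigma>_def Cons_nth_drop_Suc s_def y_def fun_eq_iff intro!: run_eq[OF run_Dec_reg])
      have dbl: "run ?L (Inc 1 ;; Double) (s, io) (s(0 := 2 * code y, 1 := 1), io)" for io
        by (intro run_Inc_Seq run_eq[OF run_Double]) (use L one in \<open>auto simp: s_def fun_eq_iff\<close>)
      have dbl1: "run ?L (Inc 1 ;; Double ;; Inc 0) (s, io) (s(0 := 2 * code y + 1, 1 := 1), io)" for io
        by (rule run_Inc_Seq[OF _ run_Seq[OF run_Double run_eq[OF run_Inc_reg]]])
          (use L one in \<open>auto simp: s_def fun_eq_iff\<close>)
      have "run ?L (Read (Inc 1 ;; Double) (Inc 1 ;; Double ;; Inc 0))
          (s, x ! i # drop (Suc i) x, []) (\<sigma> (Suc i))"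
        using i dbl dbl1 y
        by (cases "x ! i") (auto simp: \<sigma>_def s_def intro!: run_Read_Cons intro: run_eq)
      with 1 show ?thesis by (rule run_Seq)
    qed
  qed (simp add: \<sigma>_def)
  then have "run ?L (While 1 ?c) (?z(0 := 1, 1 := 1), x, []) (?z(0 := code x), [], [])"
    by (simp add: \<sigma>_def)
  then show ?thesis
    unfolding read_prog_def
    by (intro run_Inc_Seq) (use one in \<open>auto simp: fun_upd_def\<close>)
qed

text \<open>\<open>Emit\<close> writes a fixed symbol, so the three possible values need a case
  distinction. After two decrements 0, 1 or 2 is left; register \<open>a\<close> stays set if 2 is
  to be written, and register \<open>Suc a\<close> if it is 3.\<close>

definition emit_prog :: "nat \<Rightarrow> prog" where
  "emit_prog a = Dec 0 ;; Dec 0 ;; Inc a ;;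
     While 0 (Dec 0 ;; Dec a ;; Inc (Suc a) ;;
       While 0 (Dec 0 ;; Dec (Suc a) ;; Emit 4) ;;
       While (Suc a) (Dec (Suc a) ;; Emit 3)) ;;
     While a (Dec a ;; Emit 2)"

lemma run_Emit_eq: "length ys < L \<Longrightarrow> s = s' \<Longrightarrow> run L (Emit a) (s, xs, ys) (s', xs, ys @ [a])"
  using run_Emit by simp

lemma run_emit_prog:
  assumes "0 < a" "s 0 \<in> {2, 3, 4}" "s a = 0" "s (Suc a) = 0" "length ys < L"
  shows "run L (emit_prog a) (s, xs, ys) (s(0 := 0), xs, ys @ [s 0])"
proof -
  have L: "1 < (2::nat) ^ L" using assms(5) by (intro one_less_power) auto
  let ?W4 = "While 0 (Dec 0 ;; Dec (Suc a) ;; Emit 4)" and ?W3 = "While (Suc a) (Dec (Suc a) ;; Emit 3)"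
  let ?W = "While 0 (Dec 0 ;; Dec a ;; Inc (Suc a) ;; ?W4 ;; ?W3)" and ?W2 = "While a (Dec a ;; Emit 2)"
  have W: "run L (emit_prog a) (s, xs, ys) (s(0 := 0), xs, ys @ [s 0])"
    if "run L ?W (s(0 := s 0 - 2, a := 1), xs, ys) (s(0 := 0), xs, ys @ [s 0])"
  proof -
    have "run L ?W2 (s(0 := 0), xs, ys @ [s 0]) (s(0 := 0), xs, ys @ [s 0])"
      by (rule run_While_none) (use assms in simp)
    from run_Seq[OF that this] show ?thesis unfolding emit_prog_def
      by (intro run_Dec_Seq run_Inc_Seq) (use assms L in \<open>auto simp: numeral_2_eq_2\<close>)
  qed
  consider "s 0 = 2" | "s 0 = 3" | "s 0 = 4" using assms(2) by auto
  then show ?thesis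
  proof cases
    case 1
    show ?thesis unfolding emit_prog_def 1
      by (intro run_Dec_Seq run_Inc_Seq run_Seq[OF run_While_none] run_While_once run_Emit_eq)
        (use assms L 1 in \<open>auto simp: fun_eq_iff\<close>)
  next
    case 2
    have "run L ?W (s(0 := 1, a := 1), xs, ys) (s(0 := 0), xs, ys @ [3])"
      by (intro run_While_once run_Dec_Seq run_Inc_Seq run_Seq[OF run_While_none] run_Emit_eq)
        (use assms L in \<open>auto simp: fun_eq_iff\<close>)
    then show ?thesis using W 2 by simp
  next
    case 3
    have "run L ?W4 (s(0 := 1, Suc a := 1), xs, ys) (s(0 := 0), xs, ys @ [4])"
      by (intro run_While_once run_Dec_Seq run_Emit_eq) (use assms L in \<open>auto simp: fun_eq_iff\<close>)
    then have "run L (?W4 ;; ?W3) (s(0 := 1, Suc a := 1), xs, ys) (s(0 := 0), xs, ys @ [4])"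
      by (rule run_Seq) (rule run_While_none, use assms in simp)
    moreover have "s(0 := 1, Suc a := 1) = s(0 := 2 - 1, a := 1 - 1, Suc a := s (Suc a) + 1)"
      using assms by (auto simp: fun_eq_iff)
    ultimately have "run L ?W (s(0 := 2, a := 1), xs, ys) (s(0 := 0), xs, ys @ [4])"
      by (intro run_While_once run_Dec_Seq run_Inc_Seq) (use assms L in \<open>auto simp: fun_upd_twist\<close>)
    then show ?thesis using W 3 by simp
  qed
qed

text \<open>The word is peeled off digit by digit in base 5. As no symbol is 0, the remaining number
  vanishes exactly when the whole word has been written.\<close>

theorem polyspace_computable_pspace:
  assumes F: "pspace F" and f: "\<And>x. set (f x) \<subseteq> {2, 3, 4}" "\<And>x. F (code x) = undigs 5 (f x)"
  shows "polyspace_computable f"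
proof -
  obtain cF wF qF where "computes wF cF qF F"
    using F unfolding pspace_def by blast
  note F = computesD[OF this]
  have md: "pspace (\<lambda>x. x mod 5)" "pspace (\<lambda>x. x div 5)" by (intro pspace_intros)+
  obtain cm wm qm where "computes wm cm qm (\<lambda>x. x mod 5)"
    using md(1) unfolding pspace_def by blast
  note cm = computesD[OF this]
  obtain cd wd qd where "computes wd cd qd (\<lambda>x. x div 5)"
    using md(2) unfolding pspace_def by blast
  note cd = computesD[OF this]
  define W where "W = wF + wm + wd + 1"
  let ?body = "Copy 0 W (W + 1) ;; cm ;; emit_prog (W + 1) ;; Move W 0 ;; cd"
  let ?c = "read_prog ;; cF ;; While 0 ?body"
  define q where "q n = poly qF (Suc n)" for n
  define L where "L n = (n + 2) + q n + poly qm (q n) + poly qd (q n)" for n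
  have "poly_bounded q" unfolding q_def by (intro poly_bounded_intros)
  then have "poly_bounded L" unfolding L_def by (intro poly_bounded_intros)
  then obtain p where p: "\<And>n. L n \<le> poly p n" unfolding poly_bounded_def by blast
  show ?thesis
  proof (rule polyspace_computable_prog)
    show "wf_prog (W + 4) ?c"
      using F(1) cm(1) cd(1)
      by (auto simp: W_def read_prog_def emit_prog_def Double_def intro: wf_prog_mono)
    fix x :: "bool list"
    define n where "n = length x"
    define y where "y = f x"
    let ?z = "\<lambda>_::nat. 0::nat"
    have y: "d \<in> {2, 3, 4}" if "d \<in> set y" for d using that f(1) by (auto simp: y_def)
    have Lq: "q n \<le> L n" "poly qF (Suc n) \<le> L n" "poly qm (q n) \<le> L n" "poly qd (q n) \<le> L n" "n + 2 \<le> L n"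
      by (auto simp: L_def q_def)
    have Fx: "undigs 5 y < 2 ^ q n"
      using F(2)[OF code_less[of x]] f(2)[of x] by (simp add: q_def n_def y_def)
    have "digs 5 (undigs 5 y) = y" using y by (intro digs_undigs) force+
    then have ly: "length y \<le> q n" using length_digs_le[OF Fx, of 5] by simp
    have r1: "run (L n) read_prog (?z, x, []) (?z(0 := code x), [], [])"
      using run_mono[OF run_read_prog Lq(5)[unfolded n_def]] by (simp add: n_def)
    have r2: "run (L n) cF (?z(0 := code x), [], []) (?z(0 := undigs 5 y), [], [])"
      using F(3)[of "?z(0 := code x)" "Suc n" "L n" "([], [])"] code_less[of x] Lq f(2)[of x]
      by (simp add: n_def y_def)
    let ?\<sigma> = "\<lambda>i. (?z(0 := undigs 5 (drop i y)), [] :: bool list, take i y)"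
    have "run (L n) (While 0 ?body) (?\<sigma> 0) (?\<sigma> (length y))"
    proof (rule run_While_seq)
      fix i assume i: "i < length y"
      define d where "d = y ! i"
      define u where "u = undigs 5 (drop (Suc i) y)"
      have d: "d \<in> {2, 3, 4}" using y i by (simp add: d_def)
      have v: "undigs 5 (drop i y) = d + 5 * u"
        using i by (simp add: d_def u_def flip: Cons_nth_drop_Suc)
      show "fst (?\<sigma> i) 0 \<noteq> 0" using d by (auto simp: v)
      have dm: "(d + 5 * u) mod 5 = d" "(d + 5 * u) div 5 = u" using d by auto
      have "undigs 5 y = undigs 5 (take i y) + 5 ^ i * (d + 5 * u)"
        using horner_sum_append[of "\<lambda>d. d" 5 "take i y" "drop i y"] i v by simp
      then have "d + 5 * u \<le> undigs 5 y" by (metis le_add2 le_trans mult_le_mono1 mult_1 one_le_numeral one_le_power)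
      then have less: "d + 5 * u < 2 ^ q n" "d + 5 * u < 2 ^ L n" using Fx Lq(1) less_power2_mono le_less_trans by blast+
      have W: "0 < W" "wm < W" "wd < W" by (auto simp: W_def)
      have s1: "run (L n) (Copy 0 W (W + 1)) (?z(0 := d + 5 * u), io) (?z(0 := d + 5 * u, W := d + 5 * u), io)" for io
        using run_Copy[of 0 W "W + 1" "?z(0 := d + 5 * u)" "L n" io] W less by simp
      have s2: "run (L n) cm (?z(0 := d + 5 * u, W := d + 5 * u), io) (?z(0 := d, W := d + 5 * u), io)" for io
        by (rule run_eq[OF cm(3)[of _ "q n"]]) (use W less Lq dm in \<open>auto simp: fun_eq_iff\<close>)
      have s3: "run (L n) (emit_prog (W + 1)) (?z(0 := d, W := d + 5 * u), [], take i y)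
          (?z(W := d + 5 * u), [], take (Suc i) y)"
        using d i ly Lq(1) W
        by (intro run_eq[OF run_emit_prog]) (auto simp: fun_eq_iff take_Suc_conv_app_nth d_def)
      have s4: "run (L n) (Move W 0) (?z(W := d + 5 * u), io) (?z(0 := d + 5 * u), io)" for io
        by (rule run_eq[OF run_Move]) (use W less in \<open>auto simp: fun_eq_iff\<close>)
      have s5: "run (L n) cd (?z(0 := d + 5 * u), io) (?z(0 := u), io)" for io
        by (rule run_eq[OF cd(3)[of _ "q n"]]) (use W less Lq dm in \<open>auto simp: fun_eq_iff\<close>)
      show "run (L n) ?body (?\<sigma> i) (?\<sigma> (Suc i))"
        unfolding v u_def[symmetric]
        by (rule run_Seq[OF s1 run_Seq[OF s2 run_Seq[OF s3 run_Seq[OF s4 s5]]]])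
    qed simp
    then have r3: "run (L n) (While 0 ?body) (?z(0 := undigs 5 y), [], []) (?\<sigma> (length y))" by simp
    have "run (poly p (length x)) ?c (?z, x, []) (?\<sigma> (length y))"
      using run_mono[OF run_Seq[OF r1 run_Seq[OF r2 r3]] p[of n]] by (simp add: n_def)
    then show "\<exists>s. run (poly p (length x)) ?c (?z, x, []) (s, [], f x)"
      by (auto simp: y_def)
  qed
qed

section \<open>A dyadic martingale that never loses its savings\<close>

text \<open>The precision grows with the length of \<open>x\<close>, which makes the sum of all
  rounding errors converge.\<close>

definition approx :: "(bool list \<Rightarrow> rat) \<Rightarrow> bool list \<Rightarrow> nat" where
  "approx M x = nat \<lfloor>2 ^ length x * M x\<rfloor>"

definition sibling :: "bool list \<Rightarrow> bool list" where
  "sibling x = butlast x @ [\<not> last x]"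

text \<open>With \<open>j\<close> halvings so far the stake is \<open>M / 2 ^ j\<close>. The next
  one is due when this is at least 2, so that the half put aside is at least 1.\<close>

primrec halvings :: "(bool list \<Rightarrow> rat) \<Rightarrow> bool list \<Rightarrow> nat \<Rightarrow> nat" where
  "halvings M x 0 = 0"
| "halvings M x (Suc i) =
     (if 2 ^ (halvings M x i + 1) \<le> M (take (Suc i) x) then Suc (halvings M x i) else halvings M x i)"

text \<open>
  Replacing the increment of \<open>M\<close> by half the difference of the rounded values at the two siblings
  costs at most \<open>2 ^ -(i + 2)\<close> at stage \<open>i\<close>, hence at most \<open>1/2\<close> in total.
\<close>

definition saver :: "nat \<Rightarrow> (bool list \<Rightarrow> rat) \<Rightarrow> bool list \<Rightarrow> rat" where
  "saver c M x = of_nat c + (\<Sum>i<length x.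
     (of_nat (approx M (take (Suc i) x)) - of_nat (approx M (sibling (take (Suc i) x)))) /
     2 ^ (i + 2 + halvings M x i))"

lemma halvings_append: "i \<le> length x \<Longrightarrow> halvings M (x @ y) i = halvings M x i"
  by (induction i) auto

lemma halvings_le: "halvings M x i \<le> i"
  by (induction i) auto

lemma halvings_mono: "i \<le> j \<Longrightarrow> halvings M x i \<le> halvings M x j"
  by (rule lift_Suc_mono_le[of "halvings M x"]) auto

lemma saver_snoc:
  "saver c M (x @ [b]) = saver c M x +
     (of_nat (approx M (x @ [b])) - of_nat (approx M (x @ [\<not> b]))) /
     2 ^ (length x + 2 + halvings M x (length x))"
proof -
  have "(\<Sum>i<length x. (of_nat (approx M (take (Suc i) (x @ [b]))) -
      of_nat (approx M (sibling (take (Suc i) (x @ [b]))))) / 2 ^ (i + 2 + halvings M (x @ [b]) i)) =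
    (\<Sum>i<length x. (of_nat (approx M (take (Suc i) x)) - of_nat (approx M (sibling (take (Suc i) x)))) /
      (2 :: rat) ^ (i + 2 + halvings M x i))"
    by (rule sum.cong) (simp_all add: halvings_append)
  then show ?thesis by (simp add: saver_def halvings_append sibling_def)
qed

text \<open>Siblings receive opposite increments, so the rounding does not disturb fairness.\<close>

lemma saver_fair: "saver c M (x @ [False]) + saver c M (x @ [True]) = 2 * saver c M x"
  unfolding saver_snoc by (simp add: add_divide_distrib[symmetric] flip: diff_divide_distrib)

lemma approx_bounds:
  assumes "0 < M x"
  shows "of_nat (approx M x) \<le> 2 ^ length x * M x" "2 ^ length x * M x < of_nat (approx M x) + 1"
proof -
  let ?r = "2 ^ length x * M x"
  have "0 \<le> \<lfloor>?r\<rfloor>" using assms by simp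
  then have "(of_nat (nat \<lfloor>?r\<rfloor>) :: rat) = of_int \<lfloor>?r\<rfloor>" by (simp add: of_nat_nat)
  then show "of_nat (approx M x) \<le> ?r" "?r < of_nat (approx M x) + 1"
    unfolding approx_def by linarith+
qed

text \<open>The invariant of the book-keeping: the constant \<open>c - M []\<close>, less the
  rounding losses so far (a geometric sum), plus savings of at least 1 for each halving, plus the
  stake \<open>M x / 2 ^ j\<close>.\<close>

lemma saver_ge:
  assumes M: "martingale M"
  shows "of_nat c - M [] - (1 - 1 / 2 ^ length x) / 2 + of_nat (halvings M x (length x)) +
    M x / 2 ^ halvings M x (length x) \<le> saver c M x"
proof (induction x rule: rev_induct)
  case Nil
  show ?case by (simp add: saver_def)
next
  case (snoc b x)
  let ?n = "length x"
  define j where "j = halvings M x ?n"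
  have pos: "\<And>y. 0 < M y" and fair: "M x = (M (x @ [False]) + M (x @ [True])) / 2"
    using M by (auto simp: martingale_def)
  define p where "p = M (x @ [b])"
  define q where "q = M (x @ [\<not> b])"
  define w :: rat where "w = 1 / 2 ^ j"
  define e :: rat where "e = 1 / 2 ^ ?n"
  have Mx: "M x = (p + q) / 2" using fair by (cases b) (auto simp: p_def q_def)
  have w: "0 < w" "w \<le> 1" by (simp_all add: w_def)
  have e: "0 < e" by (simp add: e_def)
  let ?d = "of_nat (approx M (x @ [b])) - of_nat (approx M (x @ [\<not> b])) :: rat"
  have "?d \<ge> 2 ^ Suc ?n * (p - q) - 1"
    using approx_bounds[of M "x @ [b]", OF pos] approx_bounds[of M "x @ [\<not> b]", OF pos]
    by (simp add: p_def q_def algebra_simps)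
  then have "?d / (2 ^ ?n * 4) \<ge> (2 ^ Suc ?n * (p - q) - 1) / (2 ^ ?n * 4)"
    by (intro divide_right_mono) auto
  moreover have "(2 ^ Suc ?n * (p - q) - 1) / (2 ^ ?n * 4) = (p - q) / 2 - e / 4"
    by (simp add: e_def field_simps)
  ultimately have "?d / (2 ^ ?n * 4) \<ge> (p - q) / 2 - e / 4" by simp
  then have "w * (?d / (2 ^ ?n * 4)) \<ge> w * ((p - q) / 2 - e / 4)"
    using w by (intro mult_left_mono) auto
  moreover have "?d / 2 ^ (?n + 2 + j) = w * (?d / (2 ^ ?n * 4))"
    by (simp add: w_def power_add)
  moreover have "w * (e / 4) \<le> e / 4" using w e by (simp add: mult_le_cancel_right1)
  moreover have "w * ((p - q) / 2 - e / 4) = w * p - w * M x - w * (e / 4)"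
    by (simp add: Mx field_simps)
  ultimately have d: "?d / 2 ^ (?n + 2 + j) \<ge> w * p - w * M x - e / 4" by linarith
  have IH: "of_nat c - M [] - (1 - e) / 2 + of_nat j + w * M x \<le> saver c M x"
    using snoc by (simp add: j_def w_def e_def)
  have e2: "1 / 2 ^ length (x @ [b]) = e / 2" by (simp add: e_def)
  have S: "saver c M (x @ [b]) \<ge> of_nat c - M [] - (1 - e / 2) / 2 + of_nat j + w * p"
  proof -
    define D where "D = ?d / 2 ^ (?n + 2 + j)"
    have "saver c M (x @ [b]) = saver c M x + D" unfolding saver_snoc j_def[symmetric] D_def ..
    moreover have "(1 - e) / 2 + e / 4 = (1 - e / 2) / 2" by (simp add: field_simps)
    ultimately show ?thesis using d IH unfolding D_def[symmetric] by linarith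
  qed
  have h: "halvings M (x @ [b]) (length (x @ [b])) = (if 2 ^ (j + 1) \<le> p then Suc j else j)"
    by (simp add: halvings_append j_def p_def)
  show ?case
  proof (cases "2 ^ (j + 1) \<le> p")
    case True
    \<comment> \<open>\<open>w * p\<close> is the stake and has reached 2; half of it, hence at
      least 1, is booked as savings.\<close>
    have "w / 2 * 2 ^ (j + 1) \<le> w / 2 * p" using w True by (intro mult_left_mono) auto
    then have "1 \<le> w * p / 2" by (simp add: w_def)
    then have "of_nat (Suc j) + p / 2 ^ Suc j \<le> of_nat j + w * p"
      by (simp add: w_def field_simps)
    then show ?thesis using S True unfolding h e2 p_def[symmetric] by simp
  next
    case False
    have "p / 2 ^ j = w * p" by (simp add: w_def)
    then show ?thesis using S False unfolding h e2 p_def[symmetric] by simp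
  qed
qed

text \<open>\<open>c\<close> exceeds \<open>M []\<close> by at least 1, whereas the rounding costs
  at most 1/2 in total.\<close>

lemma saver_ge_halvings:
  assumes "martingale M" "M [] + 1 \<le> of_nat c"
  shows "of_nat (halvings M x (length x)) < saver c M x"
proof -
  have "0 < M x" using assms(1) by (simp add: martingale_def)
  then have "0 < M x / 2 ^ halvings M x (length x)" by simp
  moreover have "(1 - 1 / 2 ^ length x) / 2 \<le> (1 / 2 :: rat)" by simp
  ultimately show ?thesis using saver_ge[OF assms(1), of c x] assms(2) by linarith
qed

text \<open>An infinite limes superior yields arbitrarily late values above any bound. After
  \<open>K\<close> halvings, a later value above \<open>2 ^ (K + 1)\<close> forces another one
  unless it has already taken place.\<close>

lemma halvings_unbounded:
  assumes "succeeds_on M Y"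
  shows "\<exists>n. K \<le> halvings M (set_prefix Y n) n"
proof -
  have take: "take i (set_prefix Y n) = set_prefix Y i" if "i \<le> n" for i n
    using that by (simp add: set_prefix_def take_map take_upt)
  have large: "\<exists>n\<ge>n0. r < M (set_prefix Y n)" for n0 r
  proof (rule ccontr)
    assume "\<not> ?thesis"
    then have "\<forall>n\<ge>n0. M (set_prefix Y n) \<le> r" by (simp add: not_less)
    then have "\<forall>\<^sub>F n in sequentially. ereal (real_of_rat (M (set_prefix Y n))) \<le> ereal (real_of_rat r)"
      by (auto simp: eventually_sequentially of_rat_less_eq)
    then have "limsup (\<lambda>n. ereal (real_of_rat (M (set_prefix Y n)))) \<le> ereal (real_of_rat r)"
      by (rule Limsup_bounded)
    then show False using assms by (simp add: succeeds_on_def)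
  qed
  define j where "j n = halvings M (set_prefix Y n) n" for n
  have prefix: "set_prefix Y (Suc n) = set_prefix Y n @ [n \<in> Y]" for n
    by (simp add: set_prefix_def)
  have len: "length (set_prefix Y n) = n" for n by (simp add: set_prefix_def)
  have j_Suc: "j (Suc n) = (if 2 ^ (j n + 1) \<le> M (set_prefix Y (Suc n)) then Suc (j n) else j n)" for n
    using take[of "Suc n" "Suc n"] halvings_append[of n "set_prefix Y n"]
    by (simp add: j_def prefix len)
  have mono: "j m \<le> j n" if "m \<le> n" for m n
    using that by (rule lift_Suc_mono_le[of j, rotated]) (simp add: j_Suc)
  show ?thesis unfolding j_def[symmetric]
  proof (induction K)
    case (Suc K)
    then obtain n where n: "K \<le> j n" by blast
    obtain n' where n': "Suc n \<le> n'" "2 ^ (K + 1) < M (set_prefix Y n')" using large by blast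
    then obtain k where k: "n' = Suc k" "n \<le> k" by (cases n') auto
    have "K \<le> j k" using n mono[OF k(2)] by simp
    moreover have "Suc K \<le> j (Suc k)" if "j k = K"
      using n'(2) that unfolding j_Suc k by simp
    ultimately have "Suc K \<le> j (Suc k)" using mono[of k "Suc k"] by (cases "j k = K") auto
    then show ?case by blast
  qed simp
qed

section \<open>Averaging over the answers to the remaining queries\<close>

definition consistent :: "(bool list \<Rightarrow> nat) \<Rightarrow> bool list \<Rightarrow> bool list \<Rightarrow> bool" where
  "consistent V x \<alpha> \<longleftrightarrow> (\<forall>i<length \<alpha>. V (take i \<alpha>) < length x \<longrightarrow> \<alpha> ! i = x ! V (take i \<alpha>))"

definition runs :: "(bool list \<Rightarrow> nat) \<Rightarrow> nat \<Rightarrow> bool list \<Rightarrow> bool list set" where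
  "runs V m x = {\<alpha>. length \<alpha> = m \<and> consistent V x \<alpha>}"

text \<open>Once all queries below \<open>length x\<close> have been asked, there are
  \<open>2 ^ m / 2 ^ length x\<close> consistent runs by \<open>card_runs\<close>, so this is the
  mean of \<open>S\<close> over them.\<close>

definition average :: "(bool list \<Rightarrow> nat) \<Rightarrow> (bool list \<Rightarrow> rat) \<Rightarrow> nat \<Rightarrow> bool list \<Rightarrow> rat" where
  "average V S m x = 2 ^ length x * (\<Sum>\<alpha>\<in>runs V m x. S \<alpha>) / 2 ^ m"

text \<open>\<open>i < m\<close> and not \<open>i \<le> m\<close>: the query must have been answered
  within the string.\<close>

definition queries_below :: "(bool list \<Rightarrow> nat) \<Rightarrow> nat \<Rightarrow> nat \<Rightarrow> bool" where
  "queries_below V m n \<longleftrightarrow> (\<forall>\<alpha>. length \<alpha> = m \<longrightarrow> (\<forall>r<n. \<exists>i<m. V (take i \<alpha>) = r))"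

lemma finite_runs: "finite (runs V m x)"
proof (rule finite_subset)
  show "runs V m x \<subseteq> {\<alpha>. set \<alpha> \<subseteq> UNIV \<and> length \<alpha> = m}" by (auto simp: runs_def)
qed (rule finite_lists_length_eq, simp)

lemma queries_below_mono:
  assumes "queries_below V m n" "m \<le> m'" "n' \<le> n"
  shows "queries_below V m' n'"
  unfolding queries_below_def
proof (intro allI impI)
  fix \<alpha> :: "bool list" and r assume *: "length \<alpha> = m'" "r < n'"
  then have "length (take m \<alpha>) = m" using assms(2) by simp
  then obtain i where "i < m" "V (take i (take m \<alpha>)) = r"
    using assms * unfolding queries_below_def by (meson less_le_trans)
  then show "\<exists>i<m'. V (take i \<alpha>) = r" using assms(2) by (intro exI[of _ i]) (auto simp: min_def)
qed

lemma consistent_snoc: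
  "consistent V x (\<alpha> @ [b]) \<longleftrightarrow> consistent V x \<alpha> \<and> (V \<alpha> < length x \<longrightarrow> b = x ! V \<alpha>)"
  by (auto simp: consistent_def nth_append less_Suc_eq)

lemma consistent_take: "consistent V x \<alpha> \<Longrightarrow> consistent V x (take n \<alpha>)"
  by (auto simp: consistent_def min_def)

lemma scanning_inj:
  assumes "scanning_function V" "V (take i \<alpha>) = V (take j \<alpha>)" "i \<le> length \<alpha>" "j \<le> length \<alpha>"
  shows "i = j"
proof -
  have "V (take i \<alpha>) \<noteq> V (take j \<alpha>)" if "j < i" "i \<le> length \<alpha>" for i j
  proof -
    have "j < length (take i \<alpha>)" "take j (take i \<alpha>) = take j \<alpha>" using that by (auto simp: min_def)
    then show ?thesis using assms(1) unfolding scanning_function_def by metis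
  qed
  then show ?thesis using assms by (metis linorder_neqE_nat)
qed

text \<open>All queries below \<open>length x\<close> have been asked and none is repeated, so the
  next answer is unconstrained. Both extensions of a consistent run are consistent, and fairness of
  \<open>S\<close> applies.\<close>

lemma average_Suc:
  assumes V: "scanning_function V" and S: "\<And>\<alpha>. S (\<alpha> @ [False]) + S (\<alpha> @ [True]) = 2 * S \<alpha>"
    and q: "queries_below V m (length x)"
  shows "average V S (Suc m) x = average V S m x"
proof -
  have V': "length x \<le> V \<alpha>" if \<alpha>: "length \<alpha> = m" for \<alpha>
  proof (rule ccontr)
    assume "\<not> length x \<le> V \<alpha>"
    then have "V \<alpha> < length x" by simp
    then have "\<exists>i<m. V (take i \<alpha>) = V \<alpha>" using q \<alpha> unfolding queries_below_def by blast
    then obtain i where "i < m" "V (take i \<alpha>) = V (take m \<alpha>)" using \<alpha> by auto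
    then show False using scanning_inj[OF V, of i \<alpha> m] \<alpha> by simp
  qed
  have runs: "runs V (Suc m) x = (\<lambda>\<alpha>. \<alpha> @ [False]) ` runs V m x \<union> (\<lambda>\<alpha>. \<alpha> @ [True]) ` runs V m x"
  proof (rule set_eqI)
    fix \<beta>
    show "\<beta> \<in> runs V (Suc m) x \<longleftrightarrow>
        \<beta> \<in> (\<lambda>\<alpha>. \<alpha> @ [False]) ` runs V m x \<union> (\<lambda>\<alpha>. \<alpha> @ [True]) ` runs V m x"
      using V'[THEN leD] by (cases \<beta> rule: rev_cases; cases "last \<beta>")
        (auto simp: runs_def consistent_snoc)
  qed
  have "(\<Sum>\<alpha>\<in>runs V (Suc m) x. S \<alpha>) =
      (\<Sum>\<alpha>\<in>(\<lambda>\<alpha>. \<alpha> @ [False]) ` runs V m x. S \<alpha>) + (\<Sum>\<alpha>\<in>(\<lambda>\<alpha>. \<alpha> @ [True]) ` runs V m x. S \<alpha>)"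
    unfolding runs by (rule sum.union_disjoint) (auto simp: finite_runs)
  also have "\<dots> = (\<Sum>\<alpha>\<in>runs V m x. S (\<alpha> @ [False]) + S (\<alpha> @ [True]))"
    by (simp add: sum.reindex inj_on_def sum.distrib)
  also have "\<dots> = 2 * (\<Sum>\<alpha>\<in>runs V m x. S \<alpha>)" by (simp add: S sum_distrib_left)
  finally show ?thesis by (simp add: average_def)
qed

lemma average_eq:
  assumes "scanning_function V" "\<And>\<alpha>. S (\<alpha> @ [False]) + S (\<alpha> @ [True]) = 2 * S \<alpha>"
    and "queries_below V m (length x)" "m \<le> m'"
  shows "average V S m' x = average V S m x"
  using assms(4)
proof (induction rule: dec_induct)
  case (step k)
  then show ?case
    using average_Suc[OF assms(1,2) queries_below_mono[OF assms(3) step.hyps(1) order_refl]] by simp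
qed simp

text \<open>Every run asks the query \<open>length x\<close> exactly once, and the answer decides
  which of the two extensions of \<open>x\<close> it is consistent with. The factor 2 stems from the
  normalisation.\<close>

lemma average_split:
  assumes V: "scanning_function V" and q: "queries_below V m (Suc (length x))"
  shows "average V S m (x @ [False]) + average V S m (x @ [True]) = 2 * average V S m x"
proof -
  let ?n = "length x"
  have ex: "\<exists>i<m. V (take i \<alpha>) = ?n" if "length \<alpha> = m" for \<alpha>
    using q that unfolding queries_below_def by blast
  have sub: "runs V m (x @ [b]) \<subseteq> runs V m x" for b
    by (auto simp: runs_def consistent_def nth_append)
  have "runs V m x \<subseteq> runs V m (x @ [False]) \<union> runs V m (x @ [True])"
  proof
    fix \<alpha> assume \<alpha>: "\<alpha> \<in> runs V m x"
    then obtain i where i: "i < m" "V (take i \<alpha>) = ?n" using ex by (auto simp: runs_def)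
    have "consistent V (x @ [\<alpha> ! i]) \<alpha>"
      unfolding consistent_def
    proof (intro allI impI)
      fix j assume j: "j < length \<alpha>" "V (take j \<alpha>) < length (x @ [\<alpha> ! i])"
      show "\<alpha> ! j = (x @ [\<alpha> ! i]) ! V (take j \<alpha>)"
      proof (cases "V (take j \<alpha>) < ?n")
        case True
        then show ?thesis using \<alpha> j by (auto simp: runs_def consistent_def nth_append)
      next
        case False
        then have "V (take j \<alpha>) = ?n" using j by simp
        moreover from this have "j = i"
          using scanning_inj[OF V, of j \<alpha> i] i j \<alpha> by (simp add: runs_def)
        ultimately show ?thesis by simp
      qed
    qed
    then show "\<alpha> \<in> runs V m (x @ [False]) \<union> runs V m (x @ [True])"
      using \<alpha> by (cases "\<alpha> ! i") (auto simp: runs_def)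
  qed
  then have un: "runs V m x = runs V m (x @ [False]) \<union> runs V m (x @ [True])" using sub by blast
  have "runs V m (x @ [False]) \<inter> runs V m (x @ [True]) = {}"
  proof (rule ccontr)
    assume "\<not> ?thesis"
    then obtain \<alpha> where \<alpha>: "\<alpha> \<in> runs V m (x @ [False])" "\<alpha> \<in> runs V m (x @ [True])" by blast
    then obtain i where "i < m" "V (take i \<alpha>) = ?n" using ex by (auto simp: runs_def)
    then show False using \<alpha> by (auto simp: runs_def consistent_def nth_append dest!: spec[of _ i])
  qed
  then have "(\<Sum>\<alpha>\<in>runs V m x. S \<alpha>) = (\<Sum>\<alpha>\<in>runs V m (x @ [False]). S \<alpha>) + (\<Sum>\<alpha>\<in>runs V m (x @ [True]). S \<alpha>)"
    unfolding un by (intro sum.union_disjoint finite_runs)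
  then show ?thesis by (simp add: average_def field_simps)
qed

text \<open>The \<open>length x\<close> prescribed answers halve the number of runs once each, but
  their positions depend on the run. Hence the count is generalised to the runs that extend a prefix
  \<open>\<gamma>\<close>: a step whose query is open has its answer forced, any other step is free.
  For the empty prefix all queries are open.\<close>

lemma card_runs:
  assumes V: "scanning_function V" and q: "queries_below V m (length x)"
  shows "card (runs V m x) * 2 ^ length x = 2 ^ m"
proof -
  let ?n = "length x"
  define ext where "ext \<gamma> = {\<alpha> \<in> runs V m x. take (length \<gamma>) \<alpha> = \<gamma>}" for \<gamma>
  define open_queries where "open_queries \<gamma> = {r. r < ?n \<and> (\<forall>i<length \<gamma>. V (take i \<gamma>) \<noteq> r)}" for \<gamma>
  have fin: "finite (ext \<gamma>)" for \<gamma> unfolding ext_def using finite_runs by simp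
  have "card (ext \<gamma>) * 2 ^ card (open_queries \<gamma>) = 2 ^ (m - length \<gamma>)"
    if "consistent V x \<gamma>" "length \<gamma> \<le> m" for \<gamma>
    using that
  proof (induction "m - length \<gamma>" arbitrary: \<gamma>)
    case 0
    then have len: "length \<gamma> = m" by simp
    then have "ext \<gamma> = {\<gamma>}" using 0 by (auto simp: ext_def runs_def)
    moreover have "open_queries \<gamma> = {}" using q len unfolding open_queries_def queries_below_def by blast
    ultimately show ?case using len by simp
  next
    case (Suc d)
    have len: "length \<gamma> < m" using Suc.hyps(2) by simp
    have IH: "card (ext (\<gamma> @ [b])) * 2 ^ card (open_queries (\<gamma> @ [b])) = 2 ^ d"
      if "consistent V x (\<gamma> @ [b])" for b
      using Suc.hyps(1)[of "\<gamma> @ [b]"] Suc.hyps(2) len that by simp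
    have take: "take (Suc (length \<gamma>)) \<alpha> = \<gamma> @ [b] \<longleftrightarrow> take (length \<gamma>) \<alpha> = \<gamma> \<and> \<alpha> ! length \<gamma> = b"
      if "length \<alpha> = m" for \<alpha> b using that len by (auto simp: take_Suc_conv_app_nth)
    have ext: "ext \<gamma> = ext (\<gamma> @ [False]) \<union> ext (\<gamma> @ [True])"
      "ext (\<gamma> @ [False]) \<inter> ext (\<gamma> @ [True]) = {}"
      unfolding ext_def using take by (auto simp: runs_def)
    have card: "card (ext \<gamma>) = card (ext (\<gamma> @ [False])) + card (ext (\<gamma> @ [True]))"
      unfolding ext(1) using fin ext(2) by (rule card_Un_disjoint[OF _ fin])
    have open_snoc: "open_queries (\<gamma> @ [b]) = open_queries \<gamma> - {V \<gamma>}" for b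
      by (auto simp: open_queries_def less_Suc_eq)
    show ?case
    proof (cases "V \<gamma> < ?n")
      case True
      define b where "b = x ! V \<gamma>"
      have "V \<gamma> \<in> open_queries \<gamma>"
        using True V unfolding open_queries_def scanning_function_def by fastforce
      moreover have "finite (open_queries \<gamma>)" by (simp add: open_queries_def)
      ultimately have o: "card (open_queries \<gamma>) = Suc (card (open_queries (\<gamma> @ [b])))"
        unfolding open_snoc by (metis card_Suc_Diff1)
      have "ext (\<gamma> @ [\<not> b]) = {}"
      proof (rule ccontr)
        assume "ext (\<gamma> @ [\<not> b]) \<noteq> {}"
        then obtain \<alpha> where "consistent V x \<alpha>" "take (Suc (length \<gamma>)) \<alpha> = \<gamma> @ [\<not> b]"
          by (auto simp: ext_def runs_def)
        then have "consistent V x (\<gamma> @ [\<not> b])" by (metis consistent_take)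
        then show False using True by (simp add: consistent_snoc b_def)
      qed
      then have "card (ext \<gamma>) = card (ext (\<gamma> @ [b]))" using card by (cases b) auto
      moreover have "consistent V x (\<gamma> @ [b])" using Suc.prems by (simp add: consistent_snoc b_def)
      ultimately have "card (ext \<gamma>) * 2 ^ card (open_queries \<gamma>) = 2 * 2 ^ d" using IH[of b] o by simp
      then show ?thesis by (simp flip: Suc.hyps(2))
    next
      case False
      then have o: "open_queries (\<gamma> @ [b]) = open_queries \<gamma>" for b
        unfolding open_snoc by (auto simp: open_queries_def)
      have "consistent V x (\<gamma> @ [b])" for b using Suc.prems False by (simp add: consistent_snoc)
      then have "card (ext \<gamma>) * 2 ^ card (open_queries \<gamma>) = 2 ^ d + 2 ^ d"
        using IH[of False] IH[of True] by (simp add: card o algebra_simps)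
      then show ?thesis by (simp flip: Suc.hyps(2))
    qed
  qed
  from this[of "[]"] show ?thesis
    by (simp add: consistent_def ext_def open_queries_def)
qed

lemma average_greater:
  assumes V: "scanning_function V" and q: "queries_below V m (length x)"
    and S: "\<And>\<alpha>. \<alpha> \<in> runs V m x \<Longrightarrow> r < S \<alpha>"
  shows "r < average V S m x"
proof -
  have "card (runs V m x) \<noteq> 0" using card_runs[OF V q] by (metis mult_0 power_not_zero zero_neq_numeral)
  then have ne: "runs V m x \<noteq> {}" by auto
  have "r = 2 ^ length x * (\<Sum>\<alpha>\<in>runs V m x. r) / 2 ^ m"
  proof -
    have "of_nat (card (runs V m x) * 2 ^ length x) = (of_nat (2 ^ m) :: rat)"
      using card_runs[OF V q] by (simp only:)
    then show ?thesis by (simp add: field_simps)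
  qed
  also have "\<dots> < average V S m x"
    unfolding average_def using S ne
    by (intro divide_strict_right_mono mult_strict_left_mono sum_strict_mono finite_runs) auto
  finally show ?thesis .
qed

lemma average_martingale:
  assumes V: "scanning_function V" and S: "\<And>\<alpha>. S (\<alpha> @ [False]) + S (\<alpha> @ [True]) = 2 * S \<alpha>"
    and pos: "\<And>\<alpha>. 0 < S \<alpha>" and q: "\<And>n. queries_below V (h n) n" and h: "mono h"
  shows "martingale (\<lambda>x. average V S (h (length x)) x)"
  unfolding martingale_def
proof (intro conjI allI)
  fix x :: "bool list"
  let ?n = "length x"
  show "0 < average V S (h ?n) x" by (rule average_greater[OF V q pos])
  \<comment> \<open>Before splitting, the average at \<open>x\<close> is lifted to the run length
    used for its two successors.\<close>
  have "average V S (h ?n) x = average V S (h (Suc ?n)) x"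
    by (rule average_eq[OF V S q monoD[OF h], symmetric]) simp_all
  then show "average V S (h ?n) x = (average V S (h (length (x @ [False]))) (x @ [False]) +
      average V S (h (length (x @ [True]))) (x @ [True])) / 2"
    using average_split[OF V, of "h (Suc ?n)" x S] q by simp
qed

text \<open>If the first \<open>i\<close> queries of the scan are below \<open>n\<close>, their
  answers are determined by the first \<open>n\<close> bits of \<open>Z\<close>.\<close>

lemma consistent_set_prefix:
  assumes \<alpha>: "consistent V (set_prefix Z n) \<alpha>" and i: "i \<le> length \<alpha>"
    and n: "\<And>k. k < i \<Longrightarrow> V (scan_prefix Z V k) < n"
  shows "take i \<alpha> = scan_prefix Z V i"
  using i n
proof (induction i)
  case (Suc i)
  then have IH: "take i \<alpha> = scan_prefix Z V i" by simp
  have "V (take i \<alpha>) < n" using Suc.prems IH by simp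
  then have "\<alpha> ! i = (V (take i \<alpha>) \<in> Z)"
    using \<alpha> Suc.prems(1) by (auto simp: consistent_def set_prefix_def)
  then show ?case using Suc.prems IH by (simp add: take_Suc_conv_app_nth)
qed simp

theorem average_saver_succeeds:
  assumes V: "scanning_function V" and M: "martingale M" "M [] + 1 \<le> of_nat c"
    and succ: "succeeds_on M (scan Z V)"
    and q: "\<And>n. queries_below V (h n) n" and h: "\<And>n. n \<le> h n"
  shows "succeeds_on (\<lambda>x. average V (saver c M) (h (length x)) x) Z"
proof -
  let ?L = "\<lambda>n. average V (saver c M) (h (length (set_prefix Z n))) (set_prefix Z n)"
  have len: "length (set_prefix Z n) = n" for n by (simp add: set_prefix_def)
  have "\<exists>N. \<forall>n\<ge>N. of_nat K < ?L n" for K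
  proof -
    obtain i where i: "K \<le> halvings M (scan_prefix Z V i) i"
      using halvings_unbounded[OF succ] by (auto simp: set_prefix_scan)
    \<comment> \<open>The sum is larger than each of the first \<open>i\<close> queries, and the
      summand \<open>i\<close> makes the runs long enough, as \<open>n \<le> h n\<close>.\<close>
    define N where "N = i + (\<Sum>k<i. Suc (V (scan_prefix Z V k)))"
    have "of_nat K < ?L n" if n: "N \<le> n" for n
      unfolding len
    proof (rule average_greater[OF V])
      show "queries_below V (h n) (length (set_prefix Z n))" unfolding len by (rule q)
      fix \<alpha> assume \<alpha>: "\<alpha> \<in> runs V (h n) (set_prefix Z n)"
      have "i \<le> length \<alpha>" using \<alpha> h[of n] n by (simp add: runs_def N_def)
      moreover have "V (scan_prefix Z V k) < n" if "k < i" for k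
        using member_le_sum[of k "{..<i}" "\<lambda>k. Suc (V (scan_prefix Z V k))"] that n by (simp add: N_def)
      ultimately have take: "take i \<alpha> = scan_prefix Z V i"
        using \<alpha> by (intro consistent_set_prefix) (auto simp: runs_def)
      have "K \<le> halvings M (take i \<alpha>) i" using i take by simp
      also have "\<dots> = halvings M \<alpha> i"
        using halvings_append[of i "take i \<alpha>" M "drop i \<alpha>"] \<open>i \<le> length \<alpha>\<close> by simp
      also have "\<dots> \<le> halvings M \<alpha> (length \<alpha>)" using \<open>i \<le> length \<alpha>\<close> by (rule halvings_mono)
      finally have "(of_nat K :: rat) \<le> of_nat (halvings M \<alpha> (length \<alpha>))" by simp
      also have "\<dots> < saver c M \<alpha>" by (rule saver_ge_halvings[OF M])
      finally show "of_nat K < saver c M \<alpha>" .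
    qed
    then show ?thesis by blast
  qed
  then have "\<forall>K. \<exists>N. \<forall>n\<ge>N. ereal (real K) < ereal (real_of_rat (?L n))"
    by (metis less_ereal.simps(1) of_rat_less of_rat_of_nat_eq)
  then have "(\<lambda>n. ereal (real_of_rat (?L n))) \<longlonglongrightarrow> \<infinity>"
    unfolding tendsto_PInfty eventually_sequentially
    by (meson ereal_less_eq(3) less_imp_le order.strict_trans1 real_arch_simple)
  then show ?thesis
    unfolding succeeds_on_def by (intro lim_imp_Limsup) auto
qed

section \<open>The averaged martingale is computable in polynomial space\<close>

abbreviation decode :: "nat \<Rightarrow> bool list" where
  "decode n \<equiv> tl (binary n)"

text \<open>Division removes the last \<open>nlen n - i\<close> digits; the leading 1 survives, so
  the result codes the prefix. For \<open>i\<close> beyond the length the truncated difference is 0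
  and the whole string is kept.\<close>

definition prefix_num :: "nat \<Rightarrow> nat \<Rightarrow> nat" where
  "prefix_num n i = n div 2 ^ (nlen n - i)"

definition sibling_num :: "nat \<Rightarrow> nat" where
  "sibling_num n = (if even n then n + 1 else n - 1)"

lemma decode_code: "decode (code x) = x"
  by (simp add: binary_code)

lemma decode_0: "decode 0 = []"
  by (simp add: binary.simps)

lemma nlen_code: "nlen (code x) = length x"
  by (simp add: nlen_def binary_code)

lemma binary_pos: "0 < n \<Longrightarrow> binary n = True # decode n"
  using binary_max_1[of n] by (simp add: max_absorb1 Suc_leI)

lemma length_binary_pos: "0 < n \<Longrightarrow> length (binary n) = Suc (nlen n)"
proof -
  assume "0 < n"
  then obtain y where "binary n = True # y" using binary_pos by blast
  then show ?thesis by (simp add: nlen_def)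
qed

lemma code_decode:
  assumes "0 < n"
  shows "code (decode n) = n"
  using assms
proof (induction n rule: less_induct)
  case (less n)
  show ?case
  proof (cases "n = 1")
    case True
    then show ?thesis by (simp add: binary.simps)
  next
    case False
    then have n2: "0 < n div 2" using less.prems by linarith
    then have "binary (n div 2) \<noteq> []" using binary_pos[of "n div 2"] by force
    moreover have "binary n = binary (n div 2) @ [odd n]" using less.prems by (subst binary.simps) simp
    ultimately have "decode n = decode (n div 2) @ [odd n]" by simp
    then show ?thesis using less.IH[of "n div 2"] n2 by simp
  qed
qed

lemma nlen_bounds:
  assumes "0 < n"
  shows "2 ^ nlen n \<le> n" "n < 2 ^ Suc (nlen n)"
  using code_ge[of "decode n"] code_less[of "decode n"] code_decode[OF assms] by (simp_all add: nlen_def)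

lemma nlen_eqI:
  assumes "2 ^ m \<le> n" "n < 2 ^ Suc m"
  shows "nlen n = m"
proof -
  have n: "0 < n" using assms(1) by (metis gr0I not_le zero_less_numeral zero_less_power)
  have "2 ^ m < (2::nat) ^ Suc (nlen n)" "2 ^ nlen n < (2::nat) ^ Suc m"
    using nlen_bounds[OF n] assms by linarith+
  then have "m < Suc (nlen n)" "nlen n < Suc m" by (simp_all only: power_strict_increasing_iff)
  then show ?thesis by simp
qed

text \<open>Positive \<open>k\<close> avoids the exception at \<open>n = 0\<close>, where
  \<open>nlen\<close> is 0 although \<open>2 ^ 0 \<le> 0\<close> fails.\<close>

lemma power2_le_iff_nlen:
  assumes "0 < k"
  shows "2 ^ k \<le> n \<longleftrightarrow> k \<le> nlen n"
proof (cases "n = 0")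
  case True
  then show ?thesis using assms by (simp add: nlen_def binary.simps)
next
  case False
  then have n: "0 < n" by simp
  show ?thesis
  proof
    assume "2 ^ k \<le> n"
    then have "2 ^ k < (2::nat) ^ Suc (nlen n)" using nlen_bounds(2)[OF n] by linarith
    then have "k < Suc (nlen n)" by (simp only: power_strict_increasing_iff one_less_numeral_iff semiring_norm)
    then show "k \<le> nlen n" by simp
  next
    assume "k \<le> nlen n"
    then have "(2::nat) ^ k \<le> 2 ^ nlen n" by simp
    then show "2 ^ k \<le> n" using nlen_bounds(1)[OF n] by linarith
  qed
qed

lemma code_append_div: "code (x @ y) div 2 ^ length y = code x"
proof (induction y rule: rev_induct)
  case (snoc b y)
  have "code (x @ y @ [b]) div 2 = code (x @ y)"
    using code_simps(2)[of "x @ y" b] by simp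
  then show ?case using snoc by (simp add: div_mult2_eq)
qed simp

lemma prefix_num_code: "prefix_num (code x) i = code (take i x)"
  using code_append_div[of "take i x" "drop i x"] by (simp add: prefix_num_def nlen_code)

lemma decode_prefix_num: "decode (prefix_num n i) = take i (decode n)"
proof (cases "n = 0")
  case True
  then show ?thesis by (simp add: prefix_num_def decode_0)
next
  case False
  then show ?thesis using prefix_num_code[of "decode n" i] code_decode[of n] by (simp add: decode_code)
qed

lemma nlen_prefix_num: "nlen (prefix_num n i) = length (take i (decode n))"
  using decode_prefix_num[of n i] nlen_eq by metis

lemma decode_nth:
  assumes "k < nlen n"
  shows "decode n ! k = odd (prefix_num n (Suc k))"
proof -
  have n: "0 < n" using assms by (cases n) (auto simp: nlen_def binary.simps)
  have "prefix_num n (Suc k) = code (take (Suc k) (decode n))"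
    using prefix_num_code[of "decode n" "Suc k"] code_decode[OF n] by simp
  also have "take (Suc k) (decode n) = take k (decode n) @ [decode n ! k]"
    using assms by (simp add: take_Suc_conv_app_nth nlen_def)
  finally show ?thesis by simp
qed

lemma decode_sibling_num:
  assumes "i < nlen n"
  shows "decode (sibling_num (prefix_num n (Suc i))) = sibling (take (Suc i) (decode n))"
proof -
  have n: "0 < n" using assms by (cases n) (auto simp: nlen_def binary.simps)
  define y where "y = take i (decode n)"
  have y: "take (Suc i) (decode n) = y @ [decode n ! i]"
    using assms by (simp add: take_Suc_conv_app_nth nlen_def y_def)
  have "prefix_num n (Suc i) = code (y @ [decode n ! i])"
    using prefix_num_code[of "decode n" "Suc i"] code_decode[OF n] y by simp
  then have "sibling_num (prefix_num n (Suc i)) = code (y @ [\<not> decode n ! i])"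
    by (simp add: sibling_num_def)
  then show ?thesis using decode_code[of "y @ [\<not> decode n ! i]"] by (simp add: y sibling_def)
qed

lemma pspace_prefix_num: "pspace f \<Longrightarrow> pspace g \<Longrightarrow> pspace (\<lambda>x. prefix_num (f x) (g x))"
  unfolding prefix_num_def
  by (intro pspace_div pspace_power pspace_diff pspace_nlen small_diff small_nlen)

lemma pspace_sibling_num: "pspace f \<Longrightarrow> pspace (\<lambda>x. sibling_num (f x))"
  unfolding sibling_num_def by (intro pspace_intros)

section \<open>Reading off queries and rational values\<close>

lemma pspace_scanning_function:
  assumes "polyspace_computable (\<lambda>\<alpha>. replicate (V \<alpha>) zero_sym)"
  shows "pspace (\<lambda>n. V (decode n))"
proof -
  obtain G where G: "5 \<le> G" and F: "pspace (\<lambda>n. undigs G (replicate (V (decode n)) 2))"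
    using assms by (rule pspace_polyspace_computable) auto
  have "pspace (\<lambda>n. length (digs G (undigs G (replicate (V (decode n)) 2))))"
    using G F by (intro pspace_length_digs) auto
  moreover have "digs G (undigs G (replicate (V x) 2)) = replicate (V x) 2" for x
    using G by (intro digs_undigs) auto
  ultimately show ?thesis by simp
qed

text \<open>One step in parsing a word of \<open>rat_syms\<close>. The second component is the
  number being read, whose next bit is \<open>d - 2\<close>; the separator 4 stores it as the
  numerator and starts the denominator.\<close>

definition fraction_step :: "nat \<Rightarrow> nat \<Rightarrow> nat" where
  "fraction_step d z = (if d = 4 then pair (psnd z) 0 else pair (pfst z) (2 * psnd z + (d - 2)))"

lemma fold_fraction_step_bits:
  "fold fraction_step (bits_syms (binary a)) (pair u 0) = pair u a"
proof (induction a rule: less_induct)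
  case (less a)
  show ?case
  proof (cases "a = 0")
    case True
    then show ?thesis by (simp add: binary.simps)
  next
    case False
    then have b: "binary a = binary (a div 2) @ [odd a]" by (subst binary.simps) simp
    show ?thesis using less.IH[of "a div 2"] False
      unfolding b by (auto simp: fraction_step_def)
  qed
qed

text \<open>The slack \<open>G\<close> absorbs the digit added at each doubling, since
  \<open>2 * b + d + G \<le> 2 * (b + G)\<close> for \<open>d < G\<close>.\<close>

lemma fold_fraction_step_bound:
  assumes "\<And>d. d \<in> set ds \<Longrightarrow> d < G" "pfst z + G \<le> G * 2 ^ k" "psnd z + G \<le> G * 2 ^ k"
  shows "pfst (fold fraction_step ds z) + G \<le> G * 2 ^ (k + length ds) \<and>
    psnd (fold fraction_step ds z) + G \<le> G * 2 ^ (k + length ds)"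
  using assms
proof (induction ds arbitrary: z k)
  case (Cons d ds)
  have d: "d < G" using Cons.prems by simp
  have "pfst (fraction_step d z) + G \<le> G * 2 ^ Suc k \<and> psnd (fraction_step d z) + G \<le> G * 2 ^ Suc k"
    using Cons.prems(2,3) d by (auto simp: fraction_step_def)
  then show ?case using Cons.IH[of "fraction_step d z" "Suc k"] Cons.prems(1) by simp
qed simp

lemma pspace_rational:
  assumes "polyspace_computable (\<lambda>x. rat_syms (M x))" and pos: "\<And>x. 0 < M x"
  obtains N D where "pspace N" "pspace D" "\<And>n. 0 < D n" "\<And>n. M (decode n) = of_nat (N n) / of_nat (D n)"
proof -
  have syms: "set (rat_syms r) \<subseteq> {2, 3, 4}" for r by (auto simp: rat_syms_def bits_syms_def)
  obtain G where G: "5 \<le> G" "\<And>x a. a \<in> set (rat_syms (M x)) \<Longrightarrow> a < G"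
    and F: "pspace (\<lambda>n. undigs G (rat_syms (M (decode n))))"
  proof (rule pspace_polyspace_computable[OF assms(1)])
    show "0 \<notin> set (rat_syms (M x))" for x using syms by fastforce
  qed blast
  define ds where "ds n = digs G (undigs G (rat_syms (M (decode n))))" for n
  have ds: "ds n = rat_syms (M (decode n))" for n
    unfolding ds_def using G syms[of "M (decode n)"] by (intro digs_undigs) fastforce+
  obtain q where q: "\<And>m x. x < 2 ^ m \<Longrightarrow> undigs G (rat_syms (M (decode x))) < 2 ^ poly q m"
    using F by (rule pspace_bounded) blast
  define Q where "Q m = 4 * (G + poly q m) + 3" for m
  let ?F = "\<lambda>n. fold fraction_step (ds n) (pair 0 0)"
  have PS: "pspace ?F"
    unfolding ds_def
  proof (rule pspace_fold_digs[where Q = Q])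
    show "pspace (\<lambda>z. fraction_step (pfst (psnd z)) (psnd (psnd z)))"
      unfolding fraction_step_def by (intro pspace_intros)
    show "poly_bounded Q" unfolding Q_def by (intro poly_bounded_intros)
    fix m x t :: nat
    assume x: "x < 2 ^ m"
    let ?ds = "take t (ds x)"
    let ?z = "fold fraction_step ?ds (pair 0 0)"
    have "length ?ds \<le> poly q m" using length_digs_le[OF q[OF x], of G] by (simp add: ds_def)
    then have "G * 2 ^ length ?ds < 2 ^ G * 2 ^ poly q m"
      using less_exp[of G] by (intro mult_less_le_imp_less) auto
    then have K: "G * 2 ^ length ?ds < 2 ^ (G + poly q m)" by (simp add: power_add)
    have "pfst ?z + G \<le> G * 2 ^ (0 + length ?ds) \<and> psnd ?z + G \<le> G * 2 ^ (0 + length ?ds)"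
      by (rule fold_fraction_step_bound) (auto simp: ds dest!: in_set_takeD G(2))
    then have "pfst ?z < 2 ^ (G + poly q m)" "psnd ?z < 2 ^ (G + poly q m)" using K by auto
    from pspace_pair_bounded[OF this] show "fold fraction_step (take t (digs G (undigs G (rat_syms (M (decode x))))))
        (pair 0 0) < 2 ^ Q m"
      by (simp add: ds_def Q_def)
  qed (use G in \<open>auto intro!: pspace_intros F\<close>)
  let ?a = "\<lambda>n. nat (fst (quotient_of (M (decode n))))"
  let ?d = "\<lambda>n. nat (snd (quotient_of (M (decode n))))"
  have val: "?F n = pair (?a n) (?d n)" for n
    unfolding ds rat_syms_def by (simp add: fold_fraction_step_bits fraction_step_def)
  show ?thesis
  proof (rule that[of ?a ?d])
    show "pspace ?a" using pspace_pfst[OF PS] by (simp add: val)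
    show "pspace ?d" using pspace_psnd[OF PS] by (simp add: val)
    show "0 < ?d n" for n using quotient_of_denom_pos'[of "M (decode n)"] by simp
    fix n
    let ?r = "M (decode n)"
    have r: "?r = of_int (fst (quotient_of ?r)) / of_int (snd (quotient_of ?r))"
      by (rule quotient_of_div) simp
    have d: "0 < snd (quotient_of ?r)" by (rule quotient_of_denom_pos')
    then have "0 < fst (quotient_of ?r)"
      using r pos[of "decode n"] by (metis divide_pos_pos less_irrefl not_less_iff_gr_or_eq of_int_0_less_iff
          zero_less_divide_iff)
    then show "?r = of_nat (?a n) / of_nat (?d n)" using r d by (simp add: of_nat_nat)
  qed
qed

text \<open>Rounding down does not affect the comparison with an integer, so the condition for a
  halving can be read from the length of \<open>approx M y\<close>.\<close>

lemma power2_le_approx_iff: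
  assumes "0 < M y" "0 < k"
  shows "2 ^ k \<le> M y \<longleftrightarrow> length y + k \<le> nlen (approx M y)"
proof -
  have "2 ^ k \<le> M y \<longleftrightarrow> 2 ^ length y * 2 ^ k \<le> 2 ^ length y * M y" by simp
  also have "\<dots> \<longleftrightarrow> of_nat (2 ^ (length y + k)) \<le> 2 ^ length y * M y" by (simp add: power_add)
  also have "\<dots> \<longleftrightarrow> 2 ^ (length y + k) \<le> approx M y"
  proof
    assume "of_nat (2 ^ (length y + k)) \<le> 2 ^ length y * M y"
    then have "(of_nat (2 ^ (length y + k)) :: rat) < of_nat (approx M y + 1)"
      using approx_bounds(2)[of M y, OF assms(1)] by simp
    then have "2 ^ (length y + k) < approx M y + 1" by (simp only: of_nat_less_iff)
    then show "2 ^ (length y + k) \<le> approx M y" by simp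
  next
    assume "2 ^ (length y + k) \<le> approx M y"
    then have "(of_nat (2 ^ (length y + k)) :: rat) \<le> of_nat (approx M y)" by (simp only: of_nat_le_iff)
    then show "of_nat (2 ^ (length y + k)) \<le> 2 ^ length y * M y"
      using approx_bounds(1)[of M y, OF assms(1)] by (rule order_trans)
  qed
  also have "\<dots> \<longleftrightarrow> length y + k \<le> nlen (approx M y)"
    using assms(2) by (intro power2_le_iff_nlen) simp
  finally show ?thesis .
qed

lemma pspace_approx:
  assumes "polyspace_martingale M"
  shows "pspace (\<lambda>n. approx M (decode n))"
proof -
  have "polyspace_computable (\<lambda>x. rat_syms (M x))" "\<And>x. 0 < M x"
    using assms by (auto simp: polyspace_martingale_def martingale_def)
  then obtain N D where ND: "pspace N" "pspace D" "\<And>n. 0 < D n"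
    "\<And>n. M (decode n) = of_nat (N n) / of_nat (D n)"
    by (rule pspace_rational) blast
  have "approx M (decode n) = 2 ^ nlen n * N n div D n" for n
  proof -
    have "2 ^ nlen n * M (decode n) = of_nat (2 ^ nlen n * N n) / of_nat (D n)" by (simp add: ND(4))
    then show ?thesis
      unfolding approx_def nlen_eq by (simp only: floor_divide_of_nat_eq nat_int)
  qed
  moreover have "pspace (\<lambda>n. 2 ^ nlen n * N n div D n)"
    by (intro pspace_div pspace_mult pspace_power pspace_nlen small_nlen pspace_id ND)
  ultimately show ?thesis by simp
qed

lemma pspace_halvings:
  assumes M: "polyspace_martingale M" and f: "pspace f" and g: "pspace g"
  shows "pspace (\<lambda>x. halvings M (decode (f x)) (g x))"
proof -
  have pos: "\<And>x. 0 < M x" using M by (auto simp: polyspace_martingale_def martingale_def)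
  define h where "h e i j = (if nlen (prefix_num e (Suc i)) + (j + 1) \<le>
    nlen (approx M (decode (prefix_num e (Suc i)))) then Suc j else j)" for e i j
  have h: "halvings M (decode e) t = rec_nat 0 (h e) t" for e t
  proof (induction t)
    case (Suc t)
    then show ?case
      using power2_le_approx_iff[of M "take (Suc t) (decode e)" "halvings M (decode e) t + 1", OF pos]
      by (simp add: h_def decode_prefix_num nlen_prefix_num)
  qed simp
  obtain q where q: "\<And>m x. x < 2 ^ m \<Longrightarrow> g x < 2 ^ poly q m"
    using g by (rule pspace_bounded) blast
  have "pspace (\<lambda>x. rec_nat 0 (h (f x)) (g x))"
  proof (rule pspace_rec[where Q = "poly q"])
    show "pspace (\<lambda>z. h (f (pfst z)) (pfst (psnd z)) (psnd (psnd z)))"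
      unfolding h_def
      by (intro pspace_intros pspace_nlen pspace_prefix_num pspace_comp[OF pspace_approx[OF M]]
          pspace_comp[OF f])
    fix m x t :: nat
    assume "x < 2 ^ m" "t \<le> g x"
    then show "rec_nat 0 (h (f x)) t < 2 ^ poly q m"
      using q[of x m] halvings_le[of M "decode (f x)" t] unfolding h by linarith
  qed (intro pspace_intros g poly_bounded_intros)+
  then show ?thesis unfolding h .
qed

section \<open>Numerators of the saving martingale and of its average\<close>

text \<open>The numerator over \<open>2 ^ (2 * nlen n)\<close>. This denominator suffices because
  \<open>halvings\<close> is at most \<open>i\<close>, so the exponents are at most
  \<open>2 * i + 2\<close>. Gains and losses are summed separately to stay within the natural
  numbers.\<close>

definition saver_num :: "nat \<Rightarrow> (bool list \<Rightarrow> rat) \<Rightarrow> nat \<Rightarrow> nat" where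
  "saver_num c M n = c * 2 ^ (2 * nlen n) +
     (\<Sum>i<nlen n. approx M (decode (prefix_num n (Suc i))) *
        2 ^ (2 * nlen n - (i + 2 + halvings M (decode n) i))) -
     (\<Sum>i<nlen n. approx M (decode (sibling_num (prefix_num n (Suc i)))) *
        2 ^ (2 * nlen n - (i + 2 + halvings M (decode n) i)))"

lemma pspace_saver_num:
  assumes M: "polyspace_martingale M" and f: "pspace f"
  shows "pspace (\<lambda>x. saver_num c M (f x))"
  unfolding saver_num_def
  by (intro pspace_diff pspace_add pspace_mult pspace_sum pspace_const pspace_power pspace_nlen
      pspace_comp[OF pspace_approx[OF M]] pspace_prefix_num pspace_sibling_num pspace_Suc
      pspace_halvings[OF M] pspace_pfst pspace_psnd pspace_id pspace_comp[OF f] small_intros)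

lemma saver_num_eq:
  assumes "martingale M" "M [] + 1 \<le> of_nat c"
  shows "of_nat (saver_num c M n) = 2 ^ (2 * nlen n) * saver c M (decode n)"
proof -
  let ?N = "nlen n"
  let ?k = "\<lambda>i. i + 2 + halvings M (decode n) i"
  let ?a = "\<lambda>i. approx M (take (Suc i) (decode n))"
  let ?b = "\<lambda>i. approx M (sibling (take (Suc i) (decode n)))"
  define P where "P = c * 2 ^ (2 * ?N) + (\<Sum>i<?N. ?a i * 2 ^ (2 * ?N - ?k i))"
  define R where "R = (\<Sum>i<?N. ?b i * 2 ^ (2 * ?N - ?k i))"
  have num: "saver_num c M n = P - R"
    unfolding saver_num_def P_def R_def by (simp add: decode_prefix_num decode_sibling_num)
  have pow: "2 ^ (2 * ?N) / 2 ^ ?k i = (2 ^ (2 * ?N - ?k i) :: rat)" if "i < ?N" for i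
    using halvings_le[of M "decode n" i] that by (subst power_diff) auto
  have "2 ^ (2 * ?N) * saver c M (decode n) =
      of_nat c * 2 ^ (2 * ?N) + (\<Sum>i<?N. (of_nat (?a i) - of_nat (?b i)) * (2 ^ (2 * ?N) / 2 ^ ?k i))"
    unfolding saver_def nlen_eq by (simp add: distrib_left sum_distrib_left mult.commute)
  also have "\<dots> = of_nat c * 2 ^ (2 * ?N) + (\<Sum>i<?N. (of_nat (?a i) - of_nat (?b i)) * 2 ^ (2 * ?N - ?k i))"
    using pow by simp
  also have "\<dots> = of_nat P - of_nat R"
    unfolding P_def R_def by (simp add: sum_subtractf left_diff_distrib)
  finally have eq: "2 ^ (2 * ?N) * saver c M (decode n) = of_nat P - of_nat R" .
  \<comment> \<open>Positivity of \<open>saver\<close> shows that the subtraction in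
    \<open>saver_num\<close> is not truncated.\<close>
  have "(0 :: rat) \<le> of_nat (halvings M (decode n) (length (decode n)))" by simp
  also have "\<dots> < saver c M (decode n)" by (rule saver_ge_halvings[OF assms])
  finally have "0 < 2 ^ (2 * ?N) * saver c M (decode n)" by simp
  then have "(of_nat R :: rat) < of_nat P" unfolding eq by simp
  then have "R \<le> P" by simp
  then show ?thesis unfolding num eq by (rule of_nat_diff)
qed

lemma pspace_consistent:
  assumes V: "pspace (\<lambda>n. V (decode n))" and f: "pspace f" and g: "pspace g"
  shows "pspace (\<lambda>x. of_bool (consistent V (decode (f x)) (decode (g x))))"
proof -
  have "consistent V (decode e) (decode a) \<longleftrightarrow> (\<forall>i<nlen a. V (decode (prefix_num a i)) < nlen e \<longrightarrow>
      (odd (prefix_num a (Suc i)) \<longleftrightarrow> odd (prefix_num e (Suc (V (decode (prefix_num a i)))))))" for e a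
    unfolding consistent_def nlen_eq decode_prefix_num by (auto simp: decode_nth)
  moreover have "pspace (\<lambda>x. of_bool (\<forall>i<nlen (g x). V (decode (prefix_num (g x) i)) < nlen (f x) \<longrightarrow>
      (odd (prefix_num (g x) (Suc i)) \<longleftrightarrow>
       odd (prefix_num (f x) (Suc (V (decode (prefix_num (g x) i))))))))"
    by (intro pspace_intros pspace_nlen pspace_prefix_num pspace_comp[OF V] pspace_comp[OF f] pspace_comp[OF g])
  ultimately show ?thesis by simp
qed

text \<open>The codes of the strings of length \<open>m\<close> are the numbers
  \<open>2 ^ m + k\<close> with \<open>k < 2 ^ m\<close>. The denominator \<open>2 ^ (3 * m)\<close>
  combines \<open>2 ^ (2 * m)\<close> from \<open>saver_num\<close> with \<open>2 ^ m\<close> from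
  the average.\<close>

definition average_num ::
    "(bool list \<Rightarrow> nat) \<Rightarrow> nat \<Rightarrow> (bool list \<Rightarrow> rat) \<Rightarrow> nat \<Rightarrow> nat \<Rightarrow> nat" where
  "average_num V c M m e = 2 ^ nlen e *
     (\<Sum>k<2 ^ m. of_bool (consistent V (decode e) (decode (2 ^ m + k))) * saver_num c M (2 ^ m + k))"

lemma average_num_eq:
  assumes "martingale M" "M [] + 1 \<le> of_nat c"
  shows "average V (saver c M) m (decode e) = of_nat (average_num V c M m e) / of_nat (2 ^ (3 * m))"
proof -
  let ?S = "saver c M"
  let ?x = "decode e"
  have nl: "nlen (2 ^ m + k) = m" if "k < 2 ^ m" for k by (rule nlen_eqI) (use that in auto)
  have "(\<Sum>\<alpha>\<in>runs V m ?x. ?S \<alpha>) = (\<Sum>\<alpha>\<in>runs V m ?x. of_bool (consistent V ?x \<alpha>) * ?S \<alpha>)"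
    by (rule sum.cong) (auto simp: runs_def)
  also have "\<dots> = (\<Sum>\<alpha>\<in>{\<alpha>. length \<alpha> = m}. of_bool (consistent V ?x \<alpha>) * ?S \<alpha>)"
  proof (rule sum.mono_neutral_left)
    show "finite {\<alpha> :: bool list. length \<alpha> = m}"
      using finite_lists_length_eq[of "UNIV :: bool set" m] by simp
  qed (auto simp: runs_def)
  also have "\<dots> = (\<Sum>k<2 ^ m. of_bool (consistent V ?x (decode (2 ^ m + k))) * ?S (decode (2 ^ m + k)))"
  proof (rule sum.reindex_bij_witness[where i = "\<lambda>k. decode (2 ^ m + k)" and j = "\<lambda>\<alpha>. code \<alpha> - 2 ^ m"])
    fix \<alpha> :: "bool list" assume "\<alpha> \<in> {\<alpha>. length \<alpha> = m}"
    then have "2 ^ m \<le> code \<alpha>" "code \<alpha> < 2 ^ Suc m" using code_ge[of \<alpha>] code_less[of \<alpha>] by auto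
    then show "decode (2 ^ m + (code \<alpha> - 2 ^ m)) = \<alpha>" "code \<alpha> - 2 ^ m \<in> {..<2 ^ m}"
      "of_bool (consistent V ?x (decode (2 ^ m + (code \<alpha> - 2 ^ m)))) * ?S (decode (2 ^ m + (code \<alpha> - 2 ^ m))) =
        of_bool (consistent V ?x \<alpha>) * ?S \<alpha>"
      by (simp_all add: decode_code)
  next
    fix k :: nat assume "k \<in> {..<2 ^ m}"
    then show "code (decode (2 ^ m + k)) - 2 ^ m = k" "decode (2 ^ m + k) \<in> {\<alpha>. length \<alpha> = m}"
      using nl[of k] code_decode[of "2 ^ m + k"] by (simp_all add: nlen_def)
  qed
  also have "2 ^ (2 * m) * \<dots> = of_nat (\<Sum>k<2 ^ m. of_bool (consistent V ?x (decode (2 ^ m + k))) *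
      saver_num c M (2 ^ m + k))"
    unfolding of_nat_sum sum_distrib_left
    by (rule sum.cong) (auto simp: saver_num_eq[OF assms] nl)
  finally have "2 ^ (2 * m) * (\<Sum>\<alpha>\<in>runs V m ?x. ?S \<alpha>) = of_nat (\<Sum>k<2 ^ m.
      of_bool (consistent V ?x (decode (2 ^ m + k))) * saver_num c M (2 ^ m + k))" .
  then have "of_nat (average_num V c M m e) = 2 ^ nlen e * (2 ^ (2 * m) * (\<Sum>\<alpha>\<in>runs V m ?x. ?S \<alpha>))"
    unfolding average_num_def by simp
  moreover have "(2::rat) ^ (3 * m) = 2 ^ (2 * m) * 2 ^ m" by (simp flip: power_add)
  ultimately show ?thesis by (simp add: average_def nlen_def)
qed

lemma pspace_average_num:
  assumes V: "pspace (\<lambda>n. V (decode n))" and M: "polyspace_martingale M"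
    and m: "pspace m" "small m"
  shows "pspace (\<lambda>e. average_num V c M (m e) e)"
proof -
  have "pspace (\<lambda>e. 2 ^ m e)" by (intro pspace_power m)
  note p = pspace_comp[OF this]
  show ?thesis
    unfolding average_num_def
    by (intro pspace_mult pspace_power pspace_nlen small_nlen pspace_id pspace_sum pspace_consistent[OF V]
        pspace_saver_num[OF M] pspace_add p pspace_pfst pspace_psnd)
qed

section \<open>Output in lowest terms and conclusion\<close>

lemma quotient_of_nat_div:
  assumes "0 < d"
  shows "quotient_of (of_nat a / of_nat d) = (int (a div gcd a d), int (d div gcd a d))"
proof -
  have "of_nat a / of_nat d = Fract (int a) (int d)" by (simp add: Fract_of_int_quotient)
  then show ?thesis using assms by (simp add: quotient_of_Fract Rat.normalize_def Let_def zdiv_int)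
qed

lemma polyspace_computable_rat_syms:
  assumes a: "pspace a" "\<And>n. 0 < a n" and d: "pspace d" "\<And>n. 0 < d n"
    and r: "\<And>x. r x = of_nat (a (code x)) / of_nat (d (code x))"
  shows "polyspace_computable (\<lambda>x. rat_syms (r x))"
proof -
  let ?g = "\<lambda>n. gcd (a n) (d n)"
  let ?u = "\<lambda>n. a n div ?g n" and ?v = "\<lambda>n. d n div ?g n"
  let ?U = "\<lambda>n. undigs 5 (bits_syms (binary n))"
  have g: "pspace ?g" by (rule pspace_gcd[OF a(1) d(1) a(2)])
  have u: "pspace ?u" and v: "pspace ?v" by (intro pspace_div a d g)+
  have "0 < ?u n" for n using a(2)[of n] by (simp add: div_greater_zero_iff gcd_le1_nat)
  then have len: "length (binary (?u n)) = Suc (nlen (?u n))" for n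
    by (rule length_binary_pos)
  \<comment> \<open>Concatenation in base 5: the word of the numerator fills the low digits,
    followed by 4 for the separator and by the word of the denominator.\<close>
  have "pspace (\<lambda>n. ?U (?u n) + 5 ^ Suc (nlen (?u n)) * (4 + 5 * ?U (?v n)))"
    unfolding power_Suc
    by (intro pspace_add pspace_mult pspace_const pspace_power pspace_nlen small_nlen u v
        pspace_undigs_bits) simp_all
  then show ?thesis
  proof (rule polyspace_computable_pspace)
    show "set (rat_syms (r x)) \<subseteq> {2, 3, 4}" for x by (auto simp: rat_syms_def bits_syms_def)
    fix x
    show "?U (?u (code x)) + 5 ^ Suc (nlen (?u (code x))) * (4 + 5 * ?U (?v (code x))) =
        undigs 5 (rat_syms (r x))"
      unfolding rat_syms_def r quotient_of_nat_div[OF d(2)] fst_conv snd_conv nat_int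
      by (simp add: horner_sum_append len)
  qed
qed

text \<open>Every coefficient is rounded up to a natural number, negative ones to 0; the argument is
  nonnegative.\<close>

lemma real_poly_le_nat_poly: "\<exists>q :: nat poly. \<forall>n. poly p (real n) \<le> real (poly q n)"
proof (induction p)
  case 0
  show ?case by (intro exI[of _ 0]) simp
next
  case (pCons a p)
  then obtain q :: "nat poly" where q: "\<And>n. poly p (real n) \<le> real (poly q n)" by blast
  have "a \<le> real (nat \<lceil>a\<rceil>)" by linarith
  then have "poly (pCons a p) (real n) \<le> real (poly (pCons (nat \<lceil>a\<rceil>) q) n)" for n
    using mult_left_mono[OF q, of "real n" n] by (simp add: add_mono)
  then show ?case by blast
qed

theorem theorem4p5:
  fixes V :: "bool list \<Rightarrow> nat" and g :: "nat \<Rightarrow> nat" and Z :: "nat set"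
  assumes "polyspace_scanning_function V"
    and "polynomial_function g"
    and "filling g V"
    and "polyspace_random Z"
  shows "polyspace_random (scan Z V)"
  unfolding polyspace_random_def
proof
  assume "\<exists>M. polyspace_martingale M \<and> succeeds_on M (scan Z V)"
  then obtain M where M: "polyspace_martingale M" and succ: "succeeds_on M (scan Z V)" by blast
  have V: "scanning_function V" "pspace (\<lambda>n. V (decode n))"
    using assms(1) pspace_scanning_function by (auto simp: polyspace_scanning_function_def)
  have mart: "martingale M" using M by (simp add: polyspace_martingale_def)
  obtain c :: nat where c: "M [] + 1 \<le> of_nat c" using real_arch_simple[of "real_of_rat (M [] + 1)"] by (metis of_rat_less_eq of_rat_of_nat_eq)
  obtain p where p: "\<And>n. real (g n) = poly p (real n)"
    using assms(2) by (auto simp: polynomial_function_def)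
  obtain q where q: "\<And>n. poly p (real n) \<le> real (poly q n)" using real_poly_le_nat_poly by blast
  \<comment> \<open>Adding \<open>n + 1\<close> gives both \<open>g n < h n\<close> and
    \<open>n \<le> h n\<close>. The natural coefficients make \<open>h\<close> monotone even where
    \<open>g\<close> is not.\<close>
  define h where "h = poly (q + [:1, 1:])"
  have gh: "g n < h n" and nh: "n \<le> h n" for n
    using p[of n] q[of n] by (auto simp: h_def)
  have mono: "mono h" unfolding h_def by (intro monoI poly_nat_mono)
  \<comment> \<open>\<open>filling\<close> also counts the query that a string of length
    \<open>g n\<close> asks at its end without receiving an answer; the strict inequality
    \<open>g n < h n\<close> places the answer inside the run.\<close>
  have fill: "queries_below V (h n) n" for n
    unfolding queries_below_def
  proof (intro allI impI)
    fix \<alpha> :: "bool list" and r assume *: "length \<alpha> = h n" "r < n"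
    then have "length (take (g n) \<alpha>) = g n" using gh[of n] by simp
    then obtain i where "i \<le> g n" "V (take i (take (g n) \<alpha>)) = r"
      using assms(3) * unfolding filling_def by metis
    then show "\<exists>i<h n. V (take i \<alpha>) = r" using gh[of n] by (intro exI[of _ i]) (auto simp: min_def)
  qed
  define L where "L x = average V (saver c M) (h (length x)) x" for x
  have pos: "0 < saver c M \<alpha>" for \<alpha>
    using saver_ge_halvings[OF mart c, of \<alpha>] of_nat_0_le_iff le_less_trans by blast
  have L: "martingale L"
    unfolding L_def by (rule average_martingale[OF V(1) saver_fair pos fill mono])
  have "polyspace_computable (\<lambda>x. rat_syms (L x))"
  proof (rule polyspace_computable_rat_syms)
    let ?m = "\<lambda>e. h (nlen e)"
    let ?a = "\<lambda>e. average_num V c M (?m e) e"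
    have m: "pspace ?m" "small ?m"
      unfolding h_def by (intro pspace_poly pspace_nlen pspace_id small_poly small_nlen)+
    show "pspace ?a" by (rule pspace_average_num[OF V(2) M m])
    show "pspace (\<lambda>e. 2 ^ (3 * ?m e))" by (intro pspace_power pspace_mult pspace_const m small_mult small_const)
    have eq: "L (decode e) = of_nat (?a e) / of_nat (2 ^ (3 * ?m e))" for e
      unfolding L_def nlen_eq by (rule average_num_eq[OF mart c])
    show "0 < ?a e" for e
    proof -
      have "0 < L (decode e)" using L by (simp add: martingale_def)
      then show ?thesis unfolding eq by (auto intro: Nat.gr0I)
    qed
    show "0 < (2::nat) ^ (3 * ?m e)" for e by simp
    show "L x = of_nat (?a (code x)) / of_nat (2 ^ (3 * ?m (code x)))" for x
      using eq[of "code x"] by (simp only: decode_code)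
  qed
  then have "polyspace_martingale L" using L by (simp add: polyspace_martingale_def)
  moreover have "succeeds_on L Z"
    unfolding L_def by (rule average_saver_succeeds[OF V(1) mart c succ fill nh])
  ultimately show False using assms(4) by (auto simp: polyspace_random_def)
qed

end
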